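(* Let $\Psi$ be a regular solution of the von Kármán equations and let $\Psi_{IP}=(u_{IP},v_{IP})\in S^2_0(\mathcal T)\times S^2_0(\mathcal T)$ be the (local) solution of the $C^0$ interior penalty scheme $$a_{IP}(u_{IP},\varphi_1)+b_{dG}(u_{IP},v_{IP},\varphi_1)+b_{dG}(v_{IP},u_{IP},\varphi_1)=l_{dG}(\varphi_1)\quad\text{for all }\varphi_1\in S^2_0(\mathcal T),$$ $$a_{IP}(v_{IP},\varphi_2)-b_{dG}(u_{IP},u_{IP},\varphi_2)=0\quad\text{for all }\varphi_2\in S^2_0(\mathcal T).$$ For sufficiently large $\sigma_2$ and sufficiently small $h$, it holds $$|||\Psi-\Psi_{IP}|||_{IP}\le C h^{\alpha}$$ with a constant $C$ independent of $h$.
   Context: Continuous problem. $\Omega\subset\mathbb R^2$ is a bounded polygonal domain, $X:=H^2_0(\Omega)$, and bold letters denote products ($\boldsymbol X=X\times X$, $\boldsymbol H^s=H^s\times H^s$, etc.). $\alpha\in(1/2,1]$ is the index of elliptic regularity of $\Omega$: solutions $w\in H^2_0(\Omega)$ of $\Delta^2w=g$ with $g\in H^{-1}(\Omega)$ lie in $H^{2+\alpha}(\Omega)$ (with norm bound). The von Kármán bracket is $[\eta,\chi]=\eta_{xx}\chi_{yy}+\eta_{yy}\chi_{xx}-2\eta_{xy}\chi_{xy}$. For $f\in L^2(\Omega)$ put $a(\eta,\chi)=\int_\Omega D^2\eta:D^2\chi\,dx$, $b(\eta,\chi,\varphi)=-\frac12\int_\Omega[\eta,\chi]\varphi\,dx$,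 $l(\varphi)=\int_\Omega f\varphi\,dx$, and for $\Xi=(\xi_1,\xi_2),\Theta=(\theta_1,\theta_2),\Phi=(\varphi_1,\varphi_2)\in\boldsymbol X$: $A(\Theta,\Phi)=a(\theta_1,\varphi_1)+a(\theta_2,\varphi_2)$, $B(\Xi,\Theta,\Phi)=b(\xi_1,\theta_2,\varphi_1)+b(\xi_2,\theta_1,\varphi_1)-b(\xi_1,\theta_1,\varphi_2)$, $L(\Phi)=l(\varphi_1)$, $|||\Phi|||_2=(|\varphi_1|_{H^2(\Omega)}^2+|\varphi_2|_{H^2(\Omega)}^2)^{1/2}$. A regular solution is $\Psi=(u,v)\in\boldsymbol X$ with $A(\Psi,\Phi)+B(\Psi,\Psi,\Phi)-L(\Phi)=0$ for all $\Phi\in\boldsymbol X$ (weak form of $\Delta^2u=[u,v]+f$, $\Delta^2v=-\frac12[u,u]$) such that $$0<\beta:=\inf_{\Theta\in \boldsymbol X,\,|||\Theta|||_2=1}\ \sup_{\Phi\in \boldsymbol X,\,|||\Phi|||_2=1}\big(A(\Theta,\Phi)+2B(\Psi,\Theta,\Phi)\big).$$ Regular solutions belong to $\boldsymbol H^{2+\alpha}(\Omega)$. Discretization. $\mathcal T$ ranges over a shape-regular family of triangulations of $\Omega$ into closed triangles; $h_K=\mathrm{diam}\,K$, $h=\max_{K\in\mathcal T} h_K$; $\mathcal E$ is the set of all edges (interior and boundary), $h_E$ the length and $\nu_E$ a unit normal of $E\in\mathcal E$. $P_2(\mathcal T)$ is the space of piecewise polynomials of degree $\le2$, $S^2_0(\mathcal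 T)=P_2(\mathcal T)\cap H^1_0(\Omega)$, $\boldsymbol S^2_0(\mathcal T)=S^2_0(\mathcal T)^2$. For an interior edge $E=\partial K_+\cap\partial K_-$: $[\varphi]_E=\varphi|_{K_+}-\varphi|_{K_-}$, $\langle\varphi\rangle_E=\frac12(\varphi|_{K_+}+\varphi|_{K_-})$; for a boundary edge $[\varphi]_E=\langle\varphi\rangle_E=\varphi|_E$ (componentwise for vector functions). For a penalty parameter $\sigma_2>0$: $$a_{IP}(\eta,\chi)=\sum_{K\in\mathcal T}\int_K D^2\eta:D^2\chi\,dx-\sum_{E\in\mathcal E}\int_E\langle D^2\eta\,\nu_E\rangle_E\cdot[\nabla\chi]_E\,ds-\sum_{E\in\mathcal E}\int_E\langle D^2\chi\,\nu_E\rangle_E\cdot[\nabla\eta]_E\,ds+\sum_{E\in\mathcal E}\frac{\sigma_2}{h_E}\int_E[\nabla\eta\cdot\nu_E]_E[\nabla\chi\cdot\nu_E]_E\,ds,$$ $b_{dG}(\eta,\chi,\varphi)=-\frac12\sum_K\int_K[\eta,\chi]\varphi\,dx$, $l_{dG}(\varphi)=\sum_K\int_Kf\varphi\,dx$. Norms: $\|\varphi\|_{IP}^2=\sum_K|\varphi|_{H^2(K)}^2+\sum_{E\in\mathcal E}\frac{\sigma_2}{h_E}\|[\nabla\varphi\cdot\nu_E]_E\|_{L^2(E)}^2$, $|||\Phi|||_{IP}^2=\|\varphi_1\|_{IP}^2+\|\varphi_2\|_{IP}^2$. Local discrete solution. Write $A_{IP}(\Theta,\Phi)=a_{IP}(\theta_1,\varphi_1)+a_{IP}(\theta_2,\varphi_2)$,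 $B_{dG}(\Xi,\Theta,\Phi)=b_{dG}(\xi_1,\theta_2,\varphi_1)+b_{dG}(\xi_2,\theta_1,\varphi_1)-b_{dG}(\xi_1,\theta_1,\varphi_2)$, $L_{dG}(\Phi)=l_{dG}(\varphi_1)$, and let $\Pi_h\Psi\in\boldsymbol S^2_0(\mathcal T)$ be a fixed interpolant of $\Psi$ with $|||\Psi-\Pi_h\Psi|||_{IP}\le Ch^\alpha\|\Psi\|_{\boldsymbol H^{2+\alpha}(\Omega)}$ (and the same bound including the additional edge terms $h_E^{1/2}\|\langle D^2(\cdot)\rangle_E\|_{L^2(E)}$ in the norm). For sufficiently large $\sigma_2$ and sufficiently small $h$, the map $\mu:\boldsymbol S^2_0(\mathcal T)\to\boldsymbol S^2_0(\mathcal T)$ is well defined by $A_{IP}(\mu(\Theta),\Phi)+2B_{dG}(\Pi_h\Psi,\mu(\Theta),\Phi)=L_{dG}(\Phi)+2B_{dG}(\Pi_h\Psi,\Theta,\Phi)-B_{dG}(\Theta,\Theta,\Phi)$ for all $\Phi\in\boldsymbol S^2_0(\mathcal T)$; let $R(h)=2C_1h^\alpha$, where $C_1>0$ is an $h$-independent constant with $|||\mu(\Theta)-\Pi_h\Psi|||_{IP}\le C_1(h^\alpha+|||\Theta-\Pi_h\Psi|||_{IP}^2)$ for all $\Theta\in\boldsymbol S^2_0(\mathcal T)$. The local solution $\Psi_{IP}$ is the unique solution of the scheme with $|||\Psi_{IP}-\Pi_h\Psi|||_{IP}\le R(h)$ (which exists for sufficiently large $\sigma_2$ and sufficiently small $h$).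 Convention. "For sufficiently large $\sigma_2$ and sufficiently small $h$ ..." means: there exists $\underline\sigma_2$ such that for all $\sigma_2\ge\underline\sigma_2$ (large enough that $a_{IP}$ is elliptic on $S^2_0(\mathcal T)$ with respect to $\|\cdot\|_{IP}$, uniformly in $h$), there exists $h(\sigma_2)>0$ such that for all $\mathcal T$ with $h\le h(\sigma_2)$ the assertion holds. *)

theory Defs
  imports "HOL-Analysis.Analysis"
begin

type_synonym plane = "real^2"
type_synonym fn = "plane \<Rightarrow> real"
type_synonym fn2 = "fn \<times> fn"
type_synonym mesh = "plane set set"

text \<open>
  Elements of Lebesgue and Sobolev spaces are represented by functions; two functions that agree
  almost everywhere represent the same element.
\<close>

definition L2 :: "'a measure \<Rightarrow> ('a \<Rightarrow> real) set" where
  "L2 M = {f \<in> borel_measurable M. integrable M (\<lambda>x. (f x)\<^sup>2)}"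

definition L2_norm :: "'a measure \<Rightarrow> ('a \<Rightarrow> real) \<Rightarrow> real" where
  "L2_norm M f = sqrt (\<integral>x. (f x)\<^sup>2 \<partial>M)"

definition pderiv2 :: "2 \<Rightarrow> fn \<Rightarrow> fn" where
  "pderiv2 i f = (\<lambda>x. frechet_derivative f (at x) (axis i 1))"

text \<open>Infinitely differentiable: differentiability of all iterated partials makes them continuous.\<close>

definition smooth :: "fn \<Rightarrow> bool" where
  "smooth f \<longleftrightarrow> (\<forall>is x. foldr pderiv2 is f differentiable (at x))"

definition test_fns :: "plane set \<Rightarrow> fn set" where
  "test_fns S = {\<phi>. smooth \<phi> \<and> compact (closure {x. \<phi> x \<noteq> 0}) \<and> closure {x. \<phi> x \<noteq> 0} \<subseteq> S}"

definition locally_integrable :: "plane set \<Rightarrow> fn \<Rightarrow> bool" where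
  "locally_integrable S f \<longleftrightarrow> (\<forall>C. compact C \<and> C \<subseteq> S \<longrightarrow> integrable (lebesgue_on C) f)"

definition is_weak_deriv :: "plane set \<Rightarrow> 2 \<Rightarrow> fn \<Rightarrow> fn \<Rightarrow> bool" where
  "is_weak_deriv S i f g \<longleftrightarrow> locally_integrable S f \<and> locally_integrable S g \<and>
     (\<forall>\<phi>\<in>test_fns S. (\<integral>x. f x * pderiv2 i \<phi> x \<partial>lebesgue_on S) = - (\<integral>x. g x * \<phi> x \<partial>lebesgue_on S))"

text \<open>The weak derivative is determined up to a null set; any representative may be chosen.\<close>

definition weak_deriv :: "plane set \<Rightarrow> 2 \<Rightarrow> fn \<Rightarrow> fn" where
  "weak_deriv S i f = (SOME g. is_weak_deriv S i f g)"

definition D2 :: "plane set \<Rightarrow> 2 \<Rightarrow> 2 \<Rightarrow> fn \<Rightarrow> fn" where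
  "D2 S i j f = weak_deriv S i (weak_deriv S j f)"

primrec sobolev :: "nat \<Rightarrow> plane set \<Rightarrow> fn set" where
  "sobolev 0 S = L2 (lebesgue_on S)"
| "sobolev (Suc k) S = {f \<in> L2 (lebesgue_on S).
     \<forall>i. (\<exists>g. is_weak_deriv S i f g) \<and> weak_deriv S i f \<in> sobolev k S}"

primrec sobolev_norm_sq :: "nat \<Rightarrow> plane set \<Rightarrow> fn \<Rightarrow> real" where
  "sobolev_norm_sq 0 S f = (L2_norm (lebesgue_on S) f)\<^sup>2"
| "sobolev_norm_sq (Suc k) S f =
     (L2_norm (lebesgue_on S) f)\<^sup>2 + (\<Sum>i\<in>UNIV. sobolev_norm_sq k S (weak_deriv S i f))"

definition sobolev_norm :: "nat \<Rightarrow> plane set \<Rightarrow> fn \<Rightarrow> real" where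
  "sobolev_norm k S f = sqrt (sobolev_norm_sq k S f)"

definition sobolev0 :: "nat \<Rightarrow> plane set \<Rightarrow> fn set" where
  "sobolev0 k S = {f \<in> sobolev k S.
     \<exists>\<phi>. (\<forall>n. \<phi> n \<in> test_fns S) \<and> (\<lambda>n. sobolev_norm k S (\<lambda>x. f x - \<phi> n x)) \<longlonglongrightarrow> 0}"

text \<open>
  \<open>fsobolev k s S\<close> is the space of order k + s for 0 < s \<le> 1: a Sobolev-Slobodeckij space
  for s < 1, and the Sobolev space of integer order k + 1 for s = 1.
\<close>

definition slobodeckij_kernel :: "real \<Rightarrow> fn \<Rightarrow> plane \<times> plane \<Rightarrow> real" where
  "slobodeckij_kernel s f = (\<lambda>(x, y). (f x - f y)\<^sup>2 / norm (x - y) powr (2 + 2 * s))"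

primrec fsobolev :: "nat \<Rightarrow> real \<Rightarrow> plane set \<Rightarrow> fn set" where
  "fsobolev 0 s S = (if s = 1 then sobolev 1 S else
     {f \<in> L2 (lebesgue_on S). integrable (lebesgue_on S \<Otimes>\<^sub>M lebesgue_on S) (slobodeckij_kernel s f)})"
| "fsobolev (Suc k) s S = {f \<in> L2 (lebesgue_on S).
     \<forall>i. (\<exists>g. is_weak_deriv S i f g) \<and> weak_deriv S i f \<in> fsobolev k s S}"

primrec fsobolev_norm_sq :: "nat \<Rightarrow> real \<Rightarrow> plane set \<Rightarrow> fn \<Rightarrow> real" where
  "fsobolev_norm_sq 0 s S f = (if s = 1 then sobolev_norm_sq 1 S f else
     (L2_norm (lebesgue_on S) f)\<^sup>2 +
     (\<integral>z. slobodeckij_kernel s f z \<partial>(lebesgue_on S \<Otimes>\<^sub>M lebesgue_on S)))"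
| "fsobolev_norm_sq (Suc k) s S f =
     (L2_norm (lebesgue_on S) f)\<^sup>2 + (\<Sum>i\<in>UNIV. fsobolev_norm_sq k s S (weak_deriv S i f))"

definition fsobolev_norm :: "nat \<Rightarrow> real \<Rightarrow> plane set \<Rightarrow> fn \<Rightarrow> real" where
  "fsobolev_norm k s S f = sqrt (fsobolev_norm_sq k s S f)"

definition fsobolev_norm2 :: "nat \<Rightarrow> real \<Rightarrow> plane set \<Rightarrow> fn2 \<Rightarrow> real" where
  "fsobolev_norm2 k s S F = sqrt ((fsobolev_norm k s S (fst F))\<^sup>2 + (fsobolev_norm k s S (snd F))\<^sup>2)"

definition H2_seminorm :: "plane set \<Rightarrow> fn \<Rightarrow> real" where
  "H2_seminorm S f = sqrt (\<Sum>i\<in>UNIV. \<Sum>j\<in>UNIV. (L2_norm (lebesgue_on S) (D2 S i j f))\<^sup>2)"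

definition polygon_curve :: "plane set \<Rightarrow> bool" where
  "polygon_curve J \<longleftrightarrow>
     (\<exists>g. simple_path g \<and> pathfinish g = pathstart g \<and> path_image g = J) \<and>
     (\<exists>V. finite V \<and> J = (\<Union>(a, b)\<in>V. closed_segment a b))"

text \<open>Holes are allowed; disjointness of the boundary polygons excludes slits and pinch points.\<close>

definition polygonal_domain :: "plane set \<Rightarrow> bool" where
  "polygonal_domain \<Omega> \<longleftrightarrow> open \<Omega> \<and> connected \<Omega> \<and> \<Omega> \<noteq> {} \<and>
     (\<exists>\<J>. finite \<J> \<and> disjoint \<J> \<and> (\<forall>J\<in>\<J>. polygon_curve J) \<and> frontier \<Omega> = \<Union>\<J>)"

definition hess_form :: "plane set \<Rightarrow> fn \<Rightarrow> fn \<Rightarrow> real" where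
  "hess_form S \<eta> \<zeta> = (\<integral>x. (\<Sum>i\<in>UNIV. \<Sum>j\<in>UNIV. D2 S i j \<eta> x * D2 S i j \<zeta> x) \<partial>lebesgue_on S)"

definition vk_bracket :: "plane set \<Rightarrow> fn \<Rightarrow> fn \<Rightarrow> fn" where
  "vk_bracket S \<eta> \<zeta> = (\<lambda>x. D2 S 1 1 \<eta> x * D2 S 2 2 \<zeta> x + D2 S 2 2 \<eta> x * D2 S 1 1 \<zeta> x
     - 2 * D2 S 1 2 \<eta> x * D2 S 1 2 \<zeta> x)"

definition vk_trilinear :: "plane set \<Rightarrow> fn \<Rightarrow> fn \<Rightarrow> fn \<Rightarrow> real" where
  "vk_trilinear S \<eta> \<zeta> \<phi> = - (1/2) * (\<integral>x. vk_bracket S \<eta> \<zeta> x * \<phi> x \<partial>lebesgue_on S)"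

definition load :: "plane set \<Rightarrow> fn \<Rightarrow> fn \<Rightarrow> real" where
  "load S f \<phi> = (\<integral>x. f x * \<phi> x \<partial>lebesgue_on S)"

definition pair_A :: "(fn \<Rightarrow> fn \<Rightarrow> real) \<Rightarrow> fn2 \<Rightarrow> fn2 \<Rightarrow> real" where
  "pair_A a \<Theta> \<Phi> = a (fst \<Theta>) (fst \<Phi>) + a (snd \<Theta>) (snd \<Phi>)"

definition pair_B :: "(fn \<Rightarrow> fn \<Rightarrow> fn \<Rightarrow> real) \<Rightarrow> fn2 \<Rightarrow> fn2 \<Rightarrow> fn2 \<Rightarrow> real" where
  "pair_B b \<Xi> \<Theta> \<Phi> = b (fst \<Xi>) (snd \<Theta>) (fst \<Phi>) + b (snd \<Xi>) (fst \<Theta>) (fst \<Phi>)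
     - b (fst \<Xi>) (fst \<Theta>) (snd \<Phi>)"

definition pair_L :: "(fn \<Rightarrow> real) \<Rightarrow> fn2 \<Rightarrow> real" where
  "pair_L l \<Phi> = l (fst \<Phi>)"

definition X2 :: "plane set \<Rightarrow> fn2 set" where
  "X2 \<Omega> = sobolev0 2 \<Omega> \<times> sobolev0 2 \<Omega>"

definition norm_X2 :: "plane set \<Rightarrow> fn2 \<Rightarrow> real" where
  "norm_X2 \<Omega> \<Phi> = sqrt ((H2_seminorm \<Omega> (fst \<Phi>))\<^sup>2 + (H2_seminorm \<Omega> (snd \<Phi>))\<^sup>2)"

text \<open>Extended reals, so that neither the infimum nor the supremum needs a boundedness proof.\<close>

definition inf_sup_const :: "plane set \<Rightarrow> fn2 \<Rightarrow> ereal" where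
  "inf_sup_const \<Omega> \<Psi> =
     (INF \<Theta>\<in>{\<Theta>\<in>X2 \<Omega>. norm_X2 \<Omega> \<Theta> = 1}. SUP \<Phi>\<in>{\<Phi>\<in>X2 \<Omega>. norm_X2 \<Omega> \<Phi> = 1}.
        ereal (pair_A (hess_form \<Omega>) \<Theta> \<Phi> + 2 * pair_B (vk_trilinear \<Omega>) \<Psi> \<Theta> \<Phi>))"

definition regular_solution :: "plane set \<Rightarrow> fn \<Rightarrow> fn2 \<Rightarrow> bool" where
  "regular_solution \<Omega> f \<Psi> \<longleftrightarrow> \<Psi> \<in> X2 \<Omega> \<and>
     (\<forall>\<Phi>\<in>X2 \<Omega>. pair_A (hess_form \<Omega>) \<Psi> \<Phi> + pair_B (vk_trilinear \<Omega>) \<Psi> \<Psi> \<Phi> - pair_L (load \<Omega> f) \<Phi> = 0) \<and>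
     0 < inf_sup_const \<Omega> \<Psi>"

text \<open>\<open>G\<close> represents an element of the dual of \<open>sobolev0 1 \<Omega>\<close> of dual norm at most \<open>M\<close>.\<close>

definition dual_bounded :: "plane set \<Rightarrow> (fn \<Rightarrow> real) \<Rightarrow> real \<Rightarrow> bool" where
  "dual_bounded \<Omega> G M \<longleftrightarrow>
     (\<forall>\<phi>\<in>sobolev0 1 \<Omega>. \<forall>\<zeta>\<in>sobolev0 1 \<Omega>. G (\<lambda>x. \<phi> x + \<zeta> x) = G \<phi> + G \<zeta>) \<and>
     (\<forall>c. \<forall>\<phi>\<in>sobolev0 1 \<Omega>. G (\<lambda>x. c * \<phi> x) = c * G \<phi>) \<and>
     (\<forall>\<phi>\<in>sobolev0 1 \<Omega>. \<bar>G \<phi>\<bar> \<le> M * sobolev_norm 1 \<Omega> \<phi>)"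

text \<open>Weak solutions of the biharmonic equation with right-hand side in the dual space.\<close>

definition elliptic_regularity :: "plane set \<Rightarrow> real \<Rightarrow> bool" where
  "elliptic_regularity \<Omega> \<alpha> \<longleftrightarrow> (\<exists>C. \<forall>w\<in>sobolev0 2 \<Omega>. \<forall>G M.
     dual_bounded \<Omega> G M \<and> (\<forall>\<phi>\<in>sobolev0 2 \<Omega>. hess_form \<Omega> w \<phi> = G \<phi>) \<longrightarrow>
       w \<in> fsobolev 2 \<alpha> \<Omega> \<and> fsobolev_norm 2 \<alpha> \<Omega> w \<le> C * M)"

text \<open>
  The library notion of triangulation requires two triangles to meet in a common face, so there
  are no hanging nodes and an edge belongs to at most two triangles.
\<close>

definition triangulates :: "mesh \<Rightarrow> plane set \<Rightarrow> bool" where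
  "triangulates T \<Omega> \<longleftrightarrow> triangulation T \<and> (\<forall>K\<in>T. 2 simplex K) \<and> \<Union>T = closure \<Omega>"

definition shape_regular :: "mesh set \<Rightarrow> bool" where
  "shape_regular \<T> \<longleftrightarrow> (\<exists>\<gamma>>0. \<forall>T\<in>\<T>. \<forall>K\<in>T. \<exists>x. cball x (\<gamma> * diameter K) \<subseteq> K)"

definition mesh_size :: "mesh \<Rightarrow> real" where
  "mesh_size T = Max (diameter ` T)"

definition mesh_edges :: "mesh \<Rightarrow> plane set set" where
  "mesh_edges T = {E. \<exists>K\<in>T. E facet_of K}"

definition interior_edge :: "mesh \<Rightarrow> plane set \<Rightarrow> bool" where
  "interior_edge T E \<longleftrightarrow> (\<exists>K\<in>T. \<exists>K'\<in>T. K \<noteq> K' \<and> E facet_of K \<and> E facet_of K')"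

definition K_plus :: "mesh \<Rightarrow> plane set \<Rightarrow> plane set" where
  "K_plus T E = (SOME K. K \<in> T \<and> E facet_of K)"

definition K_minus :: "mesh \<Rightarrow> plane set \<Rightarrow> plane set" where
  "K_minus T E = (THE K. K \<in> T \<and> E facet_of K \<and> K \<noteq> K_plus T E)"

text \<open>
  The unit normal of an edge points out of \<open>K_plus\<close>, so that it is consistent with the
  sign of the jump, and outward at boundary edges.
\<close>

definition edge_normal :: "mesh \<Rightarrow> plane set \<Rightarrow> plane" where
  "edge_normal T E =
     (THE n. norm n = 1 \<and> (\<forall>x\<in>K_plus T E. \<forall>y\<in>E. n \<bullet> (x - y) \<le> 0))"

definition edge_param :: "plane set \<Rightarrow> real \<Rightarrow> plane" where
  "edge_param E = (SOME p. \<exists>a b. E = closed_segment a b \<and> p = linepath a b)"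

text \<open>Arc length measure on a segment.\<close>

definition edge_measure :: "plane set \<Rightarrow> plane measure" where
  "edge_measure E =
     scale_measure (ennreal (diameter E)) (distr (lebesgue_on {0..1}) borel (edge_param E))"

text \<open>
  The trace on an edge E of a triangle K of a function of order s in (1/2,1] on K: the continuous
  extension of the restriction map from smooth functions.
\<close>

definition has_edge_trace :: "real \<Rightarrow> plane set \<Rightarrow> plane set \<Rightarrow> fn \<Rightarrow> fn \<Rightarrow> bool" where
  "has_edge_trace s K E v g \<longleftrightarrow> v \<in> fsobolev 0 s (interior K) \<and> g \<in> L2 (edge_measure E) \<and>
     (\<exists>\<phi>. (\<forall>n. smooth (\<phi> n)) \<and>
        (\<lambda>n. fsobolev_norm 0 s (interior K) (\<lambda>x. v x - \<phi> n x)) \<longlonglongrightarrow> 0 \<and>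
        (\<lambda>n. L2_norm (edge_measure E) (\<lambda>x. g x - \<phi> n x)) \<longlonglongrightarrow> 0)"

definition edge_trace :: "real \<Rightarrow> plane set \<Rightarrow> plane set \<Rightarrow> fn \<Rightarrow> fn" where
  "edge_trace s K E v = (SOME g. has_edge_trace s K E v g)"

definition edge_jump :: "mesh \<Rightarrow> plane set \<Rightarrow> (plane set \<Rightarrow> fn) \<Rightarrow> fn" where
  "edge_jump T E t = (\<lambda>x. if interior_edge T E then t (K_plus T E) x - t (K_minus T E) x
     else t (K_plus T E) x)"

definition edge_avg :: "mesh \<Rightarrow> plane set \<Rightarrow> (plane set \<Rightarrow> fn) \<Rightarrow> fn" where
  "edge_avg T E t = (\<lambda>x. if interior_edge T E then (t (K_plus T E) x + t (K_minus T E) x) / 2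
     else t (K_plus T E) x)"

definition grad_jump :: "mesh \<Rightarrow> plane set \<Rightarrow> 2 \<Rightarrow> fn \<Rightarrow> fn" where
  "grad_jump T E i \<phi> = edge_jump T E (\<lambda>K. edge_trace 1 K E (weak_deriv (interior K) i \<phi>))"

definition normal_jump :: "mesh \<Rightarrow> plane set \<Rightarrow> fn \<Rightarrow> fn" where
  "normal_jump T E \<phi> = (\<lambda>x. \<Sum>i\<in>UNIV. grad_jump T E i \<phi> x * edge_normal T E $ i)"

definition hess_avg :: "real \<Rightarrow> mesh \<Rightarrow> plane set \<Rightarrow> 2 \<Rightarrow> 2 \<Rightarrow> fn \<Rightarrow> fn" where
  "hess_avg s T E i j \<phi> = edge_avg T E (\<lambda>K. edge_trace s K E (D2 (interior K) i j \<phi>))"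

definition quadratic :: "fn \<Rightarrow> bool" where
  "quadratic q \<longleftrightarrow> (\<exists>a b c d e g. \<forall>x. q x =
     a + b * x$1 + c * x$2 + d * (x$1)\<^sup>2 + e * (x$1 * x$2) + g * (x$2)\<^sup>2)"

definition P2 :: "mesh \<Rightarrow> fn set" where
  "P2 T = {p. \<forall>K\<in>T. \<exists>q. quadratic q \<and> (\<forall>x\<in>interior K. p x = q x)}"

definition S20 :: "plane set \<Rightarrow> mesh \<Rightarrow> fn set" where
  "S20 \<Omega> T = P2 T \<inter> sobolev0 1 \<Omega>"

definition a_IP :: "real \<Rightarrow> mesh \<Rightarrow> fn \<Rightarrow> fn \<Rightarrow> real" where
  "a_IP \<sigma> T \<eta> \<zeta> =
     (\<Sum>K\<in>T. hess_form (interior K) \<eta> \<zeta>)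
     - (\<Sum>E\<in>mesh_edges T. \<integral>x. (\<Sum>i\<in>UNIV.
          (\<Sum>j\<in>UNIV. hess_avg 1 T E i j \<eta> x * edge_normal T E $ j) * grad_jump T E i \<zeta> x) \<partial>edge_measure E)
     - (\<Sum>E\<in>mesh_edges T. \<integral>x. (\<Sum>i\<in>UNIV.
          (\<Sum>j\<in>UNIV. hess_avg 1 T E i j \<zeta> x * edge_normal T E $ j) * grad_jump T E i \<eta> x) \<partial>edge_measure E)
     + (\<Sum>E\<in>mesh_edges T. \<sigma> / diameter E *
          (\<integral>x. normal_jump T E \<eta> x * normal_jump T E \<zeta> x \<partial>edge_measure E))"

definition b_dG :: "mesh \<Rightarrow> fn \<Rightarrow> fn \<Rightarrow> fn \<Rightarrow> real" where
  "b_dG T \<eta> \<zeta> \<phi> = (\<Sum>K\<in>T. vk_trilinear (interior K) \<eta> \<zeta> \<phi>)"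

definition l_dG :: "mesh \<Rightarrow> fn \<Rightarrow> fn \<Rightarrow> real" where
  "l_dG T f \<phi> = (\<Sum>K\<in>T. load (interior K) f \<phi>)"

definition norm_IP :: "real \<Rightarrow> mesh \<Rightarrow> fn \<Rightarrow> real" where
  "norm_IP \<sigma> T \<phi> = sqrt ((\<Sum>K\<in>T. (H2_seminorm (interior K) \<phi>)\<^sup>2)
     + (\<Sum>E\<in>mesh_edges T. \<sigma> / diameter E * (L2_norm (edge_measure E) (normal_jump T E \<phi>))\<^sup>2))"

definition norm_IP2 :: "real \<Rightarrow> mesh \<Rightarrow> fn2 \<Rightarrow> real" where
  "norm_IP2 \<sigma> T \<Phi> = sqrt ((norm_IP \<sigma> T (fst \<Phi>))\<^sup>2 + (norm_IP \<sigma> T (snd \<Phi>))\<^sup>2)"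

definition hess_avg_sq :: "real \<Rightarrow> mesh \<Rightarrow> fn \<Rightarrow> real" where
  "hess_avg_sq s T \<phi> = (\<Sum>E\<in>mesh_edges T. diameter E *
     (\<Sum>i\<in>UNIV. \<Sum>j\<in>UNIV. (L2_norm (edge_measure E) (hess_avg s T E i j \<phi>))\<^sup>2))"

definition norm_IP2_aug :: "real \<Rightarrow> real \<Rightarrow> mesh \<Rightarrow> fn2 \<Rightarrow> real" where
  "norm_IP2_aug s \<sigma> T \<Phi> =
     sqrt ((norm_IP2 \<sigma> T \<Phi>)\<^sup>2 + hess_avg_sq s T (fst \<Phi>) + hess_avg_sq s T (snd \<Phi>))"

definition ip_elliptic :: "plane set \<Rightarrow> mesh set \<Rightarrow> real \<Rightarrow> bool" where
  "ip_elliptic \<Omega> \<T> \<sigma> \<longleftrightarrow>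
     (\<exists>\<kappa>>0. \<forall>T\<in>\<T>. \<forall>\<zeta>\<in>S20 \<Omega> T. \<kappa> * (norm_IP \<sigma> T \<zeta>)\<^sup>2 \<le> a_IP \<sigma> T \<zeta> \<zeta>)"

text \<open>
  "For sufficiently large penalty parameter and sufficiently small mesh size": the threshold for
  the penalty is by convention large enough for ellipticity uniformly over the family, and the
  threshold for the mesh size may depend on the penalty.
\<close>

definition sufficiently :: "plane set \<Rightarrow> mesh set \<Rightarrow> (real \<Rightarrow> mesh \<Rightarrow> bool) \<Rightarrow> bool" where
  "sufficiently \<Omega> \<T> P \<longleftrightarrow> (\<exists>\<sigma>0>0. (\<forall>\<sigma>\<ge>\<sigma>0. ip_elliptic \<Omega> \<T> \<sigma>) \<and>
     (\<forall>\<sigma>\<ge>\<sigma>0. \<exists>h0>0. \<forall>T\<in>\<T>. mesh_size T \<le> h0 \<longrightarrow> P \<sigma> T))"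

definition ip_solution :: "plane set \<Rightarrow> fn \<Rightarrow> real \<Rightarrow> mesh \<Rightarrow> fn2 \<Rightarrow> bool" where
  "ip_solution \<Omega> f \<sigma> T U \<longleftrightarrow> (case U of (u, v) \<Rightarrow> u \<in> S20 \<Omega> T \<and> v \<in> S20 \<Omega> T \<and>
     (\<forall>\<phi>\<in>S20 \<Omega> T. a_IP \<sigma> T u \<phi> + b_dG T u v \<phi> + b_dG T v u \<phi> = l_dG T f \<phi>) \<and>
     (\<forall>\<phi>\<in>S20 \<Omega> T. a_IP \<sigma> T v \<phi> - b_dG T u u \<phi> = 0))"

definition ae_equal2 :: "plane set \<Rightarrow> fn2 \<Rightarrow> fn2 \<Rightarrow> bool" where
  "ae_equal2 \<Omega> F G \<longleftrightarrow> (AE x in lebesgue_on \<Omega>. fst F x = fst G x \<and> snd F x = snd G x)"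

text \<open>Graph of the map \<open>\<mu>\<close>, with \<open>P\<close> the interpolant about which the scheme is linearized.\<close>

definition mu_graph :: "plane set \<Rightarrow> fn \<Rightarrow> real \<Rightarrow> mesh \<Rightarrow> fn2 \<Rightarrow> fn2 \<Rightarrow> fn2 \<Rightarrow> bool" where
  "mu_graph \<Omega> f \<sigma> T P \<Theta> M \<longleftrightarrow> M \<in> S20 \<Omega> T \<times> S20 \<Omega> T \<and>
     (\<forall>\<Phi>\<in>S20 \<Omega> T \<times> S20 \<Omega> T.
        pair_A (a_IP \<sigma> T) M \<Phi> + 2 * pair_B (b_dG T) P M \<Phi> =
        pair_L (l_dG T f) \<Phi> + 2 * pair_B (b_dG T) P \<Theta> \<Phi> - pair_B (b_dG T) \<Theta> \<Theta> \<Phi>)"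

definition mu_well_defined :: "plane set \<Rightarrow> fn \<Rightarrow> real \<Rightarrow> mesh \<Rightarrow> fn2 \<Rightarrow> bool" where
  "mu_well_defined \<Omega> f \<sigma> T P \<longleftrightarrow> (\<forall>\<Theta>\<in>S20 \<Omega> T \<times> S20 \<Omega> T.
     \<exists>M. mu_graph \<Omega> f \<sigma> T P \<Theta> M \<and> (\<forall>M'. mu_graph \<Omega> f \<sigma> T P \<Theta> M' \<longrightarrow> ae_equal2 \<Omega> M' M))"

definition local_solution :: "plane set \<Rightarrow> fn \<Rightarrow> real \<Rightarrow> mesh \<Rightarrow> fn2 \<Rightarrow> real \<Rightarrow> fn2 \<Rightarrow> bool" where
  "local_solution \<Omega> f \<sigma> T P R U \<longleftrightarrow> ip_solution \<Omega> f \<sigma> T U \<and> norm_IP2 \<sigma> T (U - P) \<le> R \<and>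
     (\<forall>U'. ip_solution \<Omega> f \<sigma> T U' \<and> norm_IP2 \<sigma> T (U' - P) \<le> R \<longrightarrow> ae_equal2 \<Omega> U' U)"

end

theory Submission
  imports Defs
begin

text \<open>
  The error splits at the interpolant. The distance from \<open>\<Psi>\<close> to its interpolant is of order
  \<open>h powr \<alpha>\<close> by the approximation property, and the local discrete solution lies by definition in
  a ball of radius \<open>2 C1 h powr \<alpha>\<close> about the interpolant. The theorem is therefore a triangle
  inequality for the energy norm, \<open>norm_IP2_diff\<close>.

  The work is to prove this inequality for the norm as it is defined, in which weak derivatives and
  edge traces are chosen representatives. A choice is not additive; it becomes so almost everywhere
  once existence and uniqueness are known.

  Weak derivatives are unique by \<open>fundamental_lemma_of_calculus_of_variations\<close>. Traces are unique
  because of \<open>trace_inequality\<close>, which bounds a smooth function on an edge by its \<open>H\<^sup>1\<close> norm on the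
  triangle. Together with \<open>L2_complete\<close> the same inequality yields a trace for every \<open>H\<^sup>1\<close> limit of
  functions that are smooth on the whole plane.

  All functions in the theorem are, with their gradients, such limits on each triangle
  (\<open>broken_H2\<close>). For discrete functions this is clear, as they are polynomials there. The components
  of \<open>\<Psi>\<close> are \<open>H\<^sup>2\<close> limits of test functions on \<open>\<Omega>\<close>; these are smooth on the plane, and as the
  boundary of \<open>\<Omega>\<close> is a null set, the limits can be taken on the interior of any triangle.

  Finally, the jump across an interior edge refers to the other triangle at the edge. By
  \<open>at_most_two_triangles\<close> there is exactly one: of three apexes two would lie on the same side of
  the edge, and their triangles would overlap in more than a common face.
\<close>


section \<open>Smooth functions\<close>

lemma smooth_differentiable: "smooth f \<Longrightarrow> f differentiable (at x)"
  unfolding smooth_def by (metis foldr.simps(1) id_apply)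

lemma smooth_pderiv2: "smooth f \<Longrightarrow> smooth (pderiv2 i f)"
  unfolding smooth_def
proof (intro allI)
  fix js x assume "\<forall>is x. foldr pderiv2 is f differentiable (at x)"
  then have "foldr pderiv2 (js @ [i]) f differentiable (at x)" by blast
  then show "foldr pderiv2 js (pderiv2 i f) differentiable (at x)" by simp
qed

text \<open>
  Smoothness quantifies over all words of partial derivatives, so any class of differentiable
  functions that is closed under partial derivatives consists of smooth functions. All proofs of
  smoothness below exhibit such a class.
\<close>

lemma smooth_coinduct:
  assumes "P f" and "\<And>f. P f \<Longrightarrow> (\<forall>x. f differentiable (at x)) \<and> (\<forall>i. P (pderiv2 i f))"
  shows "smooth f"
proof -
  have "P (foldr pderiv2 js f)" for js
    using assms by (induction js) auto
  with assms(2) show ?thesis unfolding smooth_def by blast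
qed

lemma smooth_continuous_on: "smooth f \<Longrightarrow> continuous_on A f"
  by (meson continuous_at_imp_continuous_on differentiable_imp_continuous_within smooth_differentiable)

lemma pderiv2_eqI: "(f has_derivative D) (at x) \<Longrightarrow> pderiv2 i f x = D (axis i 1)"
  unfolding pderiv2_def by (simp add: frechet_derivative_at[symmetric])

lemma has_derivative_pderiv2:
  assumes "f differentiable (at x)"
  shows "(f has_derivative (\<lambda>h. \<Sum>i\<in>UNIV. h $ i * pderiv2 i f x)) (at x)"
proof -
  have 1: "(f has_derivative frechet_derivative f (at x)) (at x)"
    using assms frechet_derivative_works by blast
  then have lin: "linear (frechet_derivative f (at x))"
    using has_derivative_linear by blast
  have "frechet_derivative f (at x) h = (\<Sum>i\<in>UNIV. h $ i * pderiv2 i f x)" for h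
  proof -
    have "frechet_derivative f (at x) h = frechet_derivative f (at x) (\<Sum>i\<in>UNIV. h $ i *\<^sub>R axis i 1)"
      by (simp only: scalar_mult_eq_scaleR[symmetric] basis_expansion)
    also have "\<dots> = (\<Sum>i\<in>UNIV. h $ i * pderiv2 i f x)"
      by (simp add: lin linear_sum linear_scale pderiv2_def)
    finally show ?thesis .
  qed
  then show ?thesis using 1 by (metis (no_types, lifting) ext)
qed

lemma pderiv2_add:
  assumes "f differentiable (at x)" "g differentiable (at x)"
  shows "pderiv2 i (\<lambda>x. f x + g x) x = pderiv2 i f x + pderiv2 i g x"
  using assms unfolding frechet_derivative_works
  by (simp add: pderiv2_def frechet_derivative_at[OF has_derivative_add, symmetric])

lemma pderiv2_mult:
  assumes "f differentiable (at x)" "g differentiable (at x)"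
  shows "pderiv2 i (\<lambda>x. f x * g x) x = f x * pderiv2 i g x + pderiv2 i f x * g x"
  using assms unfolding frechet_derivative_works
  by (simp add: pderiv2_def frechet_derivative_at[OF has_derivative_mult, symmetric])

text \<open>
  For \<open>k = 0\<close> this is the classical function that is flat at the origin; the negative powers of
  \<open>t\<close> make the family closed under differentiation up to linear combinations.
\<close>

definition flat_exp :: "nat \<Rightarrow> real \<Rightarrow> real" where
  "flat_exp k t = (if t > 0 then exp (- inverse t) * inverse t ^ k else 0)"

text \<open>
  Only the origin needs care: there the difference quotient is the next member of the family,
  which tends to 0 because the exponential beats every power.
\<close>

lemma flat_exp_deriv:
  "(flat_exp k has_real_derivative (flat_exp (k + 2) t - real k * flat_exp (k + 1) t)) (at t)"
proof -
  consider "t > 0" | "t < 0" | "t = 0" by linarith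
  then show ?thesis
  proof cases
    case 1
    have "((\<lambda>t. exp (- inverse t) * inverse t ^ k) has_real_derivative
       exp (- inverse t) * (inverse t ^ 2) * inverse t ^ k
        + (real k * (inverse t ^ (k - Suc 0) * - (inverse t ^ 2))) * exp (- inverse t)) (at t)"
      using 1 by (auto intro!: derivative_eq_intros simp: power2_eq_square)
    also have "exp (- inverse t) * (inverse t ^ 2) * inverse t ^ k
        + (real k * (inverse t ^ (k - Suc 0) * - (inverse t ^ 2))) * exp (- inverse t)
        = flat_exp (k + 2) t - real k * flat_exp (k + 1) t"
      using 1 by (cases k) (simp_all add: flat_exp_def algebra_simps power2_eq_square)
    finally show ?thesis
      by (rule DERIV_cong_ev[OF refl _ refl, THEN iffD1, rotated])
         (use 1 in \<open>auto simp: flat_exp_def intro!: eventually_mono[OF eventually_nhds_in_open[of "{0<..}"]]\<close>)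
  next
    case 2
    have "((\<lambda>t. 0) has_real_derivative 0) (at t)" by simp
    then have "(flat_exp k has_real_derivative 0) (at t)"
      by (rule DERIV_cong_ev[OF refl _ refl, THEN iffD1, rotated])
         (use 2 in \<open>auto simp: flat_exp_def intro!: eventually_mono[OF eventually_nhds_in_open[of "{..<0}"]]\<close>)
    then show ?thesis using 2 by (simp add: flat_exp_def)
  next
    case 3
    have lim: "((\<lambda>t. exp (- inverse t) * inverse t ^ Suc k) \<longlongrightarrow> 0) (at_right (0::real))"
    proof -
      have "((\<lambda>y::real. y ^ Suc k / exp y) \<longlongrightarrow> 0) at_top"
        by (rule tendsto_power_div_exp_0)
      then have "((\<lambda>t::real. (inverse t) ^ Suc k / exp (inverse t)) \<longlongrightarrow> 0) (at_right 0)"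
        using filterlim_compose filterlim_inverse_at_top_right by blast
      then show ?thesis
        by (simp add: exp_minus divide_inverse mult.commute)
    qed
    have "((\<lambda>t. flat_exp k t / t) \<longlongrightarrow> 0) (at 0)"
    proof (rule filterlim_split_at)
      show "((\<lambda>t. flat_exp k t / t) \<longlongrightarrow> 0) (at_right 0)"
        by (rule Lim_transform_eventually[OF lim])
           (auto simp: eventually_at_right_less flat_exp_def eventually_at_filter field_simps)
      show "((\<lambda>t. flat_exp k t / t) \<longlongrightarrow> 0) (at_left 0)"
        by (rule tendsto_eventually) (auto simp: flat_exp_def eventually_at_filter)
    qed
    then show ?thesis using 3
      by (simp add: DERIV_def flat_exp_def)
  qed
qed

text \<open>
  The algebra generated by the smooth functions, the coordinates and the flat functions. Both
  families of generators are needed in one class: the product rule for two smooth functions and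
  the derivatives of cut-off functions then come out of a single coinduction.
\<close>

inductive smooth_alg :: "fn \<Rightarrow> bool" where
  smooth_alg_base: "smooth f \<Longrightarrow> smooth_alg f"
| smooth_alg_const: "smooth_alg (\<lambda>x. c)"
| smooth_alg_coord: "smooth_alg (\<lambda>x. x $ i)"
| smooth_alg_flat: "smooth_alg (\<lambda>x. flat_exp k (c + d * x $ i))"
| smooth_alg_add: "smooth_alg f \<Longrightarrow> smooth_alg g \<Longrightarrow> smooth_alg (\<lambda>x. f x + g x)"
| smooth_alg_mult: "smooth_alg f \<Longrightarrow> smooth_alg g \<Longrightarrow> smooth_alg (\<lambda>x. f x * g x)"

lemma smooth_alg_imp_smooth:
  assumes "smooth_alg f" shows "smooth f"
proof (rule smooth_coinduct[of smooth_alg, OF assms])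
  fix f assume "smooth_alg f"
  then show "(\<forall>x. f differentiable (at x)) \<and> (\<forall>i. smooth_alg (pderiv2 i f))"
  proof induction
    case (smooth_alg_base f)
    then show ?case using smooth_differentiable smooth_pderiv2 smooth_alg.smooth_alg_base by blast
  next
    case (smooth_alg_const c)
    have "pderiv2 i (\<lambda>x. c) = (\<lambda>x. 0)" for i
      by (auto simp: pderiv2_def)
    then show ?case using smooth_alg.smooth_alg_const by auto
  next
    case (smooth_alg_coord j)
    have d: "((\<lambda>x. x $ j) has_derivative (\<lambda>h. h $ j)) (at x)" for x :: plane
      by (simp add: bounded_linear_imp_has_derivative bounded_linear_vec_nth)
    have "pderiv2 i (\<lambda>x. x $ j) = (\<lambda>x. axis i 1 $ j)" for i
      using pderiv2_eqI[OF d] by auto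
    then show ?case using smooth_alg.smooth_alg_const d differentiable_def by metis
  next
    case (smooth_alg_flat k c e j)
    have d: "((\<lambda>x. flat_exp k (c + e * x $ j)) has_derivative
         (\<lambda>h. (flat_exp (k + 2) (c + e * x $ j) - real k * flat_exp (k + 1) (c + e * x $ j)) * (e * h $ j))) (at x)"
      for x :: plane
    proof -
      have "((\<lambda>x. c + e * x $ j) has_derivative (\<lambda>h. e * h $ j)) (at x)"
        by (auto intro!: derivative_eq_intros bounded_linear_imp_has_derivative bounded_linear_vec_nth)
      from DERIV_compose_FDERIV[OF flat_exp_deriv this] show ?thesis
        by (simp add: mult.commute)
    qed
    have eq: "pderiv2 i (\<lambda>x. flat_exp k (c + e * x $ j)) =
        (\<lambda>x. (flat_exp (k + 2) (c + e * x $ j) + (- real k) * flat_exp (k + 1) (c + e * x $ j)) * (e * axis i 1 $ j))" for i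
      using pderiv2_eqI[OF d] by (auto simp: algebra_simps)
    have "smooth_alg (pderiv2 i (\<lambda>x. flat_exp k (c + e * x $ j)))" for i
      unfolding eq by (intro smooth_alg.smooth_alg_mult smooth_alg.smooth_alg_add smooth_alg.smooth_alg_flat smooth_alg.smooth_alg_const)
    then show ?case using d differentiable_def by blast
  next
    case (smooth_alg_add f g)
    have "pderiv2 i (\<lambda>x. f x + g x) = (\<lambda>x. pderiv2 i f x + pderiv2 i g x)" for i
      using smooth_alg_add pderiv2_add by auto
    then show ?case using smooth_alg_add by (auto intro!: smooth_alg.smooth_alg_add)
  next
    case (smooth_alg_mult f g)
    have "pderiv2 i (\<lambda>x. f x * g x) = (\<lambda>x. f x * pderiv2 i g x + pderiv2 i f x * g x)" for i
      using smooth_alg_mult pderiv2_mult by auto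
    then show ?case using smooth_alg_mult by (auto intro!: smooth_alg.smooth_alg_add smooth_alg.smooth_alg_mult)
  qed
qed

lemma smooth_const: "smooth (\<lambda>x. c)" by (simp add: smooth_alg_const smooth_alg_imp_smooth)
lemma smooth_add: "smooth f \<Longrightarrow> smooth g \<Longrightarrow> smooth (\<lambda>x. f x + g x)"
  by (simp add: smooth_alg_add smooth_alg_base smooth_alg_imp_smooth)
lemma smooth_mult: "smooth f \<Longrightarrow> smooth g \<Longrightarrow> smooth (\<lambda>x. f x * g x)"
  by (simp add: smooth_alg_mult smooth_alg_base smooth_alg_imp_smooth)
lemma smooth_diff: "smooth f \<Longrightarrow> smooth g \<Longrightarrow> smooth (\<lambda>x. f x - g x)"
  using smooth_add[OF _ smooth_mult[OF smooth_const[of "-1"]], of f g] by simp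

lemma pderiv2_diff:
  assumes "smooth f" "smooth g"
  shows "pderiv2 i (\<lambda>x. f x - g x) = (\<lambda>x. pderiv2 i f x - pderiv2 i g x)"
proof
  fix x
  have "f differentiable (at x)" "g differentiable (at x)" using assms smooth_differentiable by auto
  then show "pderiv2 i (\<lambda>x. f x - g x) x = pderiv2 i f x - pderiv2 i g x"
    unfolding frechet_derivative_works
    by (simp add: pderiv2_def frechet_derivative_at[OF has_derivative_diff, symmetric])
qed

lemma quadratic_smooth: "quadratic q \<Longrightarrow> smooth q"
proof -
  assume "quadratic q"
  then obtain a b c d e g where q: "q = (\<lambda>x. a + b * x$1 + c * x$2 + d * (x$1 * x$1) + e * (x$1 * x$2) + g * (x$2 * x$2))"
    unfolding quadratic_def power2_eq_square fun_eq_iff by blast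
  show ?thesis unfolding q
    by (rule smooth_alg_imp_smooth, (rule smooth_alg_add smooth_alg_mult smooth_alg_coord smooth_alg_const)+)
qed


section \<open>Uniqueness of weak derivatives\<close>

text \<open>
  Open boxes form an intersection-stable generator of the Borel sets, so by Dynkin's argument the
  integral vanishes over every Borel set, and an integrable function is determined by these
  integrals. The hypothesis on the total integral is what complements require.
\<close>

lemma box_integrals_zero_imp_AE_zero:
  fixes g :: "plane \<Rightarrow> real"
  assumes int: "integrable lborel g"
    and box: "\<And>a b. (\<integral>x. indicator (box a b) x * g x \<partial>lborel) = 0"
    and tot: "(\<integral>x. g x \<partial>lborel) = 0"
  shows "AE x in lborel. g x = 0"
proof (rule sigma_finite_measure.density_zero[OF _ int])
  show "sigma_finite_measure lborel" by (rule lborel.sigma_finite_measure_axioms)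
  fix A :: "plane set" assume "A \<in> sets lborel"
  then have A: "A \<in> sigma_sets UNIV (range (\<lambda>(a, b). box a b))"
    by (simp add: borel_eq_box)
  have sets: "B \<in> sets lborel" if "B \<in> sigma_sets UNIV (range (\<lambda>(a, b). box a b))" for B :: "plane set"
    using that by (simp add: borel_eq_box)
  have si: "set_integrable lborel B g" if "B \<in> sets lborel" for B
    using integrable_mult_indicator[OF that int] by (simp add: set_integrable_def)
  have st: "Int_stable (range (\<lambda>(a, b). box a b :: plane set))"
  proof (rule Int_stableI_image)
    fix p q :: "plane \<times> plane"
    show "\<exists>r\<in>UNIV. (case p of (a, b) \<Rightarrow> box a b) \<inter> (case q of (a, b) \<Rightarrow> box a b) = (case r of (a, b) \<Rightarrow> box a b)"
      by (cases p; cases q) (auto simp: box_Int_box)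
  qed
  have sub: "range (\<lambda>(a, b). box a b :: plane set) \<subseteq> Pow UNIV" by auto
  show "set_lebesgue_integral lborel A g = 0"
    using st sub A
  proof (induction rule: sigma_sets_induct_disjoint)
    case (basic A)
    then show ?case using box by (auto simp: set_lebesgue_integral_def)
  next
    case empty
    then show ?case by (simp add: set_lebesgue_integral_def)
  next
    case (compl A)
    have "set_lebesgue_integral lborel (UNIV - A) g
        = (\<integral>x. g x - indicator A x *\<^sub>R g x \<partial>lborel)"
      unfolding set_lebesgue_integral_def
      by (rule Bochner_Integration.integral_cong) (auto simp: indicator_def)
    also have "\<dots> = 0"
      using si[OF sets[OF compl(1)]] int tot compl(2)
      by (simp add: set_lebesgue_integral_def set_integrable_def)
    finally show ?case .
  next
    case (union B)
    have "set_lebesgue_integral lborel (\<Union>(range B)) g = (\<Sum>i. set_lebesgue_integral lborel (B i) g)"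
      by (rule lebesgue_integral_countable_add)
         (use union sets[of "B _"] in \<open>auto intro!: si sets.countable_UN simp: disjoint_family_on_def image_subset_iff\<close>)
    then show ?case using union by simp
  qed
qed

lemma sets_lebesgue_open: "open S \<Longrightarrow> S \<in> sets lebesgue" for S :: "plane set"
  by auto

lemma integrable_on_lebesgue_on_iff:
  fixes f :: "plane \<Rightarrow> real"
  assumes "S \<in> sets lebesgue"
  shows "integrable (lebesgue_on S) f \<longleftrightarrow> integrable lebesgue (\<lambda>x. indicator S x * f x)"
  using assms by (simp add: integrable_restrict_space)

lemma integral_lebesgue_on_eq:
  fixes f :: "plane \<Rightarrow> real"
  assumes "S \<in> sets lebesgue"
  shows "(\<integral>x. f x \<partial>lebesgue_on S) = (\<integral>x. indicator S x * f x \<partial>lebesgue)"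
  using assms by (simp add: integral_restrict_space)

text \<open>
  Off the support of the function the derivative vanishes, so the support does not grow.
\<close>

lemma test_fns_pderiv2:
  assumes "\<phi> \<in> test_fns S" shows "pderiv2 i \<phi> \<in> test_fns S"
proof -
  have "pderiv2 i \<phi> x = 0" if "x \<notin> closure {x. \<phi> x \<noteq> 0}" for x
  proof -
    have "(\<phi> has_derivative (\<lambda>_. 0)) (at x)"
      by (rule has_derivative_transform_within_open[of "\<lambda>_. 0" _ _ _ "- closure {x. \<phi> x \<noteq> 0}"])
         (use that closure_subset[of "{x. \<phi> x \<noteq> 0}"] in auto)
    then show ?thesis using pderiv2_eqI by fastforce
  qed
  then have sub0: "{x. pderiv2 i \<phi> x \<noteq> 0} \<subseteq> closure {x. \<phi> x \<noteq> 0}" by auto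
  then have sub: "closure {x. pderiv2 i \<phi> x \<noteq> 0} \<subseteq> closure {x. \<phi> x \<noteq> 0}"
    by (simp add: closure_minimal)
  then have "compact (closure {x. pderiv2 i \<phi> x \<noteq> 0})"
  proof -
    have "bounded (closure {x. \<phi> x \<noteq> 0})" using assms by (simp add: test_fns_def compact_imp_bounded)
    then show ?thesis using sub0 bounded_subset by (simp add: compact_closure)
  qed
  then show ?thesis using assms sub smooth_pderiv2 by (auto simp: test_fns_def)
qed

lemma test_fns_continuous: "\<phi> \<in> test_fns S \<Longrightarrow> continuous_on A \<phi>"
  by (simp add: smooth_continuous_on test_fns_def)

lemma test_fns_zero: "\<phi> \<in> test_fns S \<Longrightarrow> x \<notin> S \<Longrightarrow> \<phi> x = 0"
  using closure_subset[of "{x. \<phi> x \<noteq> 0}"] by (auto simp: test_fns_def)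

lemma test_fns_bounded:
  assumes "\<phi> \<in> test_fns S" obtains B where "B > 0" "\<And>x. \<bar>\<phi> x\<bar> \<le> B"
proof -
  let ?C = "closure {x. \<phi> x \<noteq> 0}"
  have "compact (\<phi> ` ?C)"
    using assms by (auto simp: test_fns_def intro!: compact_continuous_image smooth_continuous_on)
  then obtain B where B: "\<And>y. y \<in> \<phi> ` ?C \<Longrightarrow> norm y \<le> B" "B > 0"
    using compact_imp_bounded bounded_pos by metis
  have "\<bar>\<phi> x\<bar> \<le> B" for x
  proof (cases "x \<in> ?C")
    case True then show ?thesis using B(1)[of "\<phi> x"] by auto
  next
    case False then have "\<phi> x = 0" using closure_subset[of "{x. \<phi> x \<noteq> 0}"] by auto
    then show ?thesis using B(2) by simp
  qed
  then show ?thesis using that B by blast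
qed

lemma continuous_measurable_lebesgue: "continuous_on UNIV f \<Longrightarrow> f \<in> borel_measurable lebesgue"
  for f :: "plane \<Rightarrow> real"
  by (rule measurable_completion) (simp add: borel_measurable_continuous_onI)

lemma integrable_mult_test_fn:
  assumes f: "locally_integrable S f" and \<phi>: "\<phi> \<in> test_fns S" and S: "open S"
  shows "integrable (lebesgue_on S) (\<lambda>x. f x * \<phi> x)"
proof -
  let ?C = "closure {x. \<phi> x \<noteq> 0}"
  have C: "compact ?C" "?C \<subseteq> S" using \<phi> by (auto simp: test_fns_def)
  have Cm: "?C \<in> sets lebesgue" by (simp add: borel_closed)
  have "integrable (lebesgue_on ?C) f" using f C unfolding locally_integrable_def by blast
  then have i: "integrable lebesgue (\<lambda>x. indicator ?C x * f x)"
    using integrable_on_lebesgue_on_iff[OF Cm] by auto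
  obtain B where B: "\<And>x. \<bar>\<phi> x\<bar> \<le> B" using test_fns_bounded[OF \<phi>] by metis
  have "integrable lebesgue (\<lambda>x. (indicator ?C x * f x) * \<phi> x)"
  proof (rule Bochner_Integration.integrable_bound[OF integrable_mult_right[OF integrable_norm[OF i], of B]])
    show "(\<lambda>x. (indicator ?C x * f x) * \<phi> x) \<in> borel_measurable lebesgue"
      by (intro borel_measurable_times borel_measurable_integrable[OF i]
          continuous_measurable_lebesgue test_fns_continuous[OF \<phi>])
    have "norm ((indicator ?C x * f x) * \<phi> x) \<le> norm (indicator ?C x * f x) * B" for x
      unfolding norm_mult[of _ "\<phi> x"] using B[of x] by (intro mult_left_mono) auto
    then show "AE x in lebesgue. norm ((indicator ?C x * f x) * \<phi> x) \<le> norm (B * norm (indicator ?C x * f x))"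
      using order_trans[OF abs_ge_zero B] by (intro AE_I2) (simp add: abs_mult mult.commute)
  qed
  also have "(\<lambda>x. (indicator ?C x * f x) * \<phi> x) = (\<lambda>x. indicator S x * (f x * \<phi> x))"
  proof
    fix x
    have "\<phi> x \<noteq> 0 \<Longrightarrow> x \<in> ?C" using closure_subset[of "{x. \<phi> x \<noteq> 0}"] by auto
    then show "(indicator ?C x * f x) * \<phi> x = indicator S x * (f x * \<phi> x)"
      using C by (cases "\<phi> x = 0") (auto simp: indicator_def)
  qed
  finally show ?thesis using S by (simp add: integrable_on_lebesgue_on_iff)
qed

text \<open>
  For \<open>n > 0\<close> a smooth function that is positive exactly on the open box. Each factor has the form
  \<open>exp (- 1 / (n t))\<close> with \<open>t\<close> the distance to one of the four sides, so that for growing \<open>n\<close> it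
  increases to the indicator of the box without any further construction of cut-off functions.
\<close>

definition box_bump :: "nat \<Rightarrow> plane \<Rightarrow> plane \<Rightarrow> fn" where
  "box_bump n a b x =
     (flat_exp 0 (- (real n * a $ 1) + real n * x $ 1) * flat_exp 0 (real n * b $ 1 + - real n * x $ 1)) *
     (flat_exp 0 (- (real n * a $ 2) + real n * x $ 2) * flat_exp 0 (real n * b $ 2 + - real n * x $ 2))"

lemma flat_exp_0_bounds: "0 \<le> flat_exp 0 t" "flat_exp 0 t \<le> 1"
  by (auto simp: flat_exp_def)

lemma mem_box_plane: "x \<in> box a b \<longleftrightarrow> a$1 < x$1 \<and> x$1 < b$1 \<and> a$2 < x$2 \<and> x$2 < b$2" for x :: plane
  by (auto simp: mem_box_cart forall_2)

lemma box_bump_zero: "x \<notin> box a b \<Longrightarrow> box_bump n a b x = 0"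
proof -
  assume "x \<notin> box a b"
  then consider "x$1 \<le> a$1" | "x$1 \<ge> b$1" | "x$2 \<le> a$2" | "x$2 \<ge> b$2" by (auto simp: mem_box_plane)
  then show ?thesis
    by cases (simp_all add: box_bump_def flat_exp_def mult_less_cancel_left)
qed

lemma box_bump_bounds: "0 \<le> box_bump n a b x" "box_bump n a b x \<le> 1"
  unfolding box_bump_def
  by (intro mult_nonneg_nonneg mult_le_one flat_exp_0_bounds)+

lemma box_bump_smooth: "smooth (box_bump n a b)"
proof -
  have flat: "smooth_alg (\<lambda>x. flat_exp 0 (c + d * x $ i))" for c d i by (rule smooth_alg_flat)
  show ?thesis
    unfolding box_bump_def
    by (rule smooth_alg_imp_smooth, rule smooth_alg_mult; rule smooth_alg_mult; rule flat)
qed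

lemma box_bump_test: "cbox a b \<subseteq> S \<Longrightarrow> box_bump n a b \<in> test_fns S"
proof -
  assume S: "cbox a b \<subseteq> S"
  have "{x. box_bump n a b x \<noteq> 0} \<subseteq> cbox a b"
    using box_bump_zero box_subset_cbox by blast
  then have sub: "closure {x. box_bump n a b x \<noteq> 0} \<subseteq> cbox a b"
    by (rule closure_minimal) (rule closed_cbox)
  then have "compact (closure {x. box_bump n a b x \<noteq> 0})"
    using bounded_subset[OF bounded_cbox sub] by (simp add: compact_eq_bounded_closed)
  then show ?thesis using S sub box_bump_smooth by (auto simp: test_fns_def)
qed

lemma flat_exp_0_tendsto:
  assumes "t > 0" shows "(\<lambda>n. flat_exp 0 (real n * t)) \<longlonglongrightarrow> 1"
proof -
  have "(\<lambda>n. exp (- (inverse t * inverse (real n)))) \<longlonglongrightarrow> exp (- (inverse t * 0))"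
    by (intro tendsto_intros lim_inverse_n)
  then have "(\<lambda>n. exp (- (inverse t * inverse (real n)))) \<longlonglongrightarrow> 1" by simp
  then show ?thesis
    by (rule Lim_transform_eventually)
       (use assms in \<open>auto simp: flat_exp_def inverse_eq_divide field_simps intro!: eventually_mono[OF eventually_gt_at_top[of 0]]\<close>)
qed

lemma box_bump_tendsto: "(\<lambda>n. box_bump n a b x) \<longlonglongrightarrow> indicator (box a b) x"
proof (cases "x \<in> box a b")
  case True
  then have p: "x$1 - a$1 > 0" "b$1 - x$1 > 0" "x$2 - a$2 > 0" "b$2 - x$2 > 0"
    by (auto simp: mem_box_plane)
  have "(\<lambda>n. (flat_exp 0 (real n * (x$1 - a$1)) * flat_exp 0 (real n * (b$1 - x$1))) *
      (flat_exp 0 (real n * (x$2 - a$2)) * flat_exp 0 (real n * (b$2 - x$2)))) \<longlonglongrightarrow> (1 * 1) * (1 * 1)"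
    by (intro tendsto_mult flat_exp_0_tendsto p)
  then show ?thesis using True by (simp add: box_bump_def algebra_simps)
next
  case False
  then show ?thesis by (simp add: box_bump_zero)
qed

text \<open>
  Testing with \<open>box_bump\<close> and letting \<open>n\<close> tend to infinity shows that the integral of \<open>h\<close> over
  every box inside \<open>S\<close> vanishes. A countable cover of \<open>S\<close> by closed boxes, on each of which \<open>h\<close> is
  integrable, reduces the claim to the previous uniqueness result.
\<close>

lemma fundamental_lemma_of_calculus_of_variations:
  assumes S: "open S" and h: "locally_integrable S h"
    and z: "\<And>\<phi>. \<phi> \<in> test_fns S \<Longrightarrow> (\<integral>x. h x * \<phi> x \<partial>lebesgue_on S) = 0"
  shows "AE x in lebesgue_on S. h x = 0"
proof -
  have Sm: "S \<in> sets lebesgue" using S by auto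
  have zero: "(\<integral>x. indicator (box a b) x * h x \<partial>lebesgue) = 0" if ab: "cbox a b \<subseteq> S" for a b
  proof -
    let ?q = "\<lambda>x. indicator (cbox a b) x * h x"
    have "integrable (lebesgue_on (cbox a b)) h"
      using h ab by (auto simp: locally_integrable_def)
    then have i: "integrable lebesgue (\<lambda>x. ?q x)"
      by (simp add: integrable_on_lebesgue_on_iff)
    have "(\<lambda>n. \<integral>x. (?q x) * box_bump n a b x \<partial>lebesgue)
       \<longlonglongrightarrow> (\<integral>x. (?q x) * indicator (box a b) x \<partial>lebesgue)"
    proof (rule integral_dominated_convergence[where w="\<lambda>x. norm (?q x)"])
      show "integrable lebesgue (\<lambda>x. norm (?q x))" using i by (rule integrable_norm)
      show "AE x in lebesgue. (\<lambda>n. ?q x * box_bump n a b x)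
          \<longlonglongrightarrow> ?q x * indicator (box a b) x"
        by (intro AE_I2 tendsto_mult tendsto_const box_bump_tendsto)
      show "AE x in lebesgue. norm (?q x * box_bump n a b x)
           \<le> norm (?q x)" for n
        using box_bump_bounds[of n a b] by (intro AE_I2) (simp add: abs_mult mult_left_le)
      have ind: "(indicator (box a b) :: plane \<Rightarrow> real) \<in> borel_measurable lebesgue"
        by (intro borel_measurable_indicator) auto
      show "(\<lambda>x. ?q x * indicator (box a b) x) \<in> borel_measurable lebesgue"
        by (intro borel_measurable_times[OF borel_measurable_integrable[OF i] ind])
      show "(\<lambda>x. ?q x * box_bump n a b x) \<in> borel_measurable lebesgue" for n
        by (intro borel_measurable_times[OF borel_measurable_integrable[OF i]]
          continuous_measurable_lebesgue smooth_continuous_on[OF box_bump_smooth])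
    qed
    moreover have "(\<integral>x. (?q x) * box_bump n a b x \<partial>lebesgue) = 0" for n
    proof -
      have "(\<integral>x. (?q x) * box_bump n a b x \<partial>lebesgue)
          = (\<integral>x. indicator S x * (h x * box_bump n a b x) \<partial>lebesgue)"
        by (rule Bochner_Integration.integral_cong)
           (use ab box_subset_cbox[of a b] box_bump_zero[of _ a b n] in \<open>auto simp: indicator_def\<close>)
      also have "\<dots> = 0" using z[OF box_bump_test[OF ab]] Sm by (simp add: integral_lebesgue_on_eq)
      finally show ?thesis .
    qed
    ultimately have "(\<integral>x. (?q x) * indicator (box a b) x \<partial>lebesgue) = 0"
      by (simp add: LIMSEQ_const_iff)
    also have "(\<lambda>x. (?q x) * indicator (box a b) x) = (\<lambda>x. indicator (box a b) x * h x)"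
      using box_subset_cbox[of a b] by (auto simp: indicator_def fun_eq_iff)
    finally show ?thesis .
  qed
  have ae: "AE x in lebesgue. x \<in> cbox p q \<longrightarrow> h x = 0" if pq: "cbox p q \<subseteq> S" for p q
  proof -
    let ?r = "\<lambda>x. indicator (box p q) x * h x"
    have "integrable (lebesgue_on (cbox p q)) h"
      using h pq by (auto simp: locally_integrable_def)
    then have "integrable lebesgue (\<lambda>x. indicator (cbox p q) x * h x)"
      by (simp add: integrable_on_lebesgue_on_iff)
    then have "integrable lebesgue (\<lambda>x. indicator (box p q) x *\<^sub>R (indicator (cbox p q) x * h x))"
      by (intro integrable_mult_indicator) auto
    also have "(\<lambda>x. indicator (box p q) x *\<^sub>R (indicator (cbox p q) x * h x)) = (\<lambda>x. ?r x)"
      using box_subset_cbox[of p q] by (auto simp: indicator_def fun_eq_iff)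
    finally have i: "integrable lebesgue (\<lambda>x. ?r x)" .
    then obtain g where g: "g \<in> borel_measurable lborel" and gh: "AE x in lborel. ?r x = g x"
      using completion_ex_borel_measurable_real borel_measurable_integrable by blast
    have gh': "AE x in lebesgue. ?r x = g x"
      using gh AE_completion by blast
    have gm: "g \<in> borel_measurable lebesgue" using g measurable_completion by blast
    have "integrable lebesgue g"
      using integrable_cong_AE[OF borel_measurable_integrable[OF i] gm gh'] i by auto
    then have gi: "integrable lborel g" using g by (simp add: integrable_completion)
    have gz: "(\<integral>x. indicator (box a b) x * g x \<partial>lborel) = 0" for a b
    proof -
      obtain a' b' where ab: "box a b \<inter> box p q = box a' b'"
        using box_Int_box[of a b p q] by (rule that)
      have "(\<integral>x. indicator (box a b) x * g x \<partial>lborel) = (\<integral>x. indicator (box a b) x * g x \<partial>lebesgue)"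
        by (rule integral_completion[symmetric], rule borel_measurable_times[OF borel_measurable_indicator g]) simp
      also have "\<dots> = (\<integral>x. indicator (box a b) x * (?r x) \<partial>lebesgue)"
      proof (rule integral_cong_AE)
        have ind: "(indicator (box a b) :: plane \<Rightarrow> real) \<in> borel_measurable lebesgue"
          by (intro borel_measurable_indicator) auto
        show "(\<lambda>x. indicator (box a b) x * g x) \<in> borel_measurable lebesgue"
          by (rule borel_measurable_times[OF ind gm])
        show "(\<lambda>x. indicator (box a b) x * (?r x)) \<in> borel_measurable lebesgue"
          by (rule borel_measurable_times[OF ind borel_measurable_integrable[OF i]])
        show "AE x in lebesgue. indicator (box a b) x * g x = indicator (box a b) x * (?r x)"
          using gh' by eventually_elim simp
      qed
      also have "\<dots> = (\<integral>x. indicator (box a' b') x * h x \<partial>lebesgue)"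
        by (rule Bochner_Integration.integral_cong) (auto simp: ab[symmetric] indicator_def)
      also have "\<dots> = 0"
      proof (cases "box a' b' = {}")
        case False
        have sub: "box a' b' \<subseteq> box p q" using ab by blast
        then have "box p q \<noteq> {}" using False by blast
        then have "cbox a' b' \<subseteq> cbox p q"
          using closure_mono[OF sub] False by (simp add: closure_box)
        then show ?thesis using zero pq by blast
      qed simp
      finally show ?thesis .
    qed
    have tot: "(\<integral>x. g x \<partial>lborel) = 0"
    proof -
      have "(\<integral>x. g x \<partial>lborel) = (\<integral>x. g x \<partial>lebesgue)"
        by (rule integral_completion[symmetric, OF g])
      also have "\<dots> = (\<integral>x. ?r x \<partial>lebesgue)"
      proof (rule integral_cong_AE[OF gm borel_measurable_integrable[OF i]])
        show "AE x in lebesgue. g x = ?r x"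
          using gh' by eventually_elim simp
      qed
      also have "\<dots> = 0" using zero[OF pq] .
      finally show ?thesis .
    qed
    have "AE x in lborel. g x = 0" by (rule box_integrals_zero_imp_AE_zero[OF gi gz tot])
    then have 1: "AE x in lebesgue. g x = 0" by (rule AE_completion)
    have "negligible (cbox p q - box p q)" by (rule negligible_frontier_interval)
    then have "AE x in lebesgue. x \<notin> cbox p q - box p q"
      unfolding negligible_iff_null_sets by (rule AE_not_in)
    with 1 gh' show ?thesis by eventually_elim (auto simp: indicator_def split: if_splits)
  qed
  obtain D where D: "countable D" "D \<subseteq> Pow S" "\<And>X. X \<in> D \<Longrightarrow> \<exists>a b. X = cbox a b" "\<Union>D = S"
    using open_countable_Union_open_cbox[OF S] by metis
  have "AE x in lebesgue. \<forall>X\<in>D. x \<in> X \<longrightarrow> h x = 0"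
    unfolding AE_ball_countable[OF D(1)]
  proof
    fix X assume X: "X \<in> D"
    then obtain a b where "X = cbox a b" using D(3) by blast
    then show "AE x in lebesgue. x \<in> X \<longrightarrow> h x = 0" using ae[of a b] X D(2) by blast
  qed
  then have "AE x in lebesgue. x \<in> S \<longrightarrow> h x = 0"
    by eventually_elim (use D in blast)
  then show ?thesis using AE_restrict_space_iff[of S lebesgue "\<lambda>x. h x = 0"] Sm by simp
qed

text \<open>
  The difference of two weak derivatives is orthogonal to all test functions. Hence the
  representative picked by \<open>weak_deriv\<close> agrees almost everywhere with any explicit weak derivative.
\<close>

lemma is_weak_deriv_unique:
  assumes S: "open S" and 1: "is_weak_deriv S i f g" and 2: "is_weak_deriv S i f h"
  shows "AE x in lebesgue_on S. g x = h x"
proof -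
  have "AE x in lebesgue_on S. g x - h x = 0"
  proof (rule fundamental_lemma_of_calculus_of_variations[OF S])
    show li: "locally_integrable S (\<lambda>x. g x - h x)"
      using 1 2 by (auto simp: locally_integrable_def is_weak_deriv_def)
    fix \<phi> assume \<phi>: "\<phi> \<in> test_fns S"
    have "(\<integral>x. (g x - h x) * \<phi> x \<partial>lebesgue_on S)
       = (\<integral>x. g x * \<phi> x \<partial>lebesgue_on S) - (\<integral>x. h x * \<phi> x \<partial>lebesgue_on S)"
      using integrable_mult_test_fn[OF _ \<phi> S] 1 2
      by (simp add: left_diff_distrib is_weak_deriv_def)
    also have "\<dots> = 0" using 1 2 \<phi> by (fastforce simp: is_weak_deriv_def)
    finally show "(\<integral>x. (g x - h x) * \<phi> x \<partial>lebesgue_on S) = 0" .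
  qed
  then show ?thesis by simp
qed


section \<open>Integration by parts\<close>

lemma DERIV_along_line:
  assumes "smooth u"
  shows "((\<lambda>s. u (x + s *\<^sub>R v)) has_real_derivative (\<Sum>i\<in>UNIV. v $ i * pderiv2 i u (x + s *\<^sub>R v))) (at s)"
proof -
  have "((\<lambda>s. x + s *\<^sub>R v) has_derivative (\<lambda>h. h *\<^sub>R v)) (at s)"
    by (auto intro!: derivative_eq_intros)
  from has_derivative_compose[OF this has_derivative_pderiv2[OF smooth_differentiable[OF assms]]]
  have "((\<lambda>s. u (x + s *\<^sub>R v)) has_derivative (\<lambda>h. \<Sum>i\<in>UNIV. (h *\<^sub>R v) $ i * pderiv2 i u (x + s *\<^sub>R v))) (at s)" .
  moreover have "(\<lambda>h. \<Sum>i\<in>UNIV. (h *\<^sub>R v) $ i * pderiv2 i u (x + s *\<^sub>R v))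
      = (*) (\<Sum>i\<in>UNIV. v $ i * pderiv2 i u (x + s *\<^sub>R v))"
    by (rule ext) (simp add: sum_distrib_left mult_ac)
  ultimately show ?thesis by (simp add: has_field_derivative_def)
qed

lemma DERIV_along_axis:
  assumes "smooth u"
  shows "((\<lambda>s. u (x + s *\<^sub>R axis i 1)) has_real_derivative pderiv2 i u (x + s *\<^sub>R axis i 1)) (at s)"
proof -
  have "(\<Sum>j\<in>UNIV. axis i (1::real) $ j * pderiv2 j u y) = pderiv2 i u y" for y
    by (simp add: axis_def if_distrib[of "\<lambda>z. z * _"] cong: if_cong)
  then show ?thesis using DERIV_along_line[OF assms, of x "axis i 1" s] by simp
qed

lemma integrable_continuous_compact:
  fixes f :: fn assumes "compact C" "continuous_on UNIV f"
  shows "integrable (lebesgue_on C) f"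
proof -
  have "integrable lborel (\<lambda>x. indicator C x *\<^sub>R f x)"
    using assms continuous_on_subset by (intro borel_integrable_compact) blast+
  then have "integrable lebesgue (\<lambda>x. indicator C x *\<^sub>R f x)"
    by (subst integrable_completion) (auto intro: borel_measurable_integrable)
  then show ?thesis
    using compact_imp_closed[OF assms(1)] by (subst integrable_on_lebesgue_on_iff) (auto simp: borel_closed)
qed

lemma integrable_test_fn:
  assumes "\<phi> \<in> test_fns UNIV" shows "integrable lborel \<phi>"
proof -
  let ?C = "closure {x. \<phi> x \<noteq> 0}"
  have "integrable lborel (\<lambda>x. indicator ?C x *\<^sub>R \<phi> x)"
    using assms by (intro borel_integrable_compact test_fns_continuous) (auto simp: test_fns_def)
  also have "(\<lambda>x. indicator ?C x *\<^sub>R \<phi> x) = \<phi>"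
  proof
    fix x
    have "\<phi> x \<noteq> 0 \<Longrightarrow> x \<in> ?C" using closure_subset[of "{x. \<phi> x \<noteq> 0}"] by auto
    then show "indicator ?C x *\<^sub>R \<phi> x = \<phi> x" by (cases "\<phi> x = 0") auto
  qed
  finally show ?thesis .
qed

text \<open>
  By translation invariance of Lebesgue measure every difference quotient in a coordinate
  direction has integral zero, and the quotients converge dominatedly to the partial derivative.
  This replaces the usual argument by Fubini and the fundamental theorem of calculus.
\<close>

lemma integral_pderiv2_test_fn:
  assumes u: "u \<in> test_fns UNIV"
  shows "(\<integral>x. pderiv2 i u x \<partial>lborel) = 0"
proof -
  have sm: "smooth u" using u by (simp add: test_fns_def)
  define e :: plane where "e = axis i 1"
  define d where "d n x = (u (x + (1 / real (Suc n)) *\<^sub>R e) - u x) * real (Suc n)" for n x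
  have cont: "continuous_on A u" "continuous_on A (pderiv2 i u)" for A
    using sm smooth_continuous_on smooth_pderiv2 by auto
  have meas: "u \<in> borel_measurable borel" "pderiv2 i u \<in> borel_measurable borel"
    using cont by (auto intro!: borel_measurable_continuous_onI)
  have ne: "norm e = 1" by (simp add: e_def norm_axis_1)
  obtain B where B: "B > 0" "\<And>x. \<bar>pderiv2 i u x\<bar> \<le> B"
    using test_fns_bounded[OF test_fns_pderiv2[OF u, of i]] by metis
  have "bounded {x. u x \<noteq> 0}"
    using u by (simp add: test_fns_def compact_closure)
  then obtain R where R: "\<And>x. u x \<noteq> 0 \<Longrightarrow> norm x \<le> R"
    by (auto simp: bounded_iff)
  have lim: "(\<lambda>n. d n x) \<longlonglongrightarrow> pderiv2 i u x" for x
  proof -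
    have "((\<lambda>h. (u (x + (0 + h) *\<^sub>R e) - u (x + 0 *\<^sub>R e)) / h) \<longlongrightarrow> pderiv2 i u (x + 0 *\<^sub>R e)) (at 0)"
      using DERIV_along_axis[OF sm, of x i 0] unfolding DERIV_def e_def .
    then have "((\<lambda>h. (u (x + h *\<^sub>R e) - u x) / h) \<longlongrightarrow> pderiv2 i u x) (at 0)" by simp
    moreover have "filterlim (\<lambda>n. 1 / real (Suc n)) (at 0) sequentially"
      using LIMSEQ_inverse_real_of_nat by (auto simp: filterlim_at inverse_eq_divide)
    ultimately have "(\<lambda>n. (u (x + (1 / real (Suc n)) *\<^sub>R e) - u x) / (1 / real (Suc n))) \<longlonglongrightarrow> pderiv2 i u x"
      using filterlim_compose by blast
    then show ?thesis by (simp add: d_def)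
  qed
  \<comment> \<open>The shifts have length at most 1, so the quotients vanish outside the ball of radius \<open>R + 1\<close>.\<close>
  have bnd: "\<bar>d n x\<bar> \<le> B * indicator (cball 0 (R + 1)) x" for n x
  proof (cases "x \<in> cball 0 (R + 1)")
    case False
    define c where "c = (1 / real (Suc n)) *\<^sub>R e"
    have "norm c \<le> 1" using ne by (simp add: c_def divide_le_eq)
    then have "norm (x + c) > R" "norm x > R"
      using False norm_triangle_ineq4[of "x + c" c] by auto
    then have "u (x + c) = 0" "u x = 0" using R by force+
    then show ?thesis using False by (simp add: d_def c_def)
  next
    case True
    have "\<exists>z. 0 < z \<and> z < 1 / real (Suc n) \<and>
        u (x + (1 / real (Suc n)) *\<^sub>R e) - u (x + 0 *\<^sub>R e) = (1 / real (Suc n) - 0) * pderiv2 i u (x + z *\<^sub>R e)"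
      by (rule MVT2) (use DERIV_along_axis[OF sm] in \<open>auto simp: e_def\<close>)
    then obtain z where "u (x + (1 / real (Suc n)) *\<^sub>R e) - u x = pderiv2 i u (x + z *\<^sub>R e) / real (Suc n)"
      by auto
    then have "d n x = pderiv2 i u (x + z *\<^sub>R e)" by (simp add: d_def)
    then show ?thesis using B True by simp
  qed
  have "(\<lambda>n. \<integral>x. d n x \<partial>lborel) \<longlonglongrightarrow> (\<integral>x. pderiv2 i u x \<partial>lborel)"
  proof (rule integral_dominated_convergence[where w="\<lambda>x. B * indicator (cball 0 (R + 1)) x"])
    show "integrable lborel (\<lambda>x. B * indicator (cball (0::plane) (R + 1)) x)"
      using emeasure_bounded_finite[of "cball (0::plane) (R + 1)"] by simp
    show "AE x in lborel. (\<lambda>n. d n x) \<longlonglongrightarrow> pderiv2 i u x" using lim by simp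
    show "AE x in lborel. norm (d n x) \<le> B * indicator (cball 0 (R + 1)) x" for n using bnd by simp
    have "continuous_on UNIV (d n)" for n
      unfolding d_def by (intro continuous_intros continuous_on_compose2[OF cont(1)[of UNIV]] cont) auto
    then show "d n \<in> borel_measurable lborel" for n
      by (simp add: borel_measurable_continuous_onI)
  qed (use meas in simp)
  moreover have "(\<integral>x. d n x \<partial>lborel) = 0" for n
  proof -
    define c where "c = (1 / real (Suc n)) *\<^sub>R e"
    have tr: "lborel = distr lborel borel ((+) c)" by (simp add: lborel_distr_plus)
    have iu: "integrable lborel u" using integrable_test_fn[OF u] .
    then have "integrable (distr lborel borel ((+) c)) u" using tr by simp
    then have i: "integrable lborel (\<lambda>x. u (c + x))"
      by (subst (asm) integrable_distr_eq) (use meas in auto)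
    have "(\<integral>x. u x \<partial>lborel) = (\<integral>x. u x \<partial>distr lborel borel ((+) c))" using tr by simp
    also have "\<dots> = (\<integral>x. u (c + x) \<partial>lborel)" by (rule integral_distr) (use meas in auto)
    finally have eq: "(\<integral>x. u x \<partial>lborel) = (\<integral>x. u (c + x) \<partial>lborel)" .
    have "d n = (\<lambda>x. (u (c + x) - u x) * real (Suc n))"
      by (simp add: d_def c_def add.commute fun_eq_iff)
    then show ?thesis using iu i eq by simp
  qed
  ultimately show ?thesis by (simp add: LIMSEQ_const_iff)
qed

lemma test_fns_mult_smooth:
  assumes "smooth \<psi>" "\<phi> \<in> test_fns S"
  shows "(\<lambda>x. \<psi> x * \<phi> x) \<in> test_fns S"
proof -
  have "{x. \<psi> x * \<phi> x \<noteq> 0} \<subseteq> {x. \<phi> x \<noteq> 0}" by auto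
  then have sub: "closure {x. \<psi> x * \<phi> x \<noteq> 0} \<subseteq> closure {x. \<phi> x \<noteq> 0}" by (rule closure_mono)
  have "bounded {x. \<phi> x \<noteq> 0}" using assms by (simp add: test_fns_def compact_closure)
  then have "bounded {x. \<psi> x * \<phi> x \<noteq> 0}" by (rule bounded_subset) auto
  then show ?thesis using assms sub smooth_mult by (auto simp: test_fns_def compact_closure)
qed

lemma locally_integrable_smooth: "smooth u \<Longrightarrow> locally_integrable S u"
  using integrable_continuous_compact smooth_continuous_on unfolding locally_integrable_def by blast

text \<open>
  Integration by parts: the product with a test function is a test function on the whole plane,
  and its partial derivative integrates to zero.
\<close>

lemma smooth_is_weak_deriv:
  assumes S: "open S" and u: "smooth u"
  shows "is_weak_deriv S i u (pderiv2 i u)"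
  unfolding is_weak_deriv_def
proof (intro conjI ballI)
  show li: "locally_integrable S u" "locally_integrable S (pderiv2 i u)"
    using u smooth_pderiv2 locally_integrable_smooth by blast+
  fix \<phi> assume \<phi>: "\<phi> \<in> test_fns S"
  let ?M = "lebesgue_on S"
  let ?u = "\<lambda>x. u x * \<phi> x"
  have sm: "smooth \<phi>" using \<phi> by (simp add: test_fns_def)
  have 1: "(?u) \<in> test_fns S" using test_fns_mult_smooth u \<phi> by blast
  then have U: "(?u) \<in> test_fns UNIV" by (auto simp: test_fns_def)
  have eq: "pderiv2 i (?u) = (\<lambda>x. u x * pderiv2 i \<phi> x + pderiv2 i u x * \<phi> x)"
    using pderiv2_mult u sm smooth_differentiable by blast
  have i1: "integrable (?M) (\<lambda>x. u x * pderiv2 i \<phi> x)"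
    by (rule integrable_mult_test_fn[OF li(1) test_fns_pderiv2[OF \<phi>] S])
  have i2: "integrable (?M) (\<lambda>x. pderiv2 i u x * \<phi> x)"
    by (rule integrable_mult_test_fn[OF li(2) \<phi> S])
  have z: "pderiv2 i (?u) x = 0" if "x \<notin> S" for x
    using test_fns_zero[OF test_fns_pderiv2[OF 1] that] .
  have "(\<integral>x. u x * pderiv2 i \<phi> x \<partial>?M) + (\<integral>x. pderiv2 i u x * \<phi> x \<partial>?M)
      = (\<integral>x. pderiv2 i (?u) x \<partial>?M)"
    unfolding eq using i1 i2 by simp
  also have "\<dots> = (\<integral>x. indicator S x * pderiv2 i (?u) x \<partial>lebesgue)"
    using S by (simp add: integral_lebesgue_on_eq)
  also have "\<dots> = (\<integral>x. pderiv2 i (?u) x \<partial>lebesgue)"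
    by (rule Bochner_Integration.integral_cong) (use z in \<open>auto simp: indicator_def\<close>)
  also have "\<dots> = (\<integral>x. pderiv2 i (?u) x \<partial>lborel)"
    by (rule integral_completion) (use borel_measurable_integrable[OF integrable_test_fn[OF test_fns_pderiv2[OF U]]] in simp)
  also have "\<dots> = 0" by (rule integral_pderiv2_test_fn[OF U])
  finally show "(\<integral>x. u x * pderiv2 i \<phi> x \<partial>?M) = - (\<integral>x. pderiv2 i u x * \<phi> x \<partial>?M)"
    by linarith
qed


section \<open>Square integrable functions\<close>

lemma square_diff_le: "(a - b)\<^sup>2 \<le> 2 * a\<^sup>2 + 2 * b\<^sup>2" for a b :: real
  using zero_le_power2[of "a + b"] by (simp add: power2_eq_square algebra_simps)

lemma L2_diff:
  assumes "f \<in> L2 M" "g \<in> L2 M"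
  shows "(\<lambda>x. f x - g x) \<in> L2 M"
proof -
  have "integrable M (\<lambda>x. (f x - g x)\<^sup>2)"
    by (rule Bochner_Integration.integrable_bound[where f="\<lambda>x. 2 * (f x)\<^sup>2 + 2 * (g x)\<^sup>2"])
       (use assms square_diff_le in \<open>auto simp: L2_def intro!: AE_I2\<close>)
  then show ?thesis using assms by (auto simp: L2_def)
qed

lemma integral_square_diff_le:
  assumes "f \<in> L2 M" "g \<in> L2 M"
  shows "(\<integral>x. (f x - g x)\<^sup>2 \<partial>M) \<le> 2 * (\<integral>x. (f x)\<^sup>2 \<partial>M) + 2 * (\<integral>x. (g x)\<^sup>2 \<partial>M)"
proof -
  have "(\<integral>x. (f x - g x)\<^sup>2 \<partial>M) \<le> (\<integral>x. 2 * (f x)\<^sup>2 + 2 * (g x)\<^sup>2 \<partial>M)"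
    by (rule integral_mono) (use assms L2_diff[OF assms] square_diff_le in \<open>auto simp: L2_def\<close>)
  also have "\<dots> = 2 * (\<integral>x. (f x)\<^sup>2 \<partial>M) + 2 * (\<integral>x. (g x)\<^sup>2 \<partial>M)"
    using assms by (simp add: L2_def)
  finally show ?thesis .
qed

lemma L2_norm_sq: "(L2_norm M f)\<^sup>2 = (\<integral>x. (f x)\<^sup>2 \<partial>M)"
  by (simp add: L2_norm_def)

lemma L2_norm_tendsto_iff: "(\<lambda>n. L2_norm M (f n)) \<longlonglongrightarrow> 0 \<longleftrightarrow> (\<lambda>n. \<integral>x. (f n x)\<^sup>2 \<partial>M) \<longlonglongrightarrow> 0"
proof
  assume "(\<lambda>n. L2_norm M (f n)) \<longlonglongrightarrow> 0"
  from tendsto_power[OF this, of 2] show "(\<lambda>n. \<integral>x. (f n x)\<^sup>2 \<partial>M) \<longlonglongrightarrow> 0"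
    by (simp add: L2_norm_sq)
next
  assume "(\<lambda>n. \<integral>x. (f n x)\<^sup>2 \<partial>M) \<longlonglongrightarrow> 0"
  from tendsto_real_sqrt[OF this] show "(\<lambda>n. L2_norm M (f n)) \<longlonglongrightarrow> 0"
    by (simp add: L2_norm_def)
qed

lemma L2_mult_integrable:
  assumes "f \<in> L2 M" "g \<in> L2 M"
  shows "integrable M (\<lambda>x. f x * g x)"
proof (rule Bochner_Integration.integrable_bound[where f="\<lambda>x. (f x)\<^sup>2 + (g x)\<^sup>2"])
  have "\<bar>a * b\<bar> \<le> a\<^sup>2 + b\<^sup>2" for a b :: real
  proof -
    have "2 * (\<bar>a\<bar> * \<bar>b\<bar>) \<le> a\<^sup>2 + b\<^sup>2"
      using zero_le_power2[of "\<bar>a\<bar> - \<bar>b\<bar>"] by (simp add: power2_eq_square algebra_simps)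
    moreover have "0 \<le> \<bar>a\<bar> * \<bar>b\<bar>" by simp
    ultimately show ?thesis unfolding abs_mult by linarith
  qed
  then show "AE x in M. norm (f x * g x) \<le> norm ((f x)\<^sup>2 + (g x)\<^sup>2)" by auto
qed (use assms in \<open>auto simp: L2_def\<close>)

text \<open>
  The quadratic polynomial \<open>\<integral> (t f - g)\<^sup>2\<close> in \<open>t\<close> is nonnegative; its minimiser gives the
  inequality, and if the leading coefficient is zero the linear one has to vanish as well.
\<close>

lemma L2_Cauchy_Schwarz:
  assumes "f \<in> L2 M" "g \<in> L2 M"
  shows "(\<integral>x. f x * g x \<partial>M)\<^sup>2 \<le> (\<integral>x. (f x)\<^sup>2 \<partial>M) * (\<integral>x. (g x)\<^sup>2 \<partial>M)"
proof -
  let ?a = "\<integral>x. (f x)\<^sup>2 \<partial>M" and ?b = "\<integral>x. f x * g x \<partial>M" and ?c = "\<integral>x. (g x)\<^sup>2 \<partial>M"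
  have i: "integrable M (\<lambda>x. (f x)\<^sup>2)" "integrable M (\<lambda>x. (g x)\<^sup>2)" "integrable M (\<lambda>x. f x * g x)"
    using assms L2_mult_integrable by (auto simp: L2_def)
  have q: "0 \<le> t\<^sup>2 * ?a - 2 * t * ?b + ?c" for t
  proof -
    have "0 \<le> (\<integral>x. (t * f x - g x)\<^sup>2 \<partial>M)" by simp
    also have "(\<lambda>x. (t * f x - g x)\<^sup>2) = (\<lambda>x. t\<^sup>2 * (f x)\<^sup>2 - 2 * t * (f x * g x) + (g x)\<^sup>2)"
      by (rule ext) (simp add: power2_eq_square algebra_simps)
    also have "(\<integral>x. t\<^sup>2 * (f x)\<^sup>2 - 2 * t * (f x * g x) + (g x)\<^sup>2 \<partial>M) = t\<^sup>2 * ?a - 2 * t * ?b + ?c"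
      using i by simp
    finally show ?thesis .
  qed
  show ?thesis
  proof (cases "?a = 0")
    case True
    have "?b = 0"
    proof (rule ccontr)
      assume "?b \<noteq> 0"
      then show False using q[of "(?c + 1) / (2 * ?b)"] True by simp
    qed
    then show ?thesis using True by simp
  next
    case False
    then have "?a > 0" by (simp add: order_less_le)
    then show ?thesis using q[of "?b / ?a"] by (simp add: power2_eq_square field_simps)
  qed
qed

lemma L2_weak_convergence:
  assumes f: "f \<in> L2 M" and fn: "\<And>n. fn n \<in> L2 M" and w: "w \<in> L2 M"
    and lim: "(\<lambda>n. \<integral>x. (f x - fn n x)\<^sup>2 \<partial>M) \<longlonglongrightarrow> 0"
  shows "(\<lambda>n. \<integral>x. fn n x * w x \<partial>M) \<longlonglongrightarrow> (\<integral>x. f x * w x \<partial>M)"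
proof -
  let ?e = "\<lambda>n. (\<integral>x. (f x - fn n x) * w x \<partial>M)"
  let ?s = "\<lambda>n. (\<integral>x. (f x - fn n x)\<^sup>2 \<partial>M) * (\<integral>x. (w x)\<^sup>2 \<partial>M)"
  have "(\<lambda>n. ?s n) \<longlonglongrightarrow> 0 * (\<integral>x. (w x)\<^sup>2 \<partial>M)"
    by (intro tendsto_intros lim)
  then have up: "(\<lambda>n. ?s n) \<longlonglongrightarrow> 0" by simp
  have "(\<lambda>n. (?e n)\<^sup>2) \<longlonglongrightarrow> 0"
    by (rule tendsto_sandwich[OF _ _ tendsto_const up])
       (rule always_eventually, rule allI, rule zero_le_power2 L2_Cauchy_Schwarz[OF L2_diff[OF f fn] w])+
  then have "(\<lambda>n. \<integral>x. (f x - fn n x) * w x \<partial>M) \<longlonglongrightarrow> 0"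
    by (simp add: power_tendsto_0_iff)
  then have "(\<lambda>n. (\<integral>x. f x * w x \<partial>M) - (?e n)) \<longlonglongrightarrow> (\<integral>x. f x * w x \<partial>M) - 0"
    by (intro tendsto_intros)
  moreover have "(\<integral>x. f x * w x \<partial>M) - (?e n) = (\<integral>x. fn n x * w x \<partial>M)" for n
    using L2_mult_integrable[OF f w] L2_mult_integrable[OF fn w] by (simp add: left_diff_distrib)
  ultimately show ?thesis by simp
qed

text \<open>
  The Riesz--Fischer theorem. A subsequence whose consecutive squared distances are below \<open>8\<^sup>-\<^sup>k\<close>
  converges geometrically almost everywhere, and Fatou's lemma identifies the pointwise limit as
  the limit in mean square of the whole sequence.
\<close>

lemma L2_complete:
  assumes fn: "\<And>n. fn n \<in> L2 M"
    and cauchy: "\<And>e. e > 0 \<Longrightarrow> \<exists>N. \<forall>m\<ge>N. \<forall>n\<ge>N. (\<integral>x. (fn m x - fn n x)\<^sup>2 \<partial>M) < e"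
  shows "\<exists>g\<in>L2 M. (\<lambda>n. \<integral>x. (g x - fn n x)\<^sup>2 \<partial>M) \<longlonglongrightarrow> 0"
proof -
  have meas[measurable]: "fn n \<in> borel_measurable M" for n using fn by (simp add: L2_def)
  have idiff: "integrable M (\<lambda>x. (fn m x - fn n x)\<^sup>2)" for m n using L2_diff[OF fn fn] by (simp add: L2_def)
  \<comment> \<open>The rate 1/8 leaves room for the weight 4 and still gives a convergent series.\<close>
  have "\<exists>N. \<forall>m\<ge>N. \<forall>n\<ge>N. (\<integral>x. (fn m x - fn n x)\<^sup>2 \<partial>M) < (1/8) ^ k" for k
    by (rule cauchy) simp
  then obtain N where N: "\<And>k m n. m \<ge> N k \<Longrightarrow> n \<ge> N k \<Longrightarrow> (\<integral>x. (fn m x - fn n x)\<^sup>2 \<partial>M) < (1/8) ^ k"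
    by metis
  \<comment> \<open>Adding \<open>k\<close> makes the indices of the subsequence tend to infinity.\<close>
  define r where "r k = (\<Sum>j\<le>k. N j) + k" for k
  have rN: "r k \<ge> N k" "r (Suc k) \<ge> r k" "r k \<ge> k" for k
    unfolding r_def by (auto intro: trans_le_add1 member_le_sum)
  then have rN': "r (Suc k) \<ge> N k" for k using order_trans by blast
  define F where "F k x = fn (r k) x" for k x
  have Fm[measurable]: "F k \<in> borel_measurable M" for k unfolding F_def by simp
  let ?d = "\<lambda>k x. (F (Suc k) x - F k x)\<^sup>2"
  have step: "(\<integral>\<^sup>+x. ennreal (?d k x) \<partial>M) \<le> ennreal ((1/8) ^ k)" for k
  proof -
    have "(\<integral>\<^sup>+x. ennreal (?d k x) \<partial>M) = ennreal (\<integral>x. ?d k x \<partial>M)"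
      unfolding F_def by (rule nn_integral_eq_integral[OF idiff]) simp
    also have "\<dots> \<le> ennreal ((1/8) ^ k)"
      unfolding F_def using N[OF rN' rN(1), of k] by (intro ennreal_leI) simp
    finally show ?thesis .
  qed
  have "(\<integral>\<^sup>+x. (\<Sum>k. ennreal (4 ^ k * ?d k x)) \<partial>M) = (\<Sum>k. \<integral>\<^sup>+x. ennreal (4 ^ k * ?d k x) \<partial>M)"
    by (rule nn_integral_suminf) measurable
  also have "\<dots> \<le> (\<Sum>k. ennreal ((1/2) ^ k))"
  proof (rule suminf_le)
    fix k
    have "(\<integral>\<^sup>+x. ennreal (4 ^ k * ?d k x) \<partial>M)
        = ennreal (4 ^ k) * (\<integral>\<^sup>+x. ennreal (?d k x) \<partial>M)"
    proof -
      have "ennreal (4 ^ k * ?d k x) = ennreal (4 ^ k) * ennreal (?d k x)" for x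
        by (rule ennreal_mult) simp_all
      moreover have "(\<lambda>x. ennreal (?d k x)) \<in> borel_measurable M" by measurable
      ultimately show ?thesis by (simp only: nn_integral_cmult)
    qed
    also have "\<dots> \<le> ennreal (4 ^ k) * ennreal ((1/8) ^ k)" by (intro mult_left_mono step) simp
    also have "\<dots> = ennreal ((1/2) ^ k)"
    proof -
      have "ennreal (4 ^ k) * ennreal ((1/8) ^ k) = ennreal (4 ^ k * (1/8) ^ k)"
        by (rule ennreal_mult[symmetric]) simp_all
      also have "(4::real) ^ k * (1/8) ^ k = (4 * (1/8)) ^ k" by (rule power_mult_distrib[symmetric])
      finally show ?thesis by simp
    qed
    finally show "(\<integral>\<^sup>+x. ennreal (4 ^ k * ?d k x) \<partial>M) \<le> ennreal ((1/2) ^ k)" .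
  qed auto
  also have "\<dots> = ennreal (\<Sum>k. (1/2) ^ k)" by (rule suminf_ennreal2) (simp_all add: summable_geometric)
  also have "\<dots> < \<infinity>" by simp
  finally have fin: "(\<integral>\<^sup>+x. (\<Sum>k. ennreal (4 ^ k * ?d k x)) \<partial>M) < \<infinity>" .
  have "(\<lambda>x. \<Sum>k. ennreal (4 ^ k * ?d k x)) \<in> borel_measurable M"
    by measurable
  from nn_integral_PInf_AE[OF this less_imp_neq[OF fin]]
  have "AE x in M. (\<Sum>k. ennreal (4 ^ k * ?d k x)) \<noteq> \<infinity>" .
  then have conv: "AE x in M. convergent (\<lambda>k. F k x)"
  proof eventually_elim
    case (elim x)
    have nn: "0 \<le> 4 ^ k * ?d k x" for k by simp
    have "summable (\<lambda>k. 4 ^ k * ?d k x)"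
      using elim unfolding infinity_ennreal_def by (rule summable_suminf_not_top[OF nn])
    then have "Bseq (\<lambda>k. 4 ^ k * ?d k x)"
      by (rule convergent_imp_Bseq[OF convergentI[OF summable_LIMSEQ_zero]])
    then obtain B where B: "B > 0" "\<forall>k. norm (4 ^ k * ?d k x) \<le> B"
      by (rule BseqE)
    have "norm (F (Suc k) x - F k x) \<le> sqrt B * (1/2) ^ k" for k
    proof (rule power2_le_imp_le)
      have "((1/2::real) ^ k)\<^sup>2 = ((1/2)\<^sup>2) ^ k" by (simp only: power_mult[symmetric] mult.commute)
      also have "\<dots> = 1 / 4 ^ k" by (simp add: power2_eq_square power_one_over)
      finally have "(sqrt B * (1/2) ^ k)\<^sup>2 = B / 4 ^ k"
        using B(1) by (simp add: power_mult_distrib)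
      moreover have "4 ^ k * ?d k x \<le> B"
        using B(2)[rule_format, of k] by (simp add: abs_mult)
      then have "?d k x \<le> B / 4 ^ k"
        by (simp add: field_simps)
      ultimately show "(norm (F (Suc k) x - F k x))\<^sup>2 \<le> (sqrt B * (1/2) ^ k)\<^sup>2"
        by simp
    qed (use B in simp)
    moreover have "summable (\<lambda>k. sqrt B * (1/2) ^ k)"
      by (rule summable_mult) (simp add: summable_geometric)
    ultimately have "summable (\<lambda>k. F (Suc k) x - F k x)"
      by (rule summable_comparison_test'[where N=0, rotated])
    then have "convergent (\<lambda>n. \<Sum>k<n. F (Suc k) x - F k x)"
      by (simp add: summable_iff_convergent)
    then have "convergent (\<lambda>n. F n x - F 0 x)" by (simp only: sum_lessThan_telescope[of "\<lambda>k. F k x"])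
    from convergent_add[OF this convergent_const[of "F 0 x"]] show ?case by simp
  qed
  define g where "g x = lim (\<lambda>k. F k x)" for x
  have gm[measurable]: "g \<in> borel_measurable M" unfolding g_def by (rule borel_measurable_lim_metric[OF Fm])
  have glim: "AE x in M. (\<lambda>k. F k x) \<longlonglongrightarrow> g x"
    using conv by eventually_elim (simp add: g_def convergent_LIMSEQ_iff)
  have bound: "(\<integral>\<^sup>+x. ennreal ((g x - fn n x)\<^sup>2) \<partial>M) \<le> ennreal e"
    if e: "e > 0" and K: "\<And>m n. m \<ge> K \<Longrightarrow> n \<ge> K \<Longrightarrow> (\<integral>x. (fn m x - fn n x)\<^sup>2 \<partial>M) < e" and n: "n \<ge> K" for e K n
  proof -
    have "AE x in M. ennreal ((g x - fn n x)\<^sup>2) = liminf (\<lambda>k. ennreal ((F k x - fn n x)\<^sup>2))"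
      using glim
    proof eventually_elim
      case (elim x)
      then have "(\<lambda>k. ennreal ((F k x - fn n x)\<^sup>2)) \<longlonglongrightarrow> ennreal ((g x - fn n x)\<^sup>2)"
        by (intro tendsto_intros tendsto_ennrealI)
      then show ?case by (rule lim_imp_Liminf[OF sequentially_bot, symmetric])
    qed
    then have "(\<integral>\<^sup>+x. ennreal ((g x - fn n x)\<^sup>2) \<partial>M) = (\<integral>\<^sup>+x. liminf (\<lambda>k. ennreal ((F k x - fn n x)\<^sup>2)) \<partial>M)"
      by (rule nn_integral_cong_AE)
    also have "\<dots> \<le> liminf (\<lambda>k. \<integral>\<^sup>+x. ennreal ((F k x - fn n x)\<^sup>2) \<partial>M)"
      by (rule nn_integral_liminf) measurable
    also have "\<dots> \<le> limsup (\<lambda>k. \<integral>\<^sup>+x. ennreal ((F k x - fn n x)\<^sup>2) \<partial>M)"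
      by (rule Liminf_le_Limsup) simp
    also have "\<dots> \<le> ennreal e"
    proof (rule Limsup_bounded)
      show "\<forall>\<^sub>F k in sequentially. (\<integral>\<^sup>+x. ennreal ((F k x - fn n x)\<^sup>2) \<partial>M) \<le> ennreal e"
        using eventually_ge_at_top[of K]
      proof eventually_elim
        case (elim k)
        then have "r k \<ge> K" using rN(3)[of k] by simp
        have "(\<integral>\<^sup>+x. ennreal ((F k x - fn n x)\<^sup>2) \<partial>M) = ennreal (\<integral>x. (F k x - fn n x)\<^sup>2 \<partial>M)"
          unfolding F_def by (rule nn_integral_eq_integral[OF idiff]) simp
        also have "\<dots> \<le> ennreal e"
          unfolding F_def using K[OF \<open>r k \<ge> K\<close> n] by (intro ennreal_leI) simp
        finally show ?case .
      qed
    qed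
    finally show ?thesis .
  qed
  obtain K where K: "\<And>m n. m \<ge> K \<Longrightarrow> n \<ge> K \<Longrightarrow> (\<integral>x. (fn m x - fn n x)\<^sup>2 \<partial>M) < 1"
    using cauchy[of 1] by auto
  have "integrable M (\<lambda>x. (g x - fn K x)\<^sup>2)"
  proof (rule integrableI_nonneg)
    show "(\<integral>\<^sup>+x. ennreal ((g x - fn K x)\<^sup>2) \<partial>M) < \<infinity>"
      by (rule le_less_trans[OF bound[OF _ K order_refl]]) simp_all
  qed auto
  then have 1: "(\<lambda>x. g x - fn K x) \<in> L2 M" by (simp add: L2_def)
  have "(\<lambda>x. - fn K x) \<in> L2 M" using fn[of K] by (simp add: L2_def)
  from L2_diff[OF 1 this] have g: "g \<in> L2 M" by simp
  have "(\<lambda>n. \<integral>x. (g x - fn n x)\<^sup>2 \<partial>M) \<longlonglongrightarrow> 0"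
  proof (rule LIMSEQ_I)
    fix e :: real assume e: "e > 0"
    then obtain K where K: "\<And>m n. m \<ge> K \<Longrightarrow> n \<ge> K \<Longrightarrow> (\<integral>x. (fn m x - fn n x)\<^sup>2 \<partial>M) < e / 2"
      using cauchy[of "e / 2"] half_gt_zero by blast
    have "norm ((\<integral>x. (g x - fn n x)\<^sup>2 \<partial>M) - 0) < e" if n: "n \<ge> K" for n
    proof -
      have "ennreal (\<integral>x. (g x - fn n x)\<^sup>2 \<partial>M) = (\<integral>\<^sup>+x. ennreal ((g x - fn n x)\<^sup>2) \<partial>M)"
        by (rule nn_integral_eq_integral[symmetric]) (use L2_diff[OF g fn] in \<open>auto simp: L2_def\<close>)
      also have "\<dots> \<le> ennreal (e / 2)" using bound[OF _ K n] e by simp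
      finally have "(\<integral>x. (g x - fn n x)\<^sup>2 \<partial>M) \<le> e / 2"
        using e by (simp add: ennreal_le_iff)
      then show ?thesis using e by simp
    qed
    then show "\<exists>K. \<forall>n\<ge>K. norm ((\<integral>x. (g x - fn n x)\<^sup>2 \<partial>M) - 0) < e" by blast
  qed
  then show ?thesis using g by blast
qed


section \<open>Weak derivatives of limits of smooth functions\<close>

lemma AE_lebesgue_on_iff:
  assumes "S \<in> sets lebesgue"
  shows "(AE x in lebesgue_on S. P x) \<longleftrightarrow> (AE x in lebesgue. x \<in> S \<longrightarrow> P x)"
  using AE_restrict_space_iff[of S lebesgue P] assms by simp

lemma AE_lebesgue_on_subset:
  assumes "AE x in lebesgue_on S. P x" "C \<subseteq> S" "S \<in> sets lebesgue" "C \<in> sets lebesgue"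
  shows "AE x in lebesgue_on C. P x"
  using assms(1,2) unfolding AE_lebesgue_on_iff[OF assms(3)] AE_lebesgue_on_iff[OF assms(4)]
  by (auto elim!: eventually_mono)

lemma measurable_AE_lebesgue_on:
  fixes f g :: fn
  assumes S: "S \<in> sets lebesgue" and f: "f \<in> borel_measurable (lebesgue_on S)"
    and ae: "AE x in lebesgue_on S. f x = g x"
  shows "g \<in> borel_measurable (lebesgue_on S)"
proof -
  have f': "(\<lambda>x. if x \<in> S then f x else 0) \<in> borel_measurable lebesgue"
    using borel_measurable_if[OF S, of f] f by simp
  have "AE x in lebesgue. (if x \<in> S then f x else 0) = (if x \<in> S then g x else 0)"
    using ae unfolding AE_lebesgue_on_iff[OF S] by eventually_elim simp
  from borel_measurable_AE[OF f' this] show ?thesis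
    using borel_measurable_if[OF S, of g] by simp
qed

lemma integrable_AE_lebesgue_on:
  fixes f g :: fn
  assumes S: "S \<in> sets lebesgue" and f: "integrable (lebesgue_on S) f"
    and ae: "AE x in lebesgue_on S. f x = g x"
  shows "integrable (lebesgue_on S) g" "(\<integral>x. f x \<partial>lebesgue_on S) = (\<integral>x. g x \<partial>lebesgue_on S)"
proof -
  have g: "g \<in> borel_measurable (lebesgue_on S)"
    by (rule measurable_AE_lebesgue_on[OF S borel_measurable_integrable[OF f] ae])
  show "integrable (lebesgue_on S) g" by (rule integrable_cong_AE_imp[OF f g]) (use ae in \<open>auto elim!: eventually_mono\<close>)
  show "(\<integral>x. f x \<partial>lebesgue_on S) = (\<integral>x. g x \<partial>lebesgue_on S)"
    by (rule integral_cong_AE[OF borel_measurable_integrable[OF f] g ae])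
qed

lemma L2_AE_lebesgue_on:
  fixes f g :: fn
  assumes S: "S \<in> sets lebesgue" and f: "f \<in> L2 (lebesgue_on S)"
    and ae: "AE x in lebesgue_on S. f x = g x"
  shows "g \<in> L2 (lebesgue_on S)"
proof -
  have ae2: "AE x in lebesgue_on S. (f x)\<^sup>2 = (g x)\<^sup>2" using ae by eventually_elim simp
  have "integrable (lebesgue_on S) (\<lambda>x. (g x)\<^sup>2)"
    by (rule integrable_AE_lebesgue_on(1)[OF S _ ae2]) (use f in \<open>simp add: L2_def\<close>)
  moreover have "g \<in> borel_measurable (lebesgue_on S)"
    by (rule measurable_AE_lebesgue_on[OF S _ ae]) (use f in \<open>simp add: L2_def\<close>)
  ultimately show ?thesis by (simp add: L2_def)
qed

text \<open>
  Having a given weak derivative is a property of classes of functions modulo null sets. What has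
  to be transported besides the integrals is measurability, which holds because Lebesgue measure
  is complete.
\<close>

lemma is_weak_deriv_AE:
  assumes S: "open S" and fg: "is_weak_deriv S i f g"
    and f: "AE x in lebesgue_on S. f x = f' x" and g: "AE x in lebesgue_on S. g x = g' x"
  shows "is_weak_deriv S i f' g'"
proof -
  have Sm: "S \<in> sets lebesgue" using S by auto
  have li: "locally_integrable S u'"
    if u: "locally_integrable S u" and ae: "AE x in lebesgue_on S. u x = u' x" for u u'
    unfolding locally_integrable_def
  proof (intro allI impI)
    fix C assume C: "compact C \<and> C \<subseteq> S"
    then have Cm: "C \<in> sets lebesgue" by (simp add: borel_closed compact_imp_closed)
    have "AE x in lebesgue_on C. u x = u' x"
      by (rule AE_lebesgue_on_subset[OF ae _ Sm Cm]) (use C in simp)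
    then show "integrable (lebesgue_on C) u'"
      by (rule integrable_AE_lebesgue_on(1)[OF Cm, rotated]) (use u C in \<open>simp add: locally_integrable_def\<close>)
  qed
  have int: "(\<integral>x. u x * \<phi> x \<partial>lebesgue_on S) = (\<integral>x. u' x * \<phi> x \<partial>lebesgue_on S)"
    if u: "locally_integrable S u" and ae: "AE x in lebesgue_on S. u x = u' x" and \<phi>: "\<phi> \<in> test_fns S" for u u' \<phi>
  proof (rule integrable_AE_lebesgue_on(2)[OF Sm integrable_mult_test_fn[OF u \<phi> S]])
    show "AE x in lebesgue_on S. u x * \<phi> x = u' x * \<phi> x" using ae by eventually_elim simp
  qed
  show ?thesis
    unfolding is_weak_deriv_def
  proof (intro conjI ballI)
    show "locally_integrable S f'" "locally_integrable S g'"
      using fg f g li unfolding is_weak_deriv_def by blast+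
    fix \<phi> assume \<phi>: "\<phi> \<in> test_fns S"
    show "(\<integral>x. f' x * pderiv2 i \<phi> x \<partial>lebesgue_on S) = - (\<integral>x. g' x * \<phi> x \<partial>lebesgue_on S)"
      using int[OF _ f test_fns_pderiv2[OF \<phi>, of i]] int[OF _ g \<phi>] fg \<phi>
      unfolding is_weak_deriv_def by simp
  qed
qed

text \<open>
  Functions that agree almost everywhere have the same set of weak derivatives, so the choice
  operator picks literally the same representative. This allows second derivatives to be computed
  although the first ones are known only almost everywhere.
\<close>

lemma weak_deriv_cong_AE:
  assumes S: "open S" and f: "AE x in lebesgue_on S. f x = f' x"
  shows "weak_deriv S i f = weak_deriv S i f'"
proof -
  have "AE x in lebesgue_on S. f' x = f x" using f by eventually_elim simp
  then have "is_weak_deriv S i f g \<longleftrightarrow> is_weak_deriv S i f' g" for g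
    using is_weak_deriv_AE[OF S] f by (metis (mono_tags, lifting) always_eventually)
  then have "is_weak_deriv S i f = is_weak_deriv S i f'" by (rule ext)
  then show ?thesis unfolding weak_deriv_def by (simp only:)
qed

lemma is_weak_deriv_weak_deriv:
  assumes S: "open S" and g: "is_weak_deriv S i f g"
  shows "is_weak_deriv S i f (weak_deriv S i f)" "AE x in lebesgue_on S. weak_deriv S i f x = g x"
proof -
  show 1: "is_weak_deriv S i f (weak_deriv S i f)"
    unfolding weak_deriv_def by (rule someI[of "is_weak_deriv S i f", OF g])
  show "AE x in lebesgue_on S. weak_deriv S i f x = g x"
    by (rule is_weak_deriv_unique[OF S 1 g])
qed

lemma is_weak_deriv_diff:
  assumes S: "open S" and 1: "is_weak_deriv S i f g" and 2: "is_weak_deriv S i f' g'"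
  shows "is_weak_deriv S i (\<lambda>x. f x - f' x) (\<lambda>x. g x - g' x)"
  unfolding is_weak_deriv_def
proof (intro conjI ballI)
  show "locally_integrable S (\<lambda>x. f x - f' x)" "locally_integrable S (\<lambda>x. g x - g' x)"
    using 1 2 by (auto simp: locally_integrable_def is_weak_deriv_def)
  fix \<phi> assume \<phi>: "\<phi> \<in> test_fns S"
  note i = integrable_mult_test_fn[OF _ \<phi> S] integrable_mult_test_fn[OF _ test_fns_pderiv2[OF \<phi>, of i] S]
  show "(\<integral>x. (f x - f' x) * pderiv2 i \<phi> x \<partial>lebesgue_on S) = - (\<integral>x. (g x - g' x) * \<phi> x \<partial>lebesgue_on S)"
    using 1 2 \<phi> i unfolding is_weak_deriv_def by (simp add: left_diff_distrib)
qed

lemma L2_locally_integrable: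
  assumes S: "open S" and f: "f \<in> L2 (lebesgue_on S)"
  shows "locally_integrable S f"
  unfolding locally_integrable_def
proof (intro allI impI)
  fix C assume C: "compact C \<and> C \<subseteq> S"
  then have Cm: "C \<in> sets lebesgue" by (simp add: borel_closed compact_imp_closed)
  have Sm: "S \<in> sets lebesgue" using S by auto
  have "integrable lebesgue (\<lambda>x. indicator S x * (f x)\<^sup>2)"
    using f by (simp add: L2_def integrable_on_lebesgue_on_iff[OF Sm])
  then have "integrable lebesgue (\<lambda>x. indicator C x *\<^sub>R (indicator S x * (f x)\<^sup>2))"
    by (rule integrable_mult_indicator[OF Cm])
  also have "(\<lambda>x. indicator C x *\<^sub>R (indicator S x * (f x)\<^sup>2)) = (\<lambda>x. indicator C x * (f x)\<^sup>2)"
    using C by (auto simp: indicator_def fun_eq_iff)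
  finally have "integrable (lebesgue_on C) (\<lambda>x. (f x)\<^sup>2)"
    by (simp only: integrable_on_lebesgue_on_iff[OF Cm])
  moreover have "integrable (lebesgue_on C) (\<lambda>x. 1::real)"
    by (rule integrable_continuous_compact) (use C in auto)
  ultimately have i: "integrable (lebesgue_on C) (\<lambda>x. 1 + (f x)\<^sup>2)" by simp
  have "f \<in> borel_measurable (lebesgue_on C)"
    by (rule measurable_restrict_mono[of f lebesgue S]) (use f C in \<open>simp_all add: L2_def\<close>)
  moreover have "\<bar>a\<bar> \<le> 1 + a\<^sup>2" for a :: real
  proof -
    have "0 \<le> (\<bar>a\<bar> - 1)\<^sup>2" by simp
    then have "2 * \<bar>a\<bar> \<le> 1 + a\<^sup>2" by (simp add: power2_eq_square algebra_simps)
    then show ?thesis by linarith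
  qed
  ultimately show "integrable (lebesgue_on C) f"
    by (intro Bochner_Integration.integrable_bound[OF i]) auto
qed

lemma test_fns_L2:
  assumes "open S" "\<phi> \<in> test_fns S" shows "\<phi> \<in> L2 (lebesgue_on S)"
proof -
  have li: "locally_integrable S \<phi>" using assms locally_integrable_smooth by (simp add: test_fns_def)
  have "\<phi> \<in> borel_measurable (lebesgue_on S)"
    by (intro measurable_restrict_space1 continuous_measurable_lebesgue test_fns_continuous[OF assms(2)])
  then show ?thesis
    using integrable_mult_test_fn[OF li assms(2,1)] by (simp add: L2_def power2_eq_square)
qed

lemma smooth_L2:
  assumes S: "bounded S" "open S" and u: "smooth u"
  shows "u \<in> L2 (lebesgue_on S)"
proof -
  have Sm: "S \<in> sets lebesgue" "closure S \<in> sets lebesgue" using S by (auto simp: borel_closed)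
  have "integrable (lebesgue_on (closure S)) (\<lambda>x. (u x)\<^sup>2)"
    using S smooth_continuous_on[OF u, of UNIV]
    by (intro integrable_continuous_compact continuous_intros) (auto simp: compact_closure)
  then have "integrable lebesgue (\<lambda>x. indicator S x *\<^sub>R (indicator (closure S) x * (u x)\<^sup>2))"
    using Sm by (intro integrable_mult_indicator) (simp_all add: integrable_on_lebesgue_on_iff)
  also have "(\<lambda>x. indicator S x *\<^sub>R (indicator (closure S) x * (u x)\<^sup>2)) = (\<lambda>x. indicator S x * (u x)\<^sup>2)"
    using closure_subset[of S] by (auto simp: indicator_def fun_eq_iff)
  finally have "integrable (lebesgue_on S) (\<lambda>x. (u x)\<^sup>2)"
    by (simp only: integrable_on_lebesgue_on_iff[OF Sm(1)])
  moreover have "u \<in> borel_measurable (lebesgue_on S)"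
    by (intro measurable_restrict_space1 continuous_measurable_lebesgue smooth_continuous_on[OF u])
  ultimately show ?thesis by (simp add: L2_def)
qed

definition L2_lim :: "'a measure \<Rightarrow> (nat \<Rightarrow> 'a \<Rightarrow> real) \<Rightarrow> ('a \<Rightarrow> real) \<Rightarrow> bool" where
  "L2_lim M \<phi> v \<longleftrightarrow> v \<in> L2 M \<and> (\<forall>n. \<phi> n \<in> L2 M) \<and> (\<lambda>n. \<integral>x. (v x - \<phi> n x)\<^sup>2 \<partial>M) \<longlonglongrightarrow> 0"

lemma L2_lim_const: "v \<in> L2 M \<Longrightarrow> L2_lim M (\<lambda>n. v) v"
  by (simp add: L2_lim_def)

lemma L2_lim_diff:
  assumes "L2_lim M \<phi> v" "L2_lim M \<psi> w"
  shows "L2_lim M (\<lambda>n x. \<phi> n x - \<psi> n x) (\<lambda>x. v x - w x)"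
  unfolding L2_lim_def
proof (intro conjI allI)
  let ?v = "\<lambda>n. (\<integral>x. (v x - \<phi> n x)\<^sup>2 \<partial>M)"
  let ?w = "\<lambda>n. (\<integral>x. (w x - \<psi> n x)\<^sup>2 \<partial>M)"
  have m: "v \<in> L2 M" "w \<in> L2 M" "\<phi> n \<in> L2 M" "\<psi> n \<in> L2 M" for n
    using assms by (auto simp: L2_lim_def)
  show "(\<lambda>x. v x - w x) \<in> L2 M" by (rule L2_diff[OF m(1,2)])
  show "(\<lambda>x. \<phi> n x - \<psi> n x) \<in> L2 M" for n by (rule L2_diff[OF m(3,4)])
  have "(\<lambda>n. 2 * ?v n + 2 * ?w n) \<longlonglongrightarrow> 2 * 0 + 2 * 0"
    using assms by (intro tendsto_intros) (auto simp: L2_lim_def)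
  then have up: "(\<lambda>n. 2 * ?v n + 2 * ?w n) \<longlonglongrightarrow> 0" by simp
  have le: "(\<integral>x. (v x - w x - (\<phi> n x - \<psi> n x))\<^sup>2 \<partial>M)
      \<le> 2 * ?v n + 2 * ?w n" for n
  proof -
    have "v x - w x - (\<phi> n x - \<psi> n x) = (v x - \<phi> n x) - (w x - \<psi> n x)" for x by simp
    then show ?thesis
      using integral_square_diff_le[OF L2_diff[OF m(1) m(3)[of n]] L2_diff[OF m(2) m(4)[of n]]] by (simp only:)
  qed
  show "(\<lambda>n. \<integral>x. (v x - w x - (\<phi> n x - \<psi> n x))\<^sup>2 \<partial>M) \<longlonglongrightarrow> 0"
    by (rule tendsto_sandwich[OF _ _ tendsto_const up]) (use le in \<open>simp_all add: always_eventually\<close>)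
qed

lemma L2_lim_AE:
  fixes v w :: fn
  assumes S: "S \<in> sets lebesgue" and l: "L2_lim (lebesgue_on S) \<phi> v" and ae: "AE x in lebesgue_on S. v x = w x"
  shows "L2_lim (lebesgue_on S) \<phi> w"
proof -
  have "(\<integral>x. (v x - \<phi> n x)\<^sup>2 \<partial>lebesgue_on S) = (\<integral>x. (w x - \<phi> n x)\<^sup>2 \<partial>lebesgue_on S)" for n
  proof (rule integrable_AE_lebesgue_on(2)[OF S])
    show "integrable (lebesgue_on S) (\<lambda>x. (v x - \<phi> n x)\<^sup>2)"
      using L2_diff[of v "lebesgue_on S" "\<phi> n"] l unfolding L2_lim_def by (simp add: L2_def)
    show "AE x in lebesgue_on S. (v x - \<phi> n x)\<^sup>2 = (w x - \<phi> n x)\<^sup>2" using ae by eventually_elim simp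
  qed
  then show ?thesis using l L2_AE_lebesgue_on[OF S _ ae] unfolding L2_lim_def by simp
qed

text \<open>
  Both sides of the formula of integration by parts are continuous in the mean square, so it
  passes from smooth functions to their limits.
\<close>

lemma is_weak_deriv_L2_lim:
  assumes S: "open S" and sm: "\<And>n. smooth (\<phi> n)"
    and v: "L2_lim (lebesgue_on S) \<phi> v" and g: "L2_lim (lebesgue_on S) (\<lambda>n. pderiv2 i (\<phi> n)) g"
  shows "is_weak_deriv S i v g"
  unfolding is_weak_deriv_def
proof (intro conjI ballI)
  let ?M = "lebesgue_on S"
  show "locally_integrable S v" "locally_integrable S g"
    using v g L2_locally_integrable[OF S] by (auto simp: L2_lim_def)
  fix \<psi> assume \<psi>: "\<psi> \<in> test_fns S"
  have w: "\<psi> \<in> L2 (?M)" "pderiv2 i \<psi> \<in> L2 (?M)"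
    using test_fns_L2[OF S] \<psi> test_fns_pderiv2 by blast+
  have 1: "(\<lambda>n. \<integral>x. \<phi> n x * pderiv2 i \<psi> x \<partial>?M) \<longlonglongrightarrow> (\<integral>x. v x * pderiv2 i \<psi> x \<partial>?M)"
    by (rule L2_weak_convergence) (use v w in \<open>auto simp: L2_lim_def\<close>)
  have 2: "(\<lambda>n. \<integral>x. pderiv2 i (\<phi> n) x * \<psi> x \<partial>?M) \<longlonglongrightarrow> (\<integral>x. g x * \<psi> x \<partial>?M)"
    by (rule L2_weak_convergence) (use g w in \<open>auto simp: L2_lim_def\<close>)
  have "(\<integral>x. \<phi> n x * pderiv2 i \<psi> x \<partial>?M) = - (\<integral>x. pderiv2 i (\<phi> n) x * \<psi> x \<partial>?M)" for n
    using smooth_is_weak_deriv[OF S sm[of n], of i] \<psi> unfolding is_weak_deriv_def by blast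
  then have "(\<lambda>n. \<integral>x. \<phi> n x * pderiv2 i \<psi> x \<partial>?M) \<longlonglongrightarrow> - (\<integral>x. g x * \<psi> x \<partial>?M)"
    using tendsto_minus[OF 2] by simp
  from LIMSEQ_unique[OF 1 this]
  show "(\<integral>x. v x * pderiv2 i \<psi> x \<partial>?M) = - (\<integral>x. g x * \<psi> x \<partial>?M)" .
qed

text \<open>
  \<open>v\<close> is an \<open>H\<^sup>1\<close> function on \<open>S\<close> with gradient \<open>G\<close> that can be approximated by functions smooth on
  the whole plane, hence up to the boundary of \<open>S\<close>. Carrying \<open>G\<close> along avoids the chosen
  representatives of derivatives, and makes linearity a statement about sequences.
\<close>

definition smooth_limit :: "plane set \<Rightarrow> fn \<Rightarrow> (2 \<Rightarrow> fn) \<Rightarrow> bool" where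
  "smooth_limit S v G \<longleftrightarrow> (\<exists>\<phi>. (\<forall>n. smooth (\<phi> n)) \<and> L2_lim (lebesgue_on S) \<phi> v \<and>
     (\<forall>i. L2_lim (lebesgue_on S) (\<lambda>n. pderiv2 i (\<phi> n)) (G i)))"

text \<open>
  The analogue of second order, with gradient \<open>g\<close> and Hessian \<open>H\<close>; one sequence serves all
  derivatives at once.
\<close>

definition smooth_limit2 :: "plane set \<Rightarrow> fn \<Rightarrow> (2 \<Rightarrow> fn) \<Rightarrow> (2 \<Rightarrow> 2 \<Rightarrow> fn) \<Rightarrow> bool" where
  "smooth_limit2 S f g H \<longleftrightarrow> (\<exists>\<phi>. (\<forall>n. smooth (\<phi> n)) \<and> L2_lim (lebesgue_on S) \<phi> f \<and>
     (\<forall>j. L2_lim (lebesgue_on S) (\<lambda>n. pderiv2 j (\<phi> n)) (g j)) \<and>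
     (\<forall>i j. L2_lim (lebesgue_on S) (\<lambda>n. pderiv2 i (pderiv2 j (\<phi> n))) (H i j)))"

lemma smooth_limit2_fun: "smooth_limit2 S f g H \<Longrightarrow> smooth_limit S f g"
  unfolding smooth_limit2_def smooth_limit_def by blast

lemma smooth_limit2_deriv: "smooth_limit2 S f g H \<Longrightarrow> smooth_limit S (g j) (\<lambda>i. H i j)"
  unfolding smooth_limit2_def smooth_limit_def
proof (elim exE conjE)
  fix \<phi> assume \<phi>: "\<forall>n. smooth (\<phi> n)" "\<forall>j. L2_lim (lebesgue_on S) (\<lambda>n. pderiv2 j (\<phi> n)) (g j)"
    "\<forall>i j. L2_lim (lebesgue_on S) (\<lambda>n. pderiv2 i (pderiv2 j (\<phi> n))) (H i j)"
  show "\<exists>\<phi>. (\<forall>n. smooth (\<phi> n)) \<and> L2_lim (lebesgue_on S) \<phi> (g j) \<and>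
      (\<forall>i. L2_lim (lebesgue_on S) (\<lambda>n. pderiv2 i (\<phi> n)) (H i j))"
    by (rule exI[of _ "\<lambda>n. pderiv2 j (\<phi> n)"]) (use \<phi> in \<open>simp add: smooth_pderiv2\<close>)
qed

lemma smooth_limit_is_weak_deriv:
  "open S \<Longrightarrow> smooth_limit S v G \<Longrightarrow> is_weak_deriv S i v (G i)"
  unfolding smooth_limit_def
proof (elim exE conjE)
  fix \<phi> assume S: "open S" and \<phi>: "\<forall>n. smooth (\<phi> n)" "L2_lim (lebesgue_on S) \<phi> v"
    "\<forall>i. L2_lim (lebesgue_on S) (\<lambda>n. pderiv2 i (\<phi> n)) (G i)"
  show "is_weak_deriv S i v (G i)"
    by (rule is_weak_deriv_L2_lim[where \<phi>=\<phi>, OF S \<phi>(1)[rule_format] \<phi>(2) \<phi>(3)[rule_format]])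
qed

lemma smooth_limit_AE:
  assumes "open S" "smooth_limit S v G" "AE x in lebesgue_on S. v x = w x"
  shows "smooth_limit S w G"
  using assms(2) L2_lim_AE[OF sets_lebesgue_open[OF assms(1)] _ assms(3)] unfolding smooth_limit_def by metis

lemma smooth_limit2_diff:
  assumes "smooth_limit2 S f g H" "smooth_limit2 S f' g' H'"
  shows "smooth_limit2 S (\<lambda>x. f x - f' x) (\<lambda>i x. g i x - g' i x) (\<lambda>i j x. H i j x - H' i j x)"
proof -
  let ?M = "lebesgue_on S"
  obtain \<phi> where \<phi>: "\<And>n. smooth (\<phi> n)" "L2_lim (?M) \<phi> f"
     "\<And>j. L2_lim (?M) (\<lambda>n. pderiv2 j (\<phi> n)) (g j)"
     "\<And>i j. L2_lim (?M) (\<lambda>n. pderiv2 i (pderiv2 j (\<phi> n))) (H i j)"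
    using assms(1) unfolding smooth_limit2_def by blast
  obtain \<psi> where \<psi>: "\<And>n. smooth (\<psi> n)" "L2_lim (?M) \<psi> f'"
     "\<And>j. L2_lim (?M) (\<lambda>n. pderiv2 j (\<psi> n)) (g' j)"
     "\<And>i j. L2_lim (?M) (\<lambda>n. pderiv2 i (pderiv2 j (\<psi> n))) (H' i j)"
    using assms(2) unfolding smooth_limit2_def by blast
  have d: "pderiv2 j (\<lambda>x. \<phi> n x - \<psi> n x) = (\<lambda>x. pderiv2 j (\<phi> n) x - pderiv2 j (\<psi> n) x)" for j n
    by (rule pderiv2_diff[OF \<phi>(1) \<psi>(1)])
  have dd: "pderiv2 i (pderiv2 j (\<lambda>x. \<phi> n x - \<psi> n x)) = (\<lambda>x. pderiv2 i (pderiv2 j (\<phi> n)) x - pderiv2 i (pderiv2 j (\<psi> n)) x)" for i j n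
    unfolding d by (rule pderiv2_diff[OF smooth_pderiv2[OF \<phi>(1)] smooth_pderiv2[OF \<psi>(1)]])
  show ?thesis
    unfolding smooth_limit2_def
  proof (intro exI[of _ "\<lambda>n x. \<phi> n x - \<psi> n x"] conjI allI)
    show "smooth (\<lambda>x. \<phi> n x - \<psi> n x)" for n by (rule smooth_diff[OF \<phi>(1) \<psi>(1)])
    show "L2_lim (?M) (\<lambda>n x. \<phi> n x - \<psi> n x) (\<lambda>x. f x - f' x)"
      by (rule L2_lim_diff[OF \<phi>(2) \<psi>(2)])
    show "L2_lim (?M) (\<lambda>n. pderiv2 j (\<lambda>x. \<phi> n x - \<psi> n x)) (\<lambda>x. g j x - g' j x)" for j
      unfolding d by (rule L2_lim_diff[OF \<phi>(3) \<psi>(3)])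
    show "L2_lim (?M) (\<lambda>n. pderiv2 i (pderiv2 j (\<lambda>x. \<phi> n x - \<psi> n x))) (\<lambda>x. H i j x - H' i j x)" for i j
      unfolding dd by (rule L2_lim_diff[OF \<phi>(4) \<psi>(4)])
  qed
qed

lemma smooth_limit2_smooth:
  assumes "open S" "bounded S" "smooth q"
  shows "smooth_limit2 S q (\<lambda>j. pderiv2 j q) (\<lambda>i j. pderiv2 i (pderiv2 j q))"
  unfolding smooth_limit2_def
  by (rule exI[of _ "\<lambda>n. q"])
     (auto intro!: L2_lim_const smooth_L2[OF assms(2,1)] smooth_pderiv2 assms(3))

lemma smooth_limit2_AE:
  assumes "open S" "smooth_limit2 S f g H" "AE x in lebesgue_on S. f x = f' x"
  shows "smooth_limit2 S f' g H"
  using assms(2) L2_lim_AE[OF sets_lebesgue_open[OF assms(1)] _ assms(3)] unfolding smooth_limit2_def by metis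

text \<open>
  The chosen derivatives are the expected ones. For the second derivatives the first one may be
  replaced by \<open>g\<close> inside \<open>weak_deriv\<close> by \<open>weak_deriv_cong_AE\<close>.
\<close>

lemma smooth_limit2_D2:
  assumes S: "open S" and l: "smooth_limit2 S f g H"
  shows "AE x in lebesgue_on S. weak_deriv S j f x = g j x"
    and "AE x in lebesgue_on S. D2 S i j f x = H i j x"
proof -
  show 1: "AE x in lebesgue_on S. weak_deriv S j f x = g j x"
    by (rule is_weak_deriv_weak_deriv(2)[OF S smooth_limit_is_weak_deriv[OF S smooth_limit2_fun[OF l]]])
  have "D2 S i j f = weak_deriv S i (g j)"
    unfolding D2_def by (rule weak_deriv_cong_AE[OF S 1])
  then show "AE x in lebesgue_on S. D2 S i j f x = H i j x"
    using is_weak_deriv_weak_deriv(2)[OF S smooth_limit_is_weak_deriv[OF S smooth_limit2_deriv[OF l]]] by simp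
qed


section \<open>The trace inequality\<close>

lemma prod_Basis_plane: "(\<Prod>b\<in>(Basis::plane set). x \<bullet> b) = x $ 1 * x $ 2"
proof -
  have B: "(Basis :: plane set) = {axis 1 1, axis 2 1}"
    by (auto simp: Basis_vec_def UNIV_2)
  have "axis 1 (1::real) \<noteq> (axis 2 1 :: plane)" by (simp add: axis_eq_axis)
  then show ?thesis by (simp add: B inner_axis)
qed

text \<open>
  Lebesgue measure on the plane as the image of the product measure, so that Fubini's theorem
  applies to plane integrals.
\<close>

lemma lborel_plane_eq_distr: "lborel = distr lborel borel (\<lambda>(s, t). s *\<^sub>R axis 1 1 + t *\<^sub>R axis 2 1 :: plane)"
proof (rule lborel_eqI)
  have cont: "continuous_on UNIV (\<lambda>(s, t). s *\<^sub>R axis 1 1 + t *\<^sub>R axis 2 1 :: plane)"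
    unfolding case_prod_beta by (intro continuous_intros)
  then have meas: "(\<lambda>(s, t). s *\<^sub>R axis 1 1 + t *\<^sub>R axis 2 1 :: plane) \<in> borel_measurable lborel"
    by (simp add: borel_measurable_continuous_onI)
  fix l u :: plane assume le: "\<And>b. b \<in> Basis \<Longrightarrow> l \<bullet> b \<le> u \<bullet> b"
  have le': "l $ 1 \<le> u $ 1" "l $ 2 \<le> u $ 2"
    using le[of "axis 1 1"] le[of "axis 2 1"] by (auto simp: inner_axis axis_in_Basis_iff)
  have pre: "(\<lambda>(s, t). s *\<^sub>R axis 1 1 + t *\<^sub>R axis 2 1 :: plane) -` box l u = {l$1<..<u$1} \<times> {l$2<..<u$2}"
    by (auto simp: mem_box_plane axis_def)
  have "emeasure (distr lborel borel (\<lambda>(s, t). s *\<^sub>R axis 1 1 + t *\<^sub>R axis 2 1 :: plane)) (box l u)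
      = emeasure lborel ({l$1<..<u$1} \<times> {l$2<..<u$2})"
    using meas by (subst emeasure_distr) (auto simp: pre)
  also have "\<dots> = emeasure lborel {l$1<..<u$1} * emeasure lborel {l$2<..<u$2}"
    by (subst lborel_prod[symmetric]) (simp add: lborel.emeasure_pair_measure_Times)
  also have "\<dots> = ennreal ((u$1 - l$1) * (u$2 - l$2))"
    using le' by (simp add: ennreal_mult)
  also have "\<dots> = ennreal (\<Prod>b\<in>Basis. (u - l) \<bullet> b)" by (simp add: prod_Basis_plane)
  finally show "emeasure (distr lborel borel (\<lambda>(s, t). s *\<^sub>R axis 1 1 + t *\<^sub>R axis 2 1 :: plane)) (box l u) = ennreal (\<Prod>b\<in>Basis. (u - l) \<bullet> b)" .
qed simp

text \<open>
  Images of boxes under the inverse of \<open>g\<close> have a measure proportional to that of the box, so the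
  image of Lebesgue measure under \<open>g\<close> is a multiple of Lebesgue measure.
\<close>

lemma nn_integral_linear_change:
  fixes g :: "plane \<Rightarrow> plane"
  assumes g: "linear g" "inj g"
  shows "\<exists>k>0. \<forall>f\<in>borel_measurable borel. (\<integral>\<^sup>+x. f x \<partial>lborel) = ennreal k * (\<integral>\<^sup>+x. f (g x) \<partial>lborel)"
proof -
  obtain h where h: "linear h" "\<And>x. h (g x) = x" "\<And>x. g (h x) = x"
    using linear_injective_isomorphism[OF g] by blast
  have "inj h" using h(3) by (metis injI)
  then have "det (matrix h) \<noteq> 0" using h(1) det_nz_iff_inj by blast
  define d where "d = \<bar>det (matrix h)\<bar>"
  have d: "d > 0" using \<open>det (matrix h) \<noteq> 0\<close> by (simp add: d_def)
  have gm: "g \<in> borel_measurable lborel"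
    using g by (simp add: borel_measurable_continuous_onI linear_continuous_on linear_conv_bounded_linear)
  have "lborel = scale_measure (ennreal (1/d)) (distr lborel borel g)"
  proof (rule lborel_eqI)
    fix l u :: plane assume le: "\<And>b. b \<in> Basis \<Longrightarrow> l \<bullet> b \<le> u \<bullet> b"
    have pre: "g -` box l u = h ` box l u" using h by (auto simp: image_iff) (metis)
    have bs: "h ` box l u \<in> sets borel"
      using measurable_sets[OF gm, of "box l u"] by (simp add: pre)
    have lm: "h ` box l u \<in> lmeasurable" by (rule measurable_linear_image[OF h(1)]) simp
    have "emeasure (distr lborel borel g) (box l u) = emeasure lborel (h ` box l u)"
      using gm by (subst emeasure_distr) (auto simp: pre)
    also have "\<dots> = emeasure lebesgue (h ` box l u)" using bs by simp
    also have "\<dots> = ennreal (measure lebesgue (h ` box l u))" using lm by (rule emeasure_eq_measure2)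
    also have "measure lebesgue (h ` box l u) = d * measure lebesgue (box l u)"
      unfolding d_def by (rule measure_linear_image[OF h(1)]) simp
    also have "measure lebesgue (box l u) = (\<Prod>b\<in>Basis. (u - l) \<bullet> b)"
      using le by (simp add: measure_lborel_box_eq)
    finally have "emeasure (distr lborel borel g) (box l u) = ennreal (d * (\<Prod>b\<in>Basis. (u - l) \<bullet> b))" .
    moreover have "0 \<le> (\<Prod>b\<in>Basis. (u - l) \<bullet> b)"
      by (rule prod_nonneg) (use le in \<open>auto simp: inner_diff_left\<close>)
    ultimately show "emeasure (scale_measure (ennreal (1/d)) (distr lborel borel g)) (box l u) = ennreal (\<Prod>b\<in>Basis. (u - l) \<bullet> b)"
      using d by (simp add: ennreal_mult[symmetric])
  qed simp
  note eq = this
  have "(\<integral>\<^sup>+x. f x \<partial>lborel) = ennreal (1/d) * (\<integral>\<^sup>+x. f (g x) \<partial>lborel)" if f: "f \<in> borel_measurable borel" for f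
  proof -
    have "(\<integral>\<^sup>+x. f x \<partial>lborel) = (\<integral>\<^sup>+x. f x \<partial>scale_measure (ennreal (1/d)) (distr lborel borel g))"
      using eq by simp
    also have "\<dots> = ennreal (1/d) * (\<integral>\<^sup>+x. f x \<partial>distr lborel borel g)"
      by (rule nn_integral_scale_measure) (use f in simp)
    also have "(\<integral>\<^sup>+x. f x \<partial>distr lborel borel g) = (\<integral>\<^sup>+x. f (g x) \<partial>lborel)"
      by (rule nn_integral_distr) (use gm f in simp_all)
    finally show ?thesis .
  qed
  then show ?thesis using d by (intro exI[of _ "1/d"]) simp
qed

text \<open>
  Fubini's theorem in the oblique coordinates given by two independent directions.
\<close>

lemma nn_integral_parallelogram:
  fixes p u v :: plane
  assumes uv: "u $ 1 * v $ 2 \<noteq> u $ 2 * v $ 1"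
  shows "\<exists>k>0. \<forall>f\<in>borel_measurable borel. (\<integral>\<^sup>+s. \<integral>\<^sup>+t. f (p + s *\<^sub>R u + t *\<^sub>R v) \<partial>lborel \<partial>lborel) = ennreal k * (\<integral>\<^sup>+x. f x \<partial>lborel)"
proof -
  define g where "g x = x $ 1 *\<^sub>R u + x $ 2 *\<^sub>R v" for x :: plane
  have g: "linear g" unfolding g_def by (rule linearI) (simp_all add: algebra_simps)
  moreover have "inj g"
  proof (subst linear_injective_0[OF g], intro allI impI)
    fix x assume "g x = 0"
    then have e: "x$1 * u$1 + x$2 * v$1 = 0" "x$1 * u$2 + x$2 * v$2 = 0"
      by (auto simp: g_def vec_eq_iff forall_2)
    have f: "x$1 * (u$1 * v$2 - u$2 * v$1) = v$2 * (x$1 * u$1 + x$2 * v$1) - v$1 * (x$1 * u$2 + x$2 * v$2)"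
      "x$2 * (u$1 * v$2 - u$2 * v$1) = u$1 * (x$1 * u$2 + x$2 * v$2) - u$2 * (x$1 * u$1 + x$2 * v$1)"
      by (simp_all add: algebra_simps)
    then have "x$1 * (u$1 * v$2 - u$2 * v$1) = 0" "x$2 * (u$1 * v$2 - u$2 * v$1) = 0" unfolding e by simp_all
    then have "x$1 = 0" "x$2 = 0" using uv by simp_all
    then show "x = 0" by (simp add: vec_eq_iff forall_2)
  qed
  ultimately obtain k where k: "k > 0" "\<And>f. f\<in>borel_measurable borel \<Longrightarrow> (\<integral>\<^sup>+x. f x \<partial>lborel) = ennreal k * (\<integral>\<^sup>+x. f (g x) \<partial>lborel)"
    using nn_integral_linear_change by blast
  have "(\<integral>\<^sup>+s. \<integral>\<^sup>+t. f (p + s *\<^sub>R u + t *\<^sub>R v) \<partial>lborel \<partial>lborel) = ennreal (1/k) * (\<integral>\<^sup>+x. f x \<partial>lborel)"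
    if f[measurable]: "f \<in> borel_measurable borel" for f
  proof -
    define V where "V = (\<lambda>(s::real, t::real). s *\<^sub>R axis 1 1 + t *\<^sub>R axis 2 1 :: plane)"
    have "continuous_on UNIV V" unfolding V_def case_prod_beta
      by (intro continuous_intros)
    then have V[measurable]: "V \<in> borel_measurable borel" by (rule borel_measurable_continuous_onI)
    have gm[measurable]: "g \<in> borel_measurable borel"
      using g by (simp add: borel_measurable_continuous_onI linear_continuous_on linear_conv_bounded_linear)
    have gV: "p + g (V (s, t)) = p + s *\<^sub>R u + t *\<^sub>R v" for s t by (simp add: g_def V_def axis_def)
    have fm: "(\<lambda>z. f (p + g (V z))) \<in> borel_measurable borel" by measurable
    have "(\<integral>\<^sup>+s. \<integral>\<^sup>+t. f (p + s *\<^sub>R u + t *\<^sub>R v) \<partial>lborel \<partial>lborel)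
        = (\<integral>\<^sup>+s. \<integral>\<^sup>+t. f (p + g (V (s, t))) \<partial>lborel \<partial>lborel)" by (simp only: gV)
    also have "\<dots> = (\<integral>\<^sup>+z. f (p + g (V z)) \<partial>(lborel \<Otimes>\<^sub>M lborel))"
      by (rule lborel.nn_integral_fst) (use fm in \<open>simp add: lborel_prod\<close>)
    also have "\<dots> = (\<integral>\<^sup>+z. f (p + g (V z)) \<partial>lborel)" by (simp add: lborel_prod)
    also have "\<dots> = (\<integral>\<^sup>+x. f (p + g x) \<partial>distr lborel borel V)"
      by (rule nn_integral_distr[symmetric]) simp_all
    also have "\<dots> = (\<integral>\<^sup>+x. f (p + g x) \<partial>lborel)" using lborel_plane_eq_distr by (simp add: V_def)
    also have "\<dots> = ennreal (1/k) * (\<integral>\<^sup>+x. f (p + x) \<partial>lborel)"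
    proof -
      have "(\<integral>\<^sup>+x. f (p + x) \<partial>lborel) = ennreal k * (\<integral>\<^sup>+x. f (p + g x) \<partial>lborel)"
        by (rule k(2)[of "\<lambda>x. f (p + x)"]) measurable
      then show ?thesis using k(1)
        by (simp add: mult.assoc[symmetric] ennreal_mult[symmetric])
    qed
    also have "(\<integral>\<^sup>+x. f (p + x) \<partial>lborel) = (\<integral>\<^sup>+x. f x \<partial>distr lborel borel ((+) p))"
      by (rule nn_integral_distr[symmetric]) simp_all
    also have "\<dots> = (\<integral>\<^sup>+x. f x \<partial>lborel)" by (simp add: lborel_distr_plus)
    finally show ?thesis .
  qed
  then show ?thesis using k by (intro exI[of _ "1/k"]) simp
qed

text \<open>
  Apply the fundamental theorem of calculus to \<open>- (1 - t) (w t)\<^sup>2\<close>: the weight vanishes at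
  \<open>t = 1\<close>, so only the value at 0 remains, and Young's inequality removes the mixed term.
\<close>

lemma value_at_0_le_integral:
  fixes w w' :: "real \<Rightarrow> real"
  assumes d: "\<And>t. (w has_real_derivative w' t) (at t)" and c: "continuous_on UNIV w'"
  shows "ennreal ((w 0)\<^sup>2) \<le> (\<integral>\<^sup>+t. indicator {0..1} t * ennreal (2 * (w t)\<^sup>2 + (w' t)\<^sup>2) \<partial>lborel)"
proof -
  let ?W = "\<lambda>t. 2 * (w t)\<^sup>2 + (w' t)\<^sup>2"
  have cw: "continuous_on A w" for A
    using d by (meson DERIV_isCont continuous_at_imp_continuous_on)
  have cw': "continuous_on A w'" for A using c continuous_on_subset by blast
  have F: "((\<lambda>t. (w t)\<^sup>2 - 2 * (1 - t) * w t * w' t) has_integral ((-(1-1) * (w 1)\<^sup>2) - (-(1-0) * (w 0)\<^sup>2))) {0..1}"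
  proof (rule fundamental_theorem_of_calculus)
    fix x :: real assume "x \<in> {0..1}"
    have "((\<lambda>t. - (1 - t) * (w t)\<^sup>2) has_real_derivative ((w x)\<^sup>2 - 2 * (1 - x) * w x * w' x)) (at x)"
      by (auto intro!: derivative_eq_intros d simp: algebra_simps)
    then show "((\<lambda>t. - (1 - t) * (w t)\<^sup>2) has_vector_derivative ((w x)\<^sup>2 - 2 * (1 - x) * w x * w' x)) (at x within {0..1})"
      by (simp add: has_real_derivative_iff_has_vector_derivative has_vector_derivative_at_within)
  qed simp
  have i: "(?W) integrable_on {0..1}"
    by (intro integrable_continuous_interval continuous_intros cw cw')
  then have I: "((?W) has_integral integral {0..1} (?W)) {0..1}"
    by (rule integrable_integral)
  have le: "(w 0)\<^sup>2 \<le> integral {0..1} (?W)"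
  proof -
    have "(-(1-1) * (w 1)\<^sup>2) - (-(1-0) * (w 0)\<^sup>2) \<le> integral {0..1} (?W)"
    proof (rule has_integral_le[OF F I])
      fix t :: real assume t: "t \<in> {0..1}"
      have "0 \<le> (w t + (1 - t) * w' t)\<^sup>2" by simp
      then have "- 2 * (1 - t) * w t * w' t \<le> (w t)\<^sup>2 + (1 - t)\<^sup>2 * (w' t)\<^sup>2"
        by (simp add: power2_eq_square algebra_simps)
      moreover have "(1 - t)\<^sup>2 * (w' t)\<^sup>2 \<le> 1 * (w' t)\<^sup>2"
        using t by (intro mult_right_mono) (auto simp: power_le_one)
      ultimately show "(w t)\<^sup>2 - 2 * (1 - t) * w t * w' t \<le> 2 * (w t)\<^sup>2 + (w' t)\<^sup>2" by linarith
    qed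
    then show ?thesis by simp
  qed
  have "(\<integral>\<^sup>+t. indicator {0..1} t * ennreal (2 * (w t)\<^sup>2 + (w' t)\<^sup>2) \<partial>lborel)
     = (\<integral>\<^sup>+t. ennreal (indicator {0..1} t * (2 * (w t)\<^sup>2 + (w' t)\<^sup>2)) \<partial>lborel)"
    by (rule nn_integral_cong) (auto simp: indicator_def)
  also have "\<dots> = ennreal (integral {0..1} (?W))"
    by (rule nn_integral_has_integral_lebesgue[OF _ I]) simp
  finally show ?thesis using le by (simp add: ennreal_leI)
qed


definition H1_density :: "fn \<Rightarrow> fn" where
  "H1_density \<phi> x = (\<phi> x)\<^sup>2 + (\<Sum>i\<in>UNIV. (pderiv2 i \<phi> x)\<^sup>2)"

lemma H1_density_measurable: "smooth \<phi> \<Longrightarrow> H1_density \<phi> \<in> borel_measurable borel"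
  unfolding H1_density_def
  by (intro borel_measurable_continuous_onI continuous_intros smooth_continuous_on smooth_pderiv2)

text \<open>
  Apply the one-dimensional bound on each segment that leaves the edge in direction \<open>v\<close> and
  integrate over the starting points \<open>p + s u\<close>; these segments fill a parallelogram inside \<open>K\<close>.
\<close>

lemma trace_inequality_parallelogram:
  fixes p u v :: plane
  assumes uv: "u $ 1 * v $ 2 \<noteq> u $ 2 * v $ 1" and K: "closed K"
    and sub: "\<And>s t. s \<in> {0..1} \<Longrightarrow> t \<in> {0..1} \<Longrightarrow> p + s *\<^sub>R u + t *\<^sub>R v \<in> K"
  shows "\<exists>C>0. \<forall>\<phi>. smooth \<phi> \<longrightarrow>
    (\<integral>\<^sup>+s. indicator {0..1} s * ennreal ((\<phi> (p + s *\<^sub>R u))\<^sup>2) \<partial>lborel)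
      \<le> ennreal C * (\<integral>\<^sup>+x. indicator K x * ennreal (H1_density \<phi> x) \<partial>lborel)"
proof -
  obtain k where k: "k > 0" "\<And>f. f\<in>borel_measurable borel \<Longrightarrow>
      (\<integral>\<^sup>+s. \<integral>\<^sup>+t. f (p + s *\<^sub>R u + t *\<^sub>R v) \<partial>lborel \<partial>lborel) = ennreal k * (\<integral>\<^sup>+x. f x \<partial>lborel)"
    using nn_integral_parallelogram[OF uv, of p] by blast
  define m where "m = 2 + (v$1)\<^sup>2 + (v$2)\<^sup>2"
  have m: "m > 0" unfolding m_def by (smt (verit) zero_le_power2)
  have "(\<integral>\<^sup>+s. indicator {0..1} s * ennreal ((\<phi> (p + s *\<^sub>R u))\<^sup>2) \<partial>lborel)
      \<le> ennreal (m * k) * (\<integral>\<^sup>+x. indicator K x * ennreal (H1_density \<phi> x) \<partial>lborel)" if \<phi>: "smooth \<phi>" for \<phi>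
  proof -
    define F where "F x = indicator K x * ennreal (H1_density \<phi> x)" for x
    have Fm[measurable]: "F \<in> borel_measurable borel"
      unfolding F_def
      by (intro borel_measurable_times_ennreal borel_measurable_indicator borel_closed[OF K]
          measurable_compose[OF H1_density_measurable[OF \<phi>] measurable_ennreal])
    have step: "indicator {0..1} s * ennreal ((\<phi> (p + s *\<^sub>R u))\<^sup>2)
        \<le> ennreal m * (\<integral>\<^sup>+t. F (p + s *\<^sub>R u + t *\<^sub>R v) \<partial>lborel)" for s
    proof (cases "s \<in> {0..1}")
      case False then show ?thesis by simp
    next
      case True
      define w where "w t = \<phi> (p + s *\<^sub>R u + t *\<^sub>R v)" for t
      define w' where "w' t = (\<Sum>i\<in>UNIV. v $ i * pderiv2 i \<phi> (p + s *\<^sub>R u + t *\<^sub>R v))" for t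
      have d: "(w has_real_derivative w' t) (at t)" for t
        unfolding w_def w'_def by (rule DERIV_along_line[OF \<phi>])
      have c: "continuous_on UNIV w'"
        unfolding w'_def
        by (intro continuous_intros continuous_on_compose2[OF smooth_continuous_on[OF smooth_pderiv2[OF \<phi>], of UNIV]]) auto
      have "indicator {0..1} s * ennreal ((\<phi> (p + s *\<^sub>R u))\<^sup>2) = ennreal ((w 0)\<^sup>2)"
        using True by (simp add: w_def)
      also have "\<dots> \<le> (\<integral>\<^sup>+t. indicator {0..1} t * ennreal (2 * (w t)\<^sup>2 + (w' t)\<^sup>2) \<partial>lborel)"
        by (rule value_at_0_le_integral[OF d c])
      also have "\<dots> \<le> (\<integral>\<^sup>+t. ennreal m * F (p + s *\<^sub>R u + t *\<^sub>R v) \<partial>lborel)"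
      proof (rule nn_integral_mono)
        fix t :: real
        show "indicator {0..1} t * ennreal (2 * (w t)\<^sup>2 + (w' t)\<^sup>2) \<le> ennreal m * F (p + s *\<^sub>R u + t *\<^sub>R v)"
        proof (cases "t \<in> {0..1}")
          case False then show ?thesis by simp
        next
          case t: True
          let ?x = "p + s *\<^sub>R u + t *\<^sub>R v"
          let ?a = "pderiv2 1 \<phi> ?x" and ?b = "pderiv2 2 \<phi> ?x"
          have w': "w' t = v$1 * ?a + v$2 * ?b" by (simp add: w'_def UNIV_2)
          have "0 \<le> (v$1 * ?b - v$2 * ?a)\<^sup>2" by simp
          then have "(w' t)\<^sup>2 \<le> ((v$1)\<^sup>2 + (v$2)\<^sup>2) * (?a\<^sup>2 + ?b\<^sup>2)"
            unfolding w' by (simp add: power2_eq_square algebra_simps)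
          moreover have "H1_density \<phi> ?x = (w t)\<^sup>2 + (?a\<^sup>2 + ?b\<^sup>2)"
            by (simp add: H1_density_def UNIV_2 w_def)
          then have "m * H1_density \<phi> ?x = 2 * (w t)\<^sup>2 + ((v$1)\<^sup>2 + (v$2)\<^sup>2) * (w t)\<^sup>2
              + 2 * (?a\<^sup>2 + ?b\<^sup>2) + ((v$1)\<^sup>2 + (v$2)\<^sup>2) * (?a\<^sup>2 + ?b\<^sup>2)"
            by (simp only: m_def) (simp add: algebra_simps)
          moreover have "0 \<le> ((v$1)\<^sup>2 + (v$2)\<^sup>2) * (w t)\<^sup>2" "0 \<le> ?a\<^sup>2 + ?b\<^sup>2" by simp_all
          moreover have "2 * x + y \<le> z" if "y \<le> q" "z = 2 * x + r + 2 * d + q" "0 \<le> r" "0 \<le> d" for x y z q r d :: real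
            using that by linarith
          ultimately have "2 * (w t)\<^sup>2 + (w' t)\<^sup>2 \<le> m * H1_density \<phi> ?x" by blast
          then have "ennreal (2 * (w t)\<^sup>2 + (w' t)\<^sup>2) \<le> ennreal m * ennreal (H1_density \<phi> ?x)"
            using m by (simp add: ennreal_mult'[symmetric] ennreal_leI del: ennreal_plus)
          then show ?thesis using t sub[OF True t] by (simp add: F_def)
        qed
      qed
      also have "\<dots> = ennreal m * (\<integral>\<^sup>+t. F (p + s *\<^sub>R u + t *\<^sub>R v) \<partial>lborel)"
        by (rule nn_integral_cmult) measurable
      finally show ?thesis .
    qed
    have "(\<integral>\<^sup>+s. indicator {0..1} s * ennreal ((\<phi> (p + s *\<^sub>R u))\<^sup>2) \<partial>lborel)
       \<le> (\<integral>\<^sup>+s. ennreal m * (\<integral>\<^sup>+t. F (p + s *\<^sub>R u + t *\<^sub>R v) \<partial>lborel) \<partial>lborel)"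
      by (rule nn_integral_mono) (rule step)
    also have "\<dots> = ennreal m * (\<integral>\<^sup>+s. \<integral>\<^sup>+t. F (p + s *\<^sub>R u + t *\<^sub>R v) \<partial>lborel \<partial>lborel)"
      by (rule nn_integral_cmult) measurable
    also have "\<dots> = ennreal (m * k) * (\<integral>\<^sup>+x. F x \<partial>lborel)"
      unfolding k(2)[OF Fm] using m k(1) by (simp add: ennreal_mult mult.assoc)
    finally show ?thesis unfolding F_def .
  qed
  then show ?thesis using m k(1) by (intro exI[of _ "m * k"]) simp
qed

lemma in_triangle:
  fixes a b c :: plane
  assumes "0 \<le> s" "0 \<le> t" "s + t \<le> 1"
  shows "a + s *\<^sub>R (b - a) + t *\<^sub>R (c - a) \<in> convex hull {a, b, c}"
  unfolding convex_hull_3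
  by (rule CollectI, rule exI[of _ "1 - s - t"], rule exI[of _ s], rule exI[of _ t]) (use assms in \<open>simp add: algebra_simps\<close>)

text \<open>
  No parallelogram over the whole edge fits into the triangle. Each half of the edge, however,
  spans with half of the adjacent side a parallelogram that does, so the edge is cut at its
  midpoint.
\<close>

lemma trace_inequality:
  fixes a b c :: plane
  assumes nd: "(b - a) $ 1 * (c - a) $ 2 \<noteq> (b - a) $ 2 * (c - a) $ 1"
  shows "\<exists>C>0. \<forall>\<phi>. smooth \<phi> \<longrightarrow>
    (\<integral>\<^sup>+s. indicator {0..1} s * ennreal ((\<phi> (linepath a b s))\<^sup>2) \<partial>lborel)
      \<le> ennreal C * (\<integral>\<^sup>+x. indicator (convex hull {a, b, c}) x * ennreal (H1_density \<phi> x) \<partial>lborel)"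
proof -
  let ?K = "convex hull {a, b, c}"
  have K: "closed ?K" by (simp add: compact_imp_closed compact_convex_hull finite_imp_compact)
  have *: "p + s *\<^sub>R (1/2) *\<^sub>R (q - p) + t *\<^sub>R (1/2) *\<^sub>R (c - p) \<in> convex hull {p, q, c}"
    if "s \<in> {0..1}" "t \<in> {0..1}" for s t :: real and p q
    using in_triangle[of "s/2" "t/2" p q c] that by simp
  have K': "convex hull {b, a, c} = ?K" by (simp add: insert_commute)
  have nd1: "((1/2) *\<^sub>R (b - a)) $ 1 * ((1/2) *\<^sub>R (c - a)) $ 2 \<noteq> ((1/2) *\<^sub>R (b - a)) $ 2 * ((1/2) *\<^sub>R (c - a)) $ 1"
    using nd by simp
  have nd2: "((1/2) *\<^sub>R (a - b)) $ 1 * ((1/2) *\<^sub>R (c - b)) $ 2 \<noteq> ((1/2) *\<^sub>R (a - b)) $ 2 * ((1/2) *\<^sub>R (c - b)) $ 1"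
    using nd by (simp add: algebra_simps)
  obtain C1 where C1: "C1 > 0" "\<forall>\<phi>. smooth \<phi> \<longrightarrow>
      (\<integral>\<^sup>+s. indicator {0..1} s * ennreal ((\<phi> (a + s *\<^sub>R (1/2) *\<^sub>R (b - a)))\<^sup>2) \<partial>lborel)
      \<le> ennreal C1 * (\<integral>\<^sup>+x. indicator ?K x * ennreal (H1_density \<phi> x) \<partial>lborel)"
    by (rule exE[OF trace_inequality_parallelogram[OF nd1 K *[where p=a and q=b]]]) (auto intro: that)
  obtain C2 where C2: "C2 > 0" "\<forall>\<phi>. smooth \<phi> \<longrightarrow>
      (\<integral>\<^sup>+s. indicator {0..1} s * ennreal ((\<phi> (b + s *\<^sub>R (1/2) *\<^sub>R (a - b)))\<^sup>2) \<partial>lborel)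
      \<le> ennreal C2 * (\<integral>\<^sup>+x. indicator ?K x * ennreal (H1_density \<phi> x) \<partial>lborel)"
    by (rule exE[OF trace_inequality_parallelogram[OF nd2 K *[where p=b and q=a, unfolded K']]]) (auto intro: that)
  have "(\<integral>\<^sup>+s. indicator {0..1} s * ennreal ((\<phi> (linepath a b s))\<^sup>2) \<partial>lborel)
      \<le> ennreal (C1 / 2 + C2 / 2) * (\<integral>\<^sup>+x. indicator ?K x * ennreal (H1_density \<phi> x) \<partial>lborel)"
    if \<phi>: "smooth \<phi>" for \<phi>
  proof -
    let ?I = "\<integral>\<^sup>+x. indicator ?K x * ennreal (H1_density \<phi> x) \<partial>lborel"
    define G where "G s = ennreal ((\<phi> (linepath a b s))\<^sup>2)" for s
    have "continuous_on UNIV (\<lambda>s. (\<phi> (linepath a b s))\<^sup>2)"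
      by (intro continuous_intros continuous_on_compose2[OF smooth_continuous_on[OF \<phi>, of UNIV] continuous_on_linepath]) auto
    then have [measurable]: "G \<in> borel_measurable borel"
      unfolding G_def by (intro measurable_compose[OF _ measurable_ennreal] borel_measurable_continuous_onI)
    let ?HA = "\<integral>\<^sup>+s. indicator {0..1} s * ennreal ((\<phi> (a + s *\<^sub>R (1/2) *\<^sub>R (b - a)))\<^sup>2) \<partial>lborel"
    let ?HB = "\<integral>\<^sup>+s. indicator {0..1} s * ennreal ((\<phi> (b + s *\<^sub>R (1/2) *\<^sub>R (a - b)))\<^sup>2) \<partial>lborel"
    let ?J1 = "(\<integral>\<^sup>+s. indicator {0..1/2} (0 + 1/2 * s) * G (0 + 1/2 * s) \<partial>lborel)"
    let ?J2 = "(\<integral>\<^sup>+s. indicator {1/2..1} (1 + (-1/2) * s) * G (1 + (-1/2) * s) \<partial>lborel)"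
    have GI: "(\<lambda>s. indicator {l..r} s * G s) \<in> borel_measurable borel" for l r :: real
      by (intro borel_measurable_times_ennreal borel_measurable_indicator) simp_all
    have "(\<integral>\<^sup>+s. indicator {0..1} s * G s \<partial>lborel)
       \<le> (\<integral>\<^sup>+s. indicator {0..1/2} s * G s + indicator {1/2..1} s * G s \<partial>lborel)"
      by (rule nn_integral_mono) (auto simp: indicator_def)
    also have "\<dots> = (\<integral>\<^sup>+s. indicator {0..1/2} s * G s \<partial>lborel) + (\<integral>\<^sup>+s. indicator {1/2..1} s * G s \<partial>lborel)"
      by (rule nn_integral_add) (simp_all add: GI)
    also have "(\<integral>\<^sup>+s. indicator {0..1/2} s * G s \<partial>lborel)
        = ennreal \<bar>1/2\<bar> * ?J1"
      by (rule nn_integral_real_affine[OF GI]) simp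
    also have "?J1
        = (?HA)"
    proof (rule nn_integral_cong)
      fix s :: real
      have "linepath a b (s / 2) = a + s *\<^sub>R (1/2) *\<^sub>R (b - a)"
        by (simp add: linepath_def algebra_simps)
      then show "indicator {0..1/2} (0 + 1/2 * s) * G (0 + 1/2 * s) = indicator {0..1} s * ennreal ((\<phi> (a + s *\<^sub>R (1/2) *\<^sub>R (b - a)))\<^sup>2)"
        by (auto simp: G_def indicator_def)
    qed
    also have "(\<integral>\<^sup>+s. indicator {1/2..1} s * G s \<partial>lborel)
        = ennreal \<bar>-1/2\<bar> * ?J2"
      by (rule nn_integral_real_affine[OF GI]) simp
    also have "?J2
        = (?HB)"
    proof (rule nn_integral_cong)
      fix s :: real
      have "linepath a b (1 - s / 2) = b + s *\<^sub>R (1/2) *\<^sub>R (a - b)"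
        by (simp add: linepath_def algebra_simps)
      then show "indicator {1/2..1} (1 + (-1/2) * s) * G (1 + (-1/2) * s) = indicator {0..1} s * ennreal ((\<phi> (b + s *\<^sub>R (1/2) *\<^sub>R (a - b)))\<^sup>2)"
        by (auto simp: G_def indicator_def)
    qed
    also have "ennreal \<bar>1/2\<bar> * (?HA)
        + ennreal \<bar>-1/2\<bar> * (?HB)
        \<le> ennreal \<bar>1/2\<bar> * (ennreal C1 * ?I) + ennreal \<bar>-1/2\<bar> * (ennreal C2 * ?I)"
      by (intro add_mono mult_left_mono C1(2)[rule_format] C2(2)[rule_format] \<phi>) simp_all
    also have "\<dots> = (ennreal (1/2) * ennreal C1 + ennreal (1/2) * ennreal C2) * ?I"
      by (simp add: distrib_right mult.assoc)
    also have "ennreal (1/2) * ennreal C1 + ennreal (1/2) * ennreal C2 = ennreal (C1 / 2 + C2 / 2)"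
    proof -
      have "ennreal (1/2) * ennreal C1 = ennreal (1/2 * C1)" "ennreal (1/2) * ennreal C2 = ennreal (1/2 * C2)"
        using C1(1) C2(1) by (simp_all only: ennreal_mult less_imp_le zero_le_divide_1_iff zero_le_numeral)
      moreover have "ennreal (1/2 * C1) + ennreal (1/2 * C2) = ennreal (1/2 * C1 + 1/2 * C2)"
        using C1(1) C2(1) by (intro ennreal_plus[symmetric]) simp_all
      ultimately show ?thesis by simp
    qed
    finally show ?thesis unfolding G_def .
  qed
  then show ?thesis using C1(1) C2(1) by (intro exI[of _ "C1 / 2 + C2 / 2"]) simp
qed


section \<open>Traces on edges\<close>

text \<open>
  The parametrization is chosen, but a segment determines its end points up to order.
\<close>

lemma edge_param_cases:
  assumes "E = closed_segment a b"
  shows "edge_param E = linepath a b \<or> edge_param E = linepath b a"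
proof -
  have "\<exists>a' b'. E = closed_segment a' b' \<and> edge_param E = linepath a' b'"
    unfolding edge_param_def
  proof (rule someI[of "\<lambda>p. \<exists>a' b'. E = closed_segment a' b' \<and> p = linepath a' b'" "linepath a b"])
    show "\<exists>a' b'. E = closed_segment a' b' \<and> linepath a b = linepath a' b'" using assms by blast
  qed
  then obtain a' b' where e: "E = closed_segment a' b'" "edge_param E = linepath a' b'" by blast
  then have "{a, b} = {a', b'}" using assms by (simp add: closed_segment_eq)
  then show ?thesis using e(2) by (auto simp: doubleton_eq_iff)
qed

lemma edge_param_continuous:
  assumes "E = closed_segment a b" shows "continuous_on A (edge_param E)"
  using edge_param_cases[OF assms] by (auto intro: continuous_on_linepath)

lemma nn_integral_edge_measure:
  assumes E: "E = closed_segment a b" and f: "f \<in> borel_measurable borel"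
  shows "(\<integral>\<^sup>+x. f x \<partial>edge_measure E) =
    ennreal (diameter E) * (\<integral>\<^sup>+s. indicator {0..1} s * f (edge_param E s) \<partial>lborel)"
proof -
  have p: "edge_param E \<in> borel_measurable borel"
    by (rule borel_measurable_continuous_onI[OF edge_param_continuous[OF E]])
  then have pm: "edge_param E \<in> measurable (lebesgue_on {0..1}) borel"
    by (intro measurable_restrict_space1 measurable_completion) simp
  have "(\<integral>\<^sup>+x. f x \<partial>edge_measure E)
      = ennreal (diameter E) * (\<integral>\<^sup>+x. f x \<partial>distr (lebesgue_on {0..1}) borel (edge_param E))"
    unfolding edge_measure_def by (rule nn_integral_scale_measure) (use f in simp)
  also have "(\<integral>\<^sup>+x. f x \<partial>distr (lebesgue_on {0..1}) borel (edge_param E))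
      = (\<integral>\<^sup>+s. f (edge_param E s) \<partial>lebesgue_on {0..1})"
    by (rule nn_integral_distr[OF pm]) (use f in simp)
  also have "\<dots> = (\<integral>\<^sup>+s. f (edge_param E s) * indicator {0..1} s \<partial>lebesgue)"
    by (rule nn_integral_restrict_space) simp
  also have "\<dots> = (\<integral>\<^sup>+s. indicator {0..1} s * f (edge_param E s) \<partial>lborel)"
    by (simp add: nn_integral_completion mult.commute)
  finally show ?thesis .
qed

definition H1_norm_sq :: "plane set \<Rightarrow> fn \<Rightarrow> real" where
  "H1_norm_sq S \<phi> = (\<integral>x. (\<phi> x)\<^sup>2 \<partial>lebesgue_on S) + (\<Sum>i\<in>UNIV. \<integral>x. (pderiv2 i \<phi> x)\<^sup>2 \<partial>lebesgue_on S)"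

lemma H1_norm_sq_nonneg: "0 \<le> H1_norm_sq S \<phi>"
  by (simp add: H1_norm_sq_def sum_nonneg)

text \<open>
  The boundary of a convex set is a null set, so integrals over a triangle and over its interior
  agree.
\<close>

lemma nn_integral_H1_density:
  assumes K: "compact K" "convex K" and \<phi>: "smooth \<phi>"
  shows "(\<integral>\<^sup>+x. indicator K x * ennreal (H1_density \<phi> x) \<partial>lborel) = ennreal (H1_norm_sq (interior K) \<phi>)"
proof -
  let ?M = "lebesgue_on (interior K)"
  let ?h = "\<lambda>x. indicator K x * ennreal (H1_density \<phi> x)"
  let ?H = "\<lambda>x. ennreal (H1_density \<phi> x)"
  have S: "open (interior K)" "bounded (interior K)" "interior K \<in> sets lebesgue"
    using K by (auto intro: bounded_subset[OF compact_imp_bounded interior_subset])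
  have i: "integrable (?M) (\<lambda>x. (\<phi> x)\<^sup>2)"
     "integrable (?M) (\<lambda>x. (pderiv2 i \<phi> x)\<^sup>2)" for i
    using smooth_L2[OF S(2,1)] \<phi> smooth_pderiv2 by (auto simp: L2_def)
  have int: "integrable (?M) (H1_density \<phi>)"
    unfolding H1_density_def using i by simp
  have nonneg: "0 \<le> H1_density \<phi> x" for x by (simp add: H1_density_def sum_nonneg)
  have "(\<integral>\<^sup>+x. ?h x \<partial>lborel)
      = (\<integral>\<^sup>+x. ?h x \<partial>lebesgue)"
    by (simp add: nn_integral_completion)
  also have "\<dots> = (\<integral>\<^sup>+x. ?H x * indicator (interior K) x \<partial>lebesgue)"
  proof (rule nn_integral_cong_AE)
    have "negligible (frontier K)" using K by (simp add: negligible_convex_frontier)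
    then have "AE x in lebesgue. x \<notin> frontier K"
      unfolding negligible_iff_null_sets by (rule AE_not_in)
    then show "AE x in lebesgue. ?h x = ?H x * indicator (interior K) x"
    proof eventually_elim
      case (elim x)
      then have "x \<in> K \<longleftrightarrow> x \<in> interior K"
        using K(1) interior_subset[of K] by (auto simp: frontier_def compact_imp_closed closure_closed)
      then show ?case by (simp add: indicator_def)
    qed
  qed
  also have "\<dots> = (\<integral>\<^sup>+x. ?H x \<partial>?M)"
    by (rule nn_integral_restrict_space[symmetric]) (use S in simp)
  also have "\<dots> = ennreal (\<integral>x. H1_density \<phi> x \<partial>?M)"
    by (rule nn_integral_eq_integral[OF int]) (use nonneg in simp)
  also have "(\<integral>x. H1_density \<phi> x \<partial>?M) = H1_norm_sq (interior K) \<phi>"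
    unfolding H1_density_def H1_norm_sq_def using i by simp
  finally show ?thesis .
qed

text \<open>
  The restriction to \<open>E\<close> of smooth functions is bounded in the \<open>H\<^sup>1\<close> norm. The constant may depend
  on the triangle and the edge, since it serves only to show that traces exist and are unique and
  does not enter any estimate that has to be uniform in the mesh.
\<close>

definition admits_trace :: "plane set \<Rightarrow> plane set \<Rightarrow> bool" where
  "admits_trace K E \<longleftrightarrow> bounded K \<and> (\<exists>C. \<forall>\<phi>. smooth \<phi> \<longrightarrow> \<phi> \<in> L2 (edge_measure E) \<and>
     (\<integral>x. (\<phi> x)\<^sup>2 \<partial>edge_measure E) \<le> C * H1_norm_sq (interior K) \<phi>)"

lemma triangle_admits_trace:
  fixes a b c :: plane
  assumes nd: "(b - a) $ 1 * (c - a) $ 2 \<noteq> (b - a) $ 2 * (c - a) $ 1"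
  shows "admits_trace (convex hull {a, b, c}) (closed_segment a b)"
proof -
  let ?K = "convex hull {a, b, c}" and ?E = "closed_segment a b"
  have K: "compact ?K" "convex ?K" by (simp_all add: compact_convex_hull finite_imp_compact)
  have nd': "(a - b) $ 1 * (c - b) $ 2 \<noteq> (a - b) $ 2 * (c - b) $ 1"
    using nd by (simp add: algebra_simps)
  have K': "convex hull {b, a, c} = ?K" by (simp add: insert_commute)
  have "\<exists>C>0. \<forall>\<phi>. smooth \<phi> \<longrightarrow>
    (\<integral>\<^sup>+s. indicator {0..1} s * ennreal ((\<phi> (edge_param ?E s))\<^sup>2) \<partial>lborel)
      \<le> ennreal C * (\<integral>\<^sup>+x. indicator ?K x * ennreal (H1_density \<phi> x) \<partial>lborel)"
    using edge_param_cases[OF refl, of a b]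
  proof
    assume "edge_param ?E = linepath a b"
    then show ?thesis using trace_inequality[OF nd] by simp
  next
    assume "edge_param ?E = linepath b a"
    then show ?thesis using trace_inequality[OF nd'] unfolding K' by simp
  qed
  then obtain C where C: "C > 0" "\<forall>\<phi>. smooth \<phi> \<longrightarrow>
    (\<integral>\<^sup>+s. indicator {0..1} s * ennreal ((\<phi> (edge_param ?E s))\<^sup>2) \<partial>lborel)
      \<le> ennreal C * (\<integral>\<^sup>+x. indicator ?K x * ennreal (H1_density \<phi> x) \<partial>lborel)"
    by (rule exE) (auto intro: that)
  have dn: "0 \<le> diameter ?E" by (rule diameter_ge_0) (simp add: bounded_closed_segment)
  have "\<phi> \<in> L2 (edge_measure ?E) \<and> (\<integral>x. (\<phi> x)\<^sup>2 \<partial>edge_measure ?E) \<le> (diameter ?E * C) * H1_norm_sq (interior ?K) \<phi>"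
    if \<phi>: "smooth \<phi>" for \<phi>
  proof -
    let ?B = "(diameter ?E * C) * H1_norm_sq (interior ?K) \<phi>"
    let ?N = "\<integral>\<^sup>+x. ennreal ((\<phi> x)\<^sup>2) \<partial>edge_measure ?E"
    let ?Q = "\<integral>x. (\<phi> x)\<^sup>2 \<partial>edge_measure ?E"
    have sets: "sets (edge_measure ?E) = sets borel" by (simp add: edge_measure_def)
    have m: "\<phi> \<in> borel_measurable borel"
      by (rule borel_measurable_continuous_onI[OF smooth_continuous_on[OF \<phi>]])
    then have m': "\<phi> \<in> borel_measurable (edge_measure ?E)"
      using measurable_cong_sets[OF sets refl] by blast
    have "(?N)
        = ennreal (diameter ?E) * (\<integral>\<^sup>+s. indicator {0..1} s * ennreal ((\<phi> (edge_param ?E s))\<^sup>2) \<partial>lborel)"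
      by (rule nn_integral_edge_measure[OF refl]) (use m in measurable)
    also have "\<dots> \<le> ennreal (diameter ?E) * (ennreal C * ennreal (H1_norm_sq (interior ?K) \<phi>))"
      by (intro mult_left_mono) (use C(2)[rule_format, OF \<phi>] nn_integral_H1_density[OF K \<phi>] in simp_all)
    also have "\<dots> = ennreal (?B)"
      using dn C(1) H1_norm_sq_nonneg[of "interior ?K" \<phi>] by (simp add: ennreal_mult mult.assoc)
    finally have le: "(?N) \<le> ennreal (?B)" .
    have i: "integrable (edge_measure ?E) (\<lambda>x. (\<phi> x)\<^sup>2)"
      by (rule integrableI_nonneg) (use m' le_less_trans[OF le] in \<open>simp_all add: borel_measurable_power\<close>)
    have "ennreal (?Q) \<le> ennreal (?B)"
      using le nn_integral_eq_integral[OF i] by simp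
    then have "(?Q) \<le> ?B"
      using dn C(1) H1_norm_sq_nonneg[of "interior ?K" \<phi>] by (subst (asm) ennreal_le_iff) simp_all
    then show ?thesis using m' i by (simp add: L2_def)
  qed
  then show ?thesis unfolding admits_trace_def using compact_imp_bounded[OF K(1)] by blast
qed

lemma L2_lim_unique:
  assumes "L2_lim M \<phi> v" "L2_lim M \<phi> w"
  shows "AE x in M. v x = w x"
proof -
  have d: "L2_lim M (\<lambda>n x. \<phi> n x - \<phi> n x) (\<lambda>x. v x - w x)" by (rule L2_lim_diff[OF assms])
  then have "(\<integral>x. (v x - w x)\<^sup>2 \<partial>M) = 0" by (simp add: L2_lim_def LIMSEQ_const_iff)
  moreover have "integrable M (\<lambda>x. (v x - w x)\<^sup>2)" using d by (simp add: L2_lim_def L2_def)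
  ultimately have "AE x in M. (v x - w x)\<^sup>2 = 0"
    by (subst (asm) integral_nonneg_eq_0_iff_AE) simp_all
  then show ?thesis by eventually_elim simp
qed

lemma sobolev_1_iff:
  assumes "open S"
  shows "v \<in> sobolev 1 S \<longleftrightarrow> v \<in> L2 (lebesgue_on S) \<and>
    (\<forall>i. is_weak_deriv S i v (weak_deriv S i v) \<and> weak_deriv S i v \<in> L2 (lebesgue_on S))"
proof -
  have ex: "(\<exists>g. is_weak_deriv S i v g) \<longleftrightarrow> is_weak_deriv S i v (weak_deriv S i v)" for i
  proof
    assume "\<exists>g. is_weak_deriv S i v g"
    then show "is_weak_deriv S i v (weak_deriv S i v)"
      by (rule exE) (rule is_weak_deriv_weak_deriv(1)[OF assms])
  qed (rule exI)
  show ?thesis unfolding One_nat_def sobolev.simps mem_Collect_eq ex by (rule refl)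
qed

text \<open>
  Differences with smooth functions are the only arguments at which the norm has to be known; on
  them the chosen derivatives may be replaced by the given ones.
\<close>

lemma sobolev_norm_sq_1:
  assumes S: "open S" "bounded S" and v: "\<And>i. is_weak_deriv S i v (G i)" "\<And>i. G i \<in> L2 (lebesgue_on S)"
    and \<phi>: "smooth \<phi>"
  shows "sobolev_norm_sq 1 S (\<lambda>x. v x - \<phi> x) = (\<integral>x. (v x - \<phi> x)\<^sup>2 \<partial>lebesgue_on S)
     + (\<Sum>i\<in>UNIV. \<integral>x. (G i x - pderiv2 i \<phi> x)\<^sup>2 \<partial>lebesgue_on S)"
proof -
  have "(L2_norm (lebesgue_on S) (weak_deriv S i (\<lambda>x. v x - \<phi> x)))\<^sup>2
      = (\<integral>x. (G i x - pderiv2 i \<phi> x)\<^sup>2 \<partial>lebesgue_on S)" for i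
    unfolding L2_norm_sq
  proof (rule integrable_AE_lebesgue_on(2)[symmetric])
    show "S \<in> sets lebesgue" using S by auto
    show "integrable (lebesgue_on S) (\<lambda>x. (G i x - pderiv2 i \<phi> x)\<^sup>2)"
      using L2_diff[OF v(2) smooth_L2[OF S(2,1) smooth_pderiv2[OF \<phi>]]] by (simp add: L2_def)
    have "AE x in lebesgue_on S. weak_deriv S i (\<lambda>x. v x - \<phi> x) x = G i x - pderiv2 i \<phi> x"
      by (rule is_weak_deriv_weak_deriv(2)[OF S(1) is_weak_deriv_diff[OF S(1) v(1) smooth_is_weak_deriv[OF S(1) \<phi>]]])
    then show "AE x in lebesgue_on S. (G i x - pderiv2 i \<phi> x)\<^sup>2 = (weak_deriv S i (\<lambda>x. v x - \<phi> x) x)\<^sup>2"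
      by eventually_elim simp
  qed
  then show ?thesis by (simp add: L2_norm_sq)
qed

lemma sum_tendsto_0_iff:
  fixes a :: "nat \<Rightarrow> real" and b :: "'i::finite \<Rightarrow> nat \<Rightarrow> real"
  assumes "\<And>n. 0 \<le> a n" "\<And>i n. 0 \<le> b i n"
  shows "(\<lambda>n. a n + (\<Sum>i\<in>UNIV. b i n)) \<longlonglongrightarrow> 0 \<longleftrightarrow> a \<longlonglongrightarrow> 0 \<and> (\<forall>i. b i \<longlonglongrightarrow> 0)"
proof
  assume lim: "(\<lambda>n. a n + (\<Sum>i\<in>UNIV. b i n)) \<longlonglongrightarrow> 0"
  have s: "0 \<le> (\<Sum>i\<in>UNIV. b i n)" for n by (rule sum_nonneg) (rule assms(2))
  have "a n \<le> a n + (\<Sum>i\<in>UNIV. b i n)" for n using s by simp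
  then have "a \<longlonglongrightarrow> 0"
    by (intro tendsto_sandwich[OF _ _ tendsto_const lim]) (simp_all add: assms)
  moreover have "b i \<longlonglongrightarrow> 0" for i
  proof -
    have "b i n \<le> (\<Sum>i\<in>UNIV. b i n)" for n by (rule member_le_sum) (simp_all add: assms(2))
    then have "b i n \<le> a n + (\<Sum>i\<in>UNIV. b i n)" for n using assms(1)[of n] by (simp add: add_increasing)
    then show ?thesis by (intro tendsto_sandwich[OF _ _ tendsto_const lim]) (simp_all add: assms)
  qed
  ultimately show "a \<longlonglongrightarrow> 0 \<and> (\<forall>i. b i \<longlonglongrightarrow> 0)" by blast
next
  assume "a \<longlonglongrightarrow> 0 \<and> (\<forall>i. b i \<longlonglongrightarrow> 0)"
  then have "(\<lambda>n. a n + (\<Sum>i\<in>UNIV. b i n)) \<longlonglongrightarrow> 0 + (\<Sum>i\<in>(UNIV::'i set). 0)"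
    by (intro tendsto_intros) auto
  then show "(\<lambda>n. a n + (\<Sum>i\<in>UNIV. b i n)) \<longlonglongrightarrow> 0" by simp
qed

lemma sobolev_norm_tendsto_iff:
  assumes S: "open S" "bounded S" and v: "\<And>i. is_weak_deriv S i v (G i)" "\<And>i. G i \<in> L2 (lebesgue_on S)"
    "v \<in> L2 (lebesgue_on S)" and \<phi>: "\<And>n. smooth (\<phi> n)"
  shows "(\<lambda>n. fsobolev_norm 0 1 S (\<lambda>x. v x - \<phi> n x)) \<longlonglongrightarrow> 0 \<longleftrightarrow>
    L2_lim (lebesgue_on S) \<phi> v \<and> (\<forall>i. L2_lim (lebesgue_on S) (\<lambda>n. pderiv2 i (\<phi> n)) (G i))"
proof -
  let ?A = "\<lambda>n. \<integral>x. (v x - \<phi> n x)\<^sup>2 \<partial>lebesgue_on S"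
  let ?B = "\<lambda>i n. \<integral>x. (G i x - pderiv2 i (\<phi> n) x)\<^sup>2 \<partial>lebesgue_on S"
  have "fsobolev_norm 0 1 S (\<lambda>x. v x - \<phi> n x) = sqrt (?A n + (\<Sum>i\<in>UNIV. ?B i n))" for n
    using sobolev_norm_sq_1[OF S v(1,2) \<phi>[of n]] by (simp add: fsobolev_norm_def)
  moreover have "(\<lambda>n. sqrt (?A n + (\<Sum>i\<in>UNIV. ?B i n))) \<longlonglongrightarrow> 0 \<longleftrightarrow> (\<lambda>n. ?A n + (\<Sum>i\<in>UNIV. ?B i n)) \<longlonglongrightarrow> 0"
    (is "?s \<longlonglongrightarrow> 0 \<longleftrightarrow> ?q \<longlonglongrightarrow> 0")
  proof
    assume "?s \<longlonglongrightarrow> 0"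
    from tendsto_power[OF this, of 2] show "?q \<longlonglongrightarrow> 0" by (simp add: sum_nonneg)
  next
    assume "?q \<longlonglongrightarrow> 0"
    from tendsto_real_sqrt[OF this] show "?s \<longlonglongrightarrow> 0" by simp
  qed
  moreover have "?q \<longlonglongrightarrow> 0 \<longleftrightarrow> ?A \<longlonglongrightarrow> 0 \<and> (\<forall>i. ?B i \<longlonglongrightarrow> 0)"
    by (rule sum_tendsto_0_iff) simp_all
  ultimately show ?thesis
    using v smooth_L2[OF S(2,1)] \<phi> smooth_pderiv2 by (simp add: L2_lim_def)
qed

text \<open>
  Rephrases traces of order 1 without chosen derivatives: a single sequence of smooth functions
  converges to \<open>v\<close> together with its gradient on the triangle and to \<open>g\<close> on the edge.
\<close>

lemma has_edge_trace_iff: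
  assumes T: "admits_trace K E"
  shows "has_edge_trace 1 K E v g \<longleftrightarrow> (\<exists>\<phi> G. (\<forall>n. smooth (\<phi> n)) \<and> L2_lim (lebesgue_on (interior K)) \<phi> v \<and>
     (\<forall>i. L2_lim (lebesgue_on (interior K)) (\<lambda>n. pderiv2 i (\<phi> n)) (G i)) \<and> L2_lim (edge_measure E) \<phi> g)"
    (is "?L \<longleftrightarrow> ?R")
proof -
  let ?S = "interior K"
  let ?M = "lebesgue_on ?S"
  let ?N = "edge_measure E"
  have S: "open ?S" "bounded ?S" using T interior_subset bounded_subset by (auto simp: admits_trace_def)
  have sE: "smooth \<phi> \<Longrightarrow> \<phi> \<in> L2 (?N)" for \<phi> using T by (auto simp: admits_trace_def)
  have E: "L2_lim (?N) \<phi> g \<longleftrightarrow>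
      g \<in> L2 (?N) \<and> (\<lambda>n. L2_norm (?N) (\<lambda>x. g x - \<phi> n x)) \<longlonglongrightarrow> 0"
    if "\<forall>n. smooth (\<phi> n)" for \<phi>
    using that sE unfolding L2_norm_tendsto_iff by (simp add: L2_lim_def)
  have fs: "fsobolev 0 1 ?S = sobolev 1 ?S" by simp
  show ?thesis
  proof
    assume L: ?L
    then have v: "v \<in> L2 (?M)" "\<And>i. is_weak_deriv ?S i v (weak_deriv ?S i v)"
        "\<And>i. weak_deriv ?S i v \<in> L2 (?M)"
      unfolding has_edge_trace_def fs sobolev_1_iff[OF S(1)] by blast+
    obtain \<phi> where \<phi>: "\<forall>n. smooth (\<phi> n)" "(\<lambda>n. fsobolev_norm 0 1 ?S (\<lambda>x. v x - \<phi> n x)) \<longlonglongrightarrow> 0"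
      "(\<lambda>n. L2_norm (?N) (\<lambda>x. g x - \<phi> n x)) \<longlonglongrightarrow> 0"
      using L unfolding has_edge_trace_def by blast
    have g: "g \<in> L2 (?N)" using L unfolding has_edge_trace_def by blast
    have "L2_lim (?M) \<phi> v \<and> (\<forall>i. L2_lim (?M) (\<lambda>n. pderiv2 i (\<phi> n)) (weak_deriv ?S i v))"
      using sobolev_norm_tendsto_iff[of ?S v "\<lambda>i. weak_deriv ?S i v" \<phi>] S v \<phi>(1,2) by simp
    then show ?R using \<phi>(1) E[OF \<phi>(1)] g \<phi>(3) by (intro exI[of _ \<phi>] exI[of _ "\<lambda>i. weak_deriv ?S i v"]) simp
  next
    assume ?R
    then obtain \<phi> G where \<phi>: "\<forall>n. smooth (\<phi> n)" "L2_lim (?M) \<phi> v"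
      "\<forall>i. L2_lim (?M) (\<lambda>n. pderiv2 i (\<phi> n)) (G i)" "L2_lim (?N) \<phi> g" by blast
    have wd: "is_weak_deriv ?S i v (G i)" for i
      by (rule is_weak_deriv_L2_lim[where \<phi>=\<phi>, OF S(1) \<phi>(1)[rule_format] \<phi>(2) \<phi>(3)[rule_format]])
    have G: "v \<in> L2 (?M)" "G i \<in> L2 (?M)" for i
      using \<phi> by (auto simp: L2_lim_def)
    have "weak_deriv ?S i v \<in> L2 (?M)" for i
    proof (rule L2_AE_lebesgue_on[OF sets_lebesgue_open[OF S(1)] G(2)])
      show "AE x in ?M. G i x = weak_deriv ?S i v x"
        using is_weak_deriv_weak_deriv(2)[OF S(1) wd[of i]] by eventually_elim simp
    qed
    then have "v \<in> sobolev 1 ?S"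
      using sobolev_1_iff[OF S(1)] G(1) is_weak_deriv_weak_deriv(1)[OF S(1) wd] by blast
    moreover have "(\<lambda>n. fsobolev_norm 0 1 ?S (\<lambda>x. v x - \<phi> n x)) \<longlonglongrightarrow> 0"
      using sobolev_norm_tendsto_iff[of ?S v G \<phi>] S wd G \<phi> by simp
    ultimately show ?L
      using E[OF \<phi>(1)] \<phi>(4) \<phi>(1) unfolding has_edge_trace_def fs by blast
  qed
qed

text \<open>
  The difference of two approximating sequences tends to 0 together with its gradient, because the
  gradients converge to weak derivatives of the same function; by the trace inequality it tends
  to 0 on the edge as well.
\<close>

lemma has_edge_trace_unique:
  assumes T: "admits_trace K E" and 1: "has_edge_trace 1 K E v g" and 2: "has_edge_trace 1 K E v h"
  shows "AE x in edge_measure E. g x = h x"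
proof -
  let ?S = "interior K"
  let ?M = "lebesgue_on ?S"
  let ?N = "edge_measure E"
  have S: "open ?S" by simp
  obtain C where sE: "\<And>\<phi>. smooth \<phi> \<Longrightarrow> \<phi> \<in> L2 (?N)"
    and C: "\<And>\<phi>. smooth \<phi> \<Longrightarrow> (\<integral>x. (\<phi> x)\<^sup>2 \<partial>?N) \<le> C * H1_norm_sq ?S \<phi>"
    using T unfolding admits_trace_def by metis
  obtain \<phi> F where \<phi>: "\<And>n. smooth (\<phi> n)" "L2_lim (?M) \<phi> v"
      "\<And>i. L2_lim (?M) (\<lambda>n. pderiv2 i (\<phi> n)) (F i)" "L2_lim (?N) \<phi> g"
    using 1 unfolding has_edge_trace_iff[OF T] by metis
  obtain \<psi> G where \<psi>: "\<And>n. smooth (\<psi> n)" "L2_lim (?M) \<psi> v"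
      "\<And>i. L2_lim (?M) (\<lambda>n. pderiv2 i (\<psi> n)) (G i)" "L2_lim (?N) \<psi> h"
    using 2 unfolding has_edge_trace_iff[OF T] by metis
  have "is_weak_deriv ?S i v (F i)" "is_weak_deriv ?S i v (G i)" for i
    using is_weak_deriv_L2_lim[where \<phi>=\<phi>, OF S \<phi>(1-3)] is_weak_deriv_L2_lim[where \<phi>=\<psi>, OF S \<psi>(1-3)] by auto
  then have FG: "AE x in ?M. F i x - G i x = 0" for i
    using is_weak_deriv_unique[OF S, of i v "F i" "G i"] by simp
  define d where "d n x = \<phi> n x - \<psi> n x" for n x
  have d: "smooth (d n)" for n unfolding d_def by (rule smooth_diff[OF \<phi>(1) \<psi>(1)])
  have pd: "pderiv2 i (d n) = (\<lambda>x. pderiv2 i (\<phi> n) x - pderiv2 i (\<psi> n) x)" for i n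
    unfolding d_def by (rule pderiv2_diff[OF \<phi>(1) \<psi>(1)])
  have "L2_lim (?M) d (\<lambda>x. v x - v x)"
    unfolding d_def by (rule L2_lim_diff[OF \<phi>(2) \<psi>(2)])
  then have a: "(\<lambda>n. \<integral>x. (d n x)\<^sup>2 \<partial>?M) \<longlonglongrightarrow> 0" by (simp add: L2_lim_def)
  have "L2_lim (?M) (\<lambda>n. pderiv2 i (d n)) (\<lambda>x. F i x - G i x)" for i
    unfolding pd by (rule L2_lim_diff[OF \<phi>(3) \<psi>(3)])
  then have "L2_lim (?M) (\<lambda>n. pderiv2 i (d n)) (\<lambda>x. 0)" for i
    using L2_lim_AE[OF sets_lebesgue_open[OF S] _ FG] by blast
  then have b: "(\<lambda>n. \<integral>x. (pderiv2 i (d n) x)\<^sup>2 \<partial>?M) \<longlonglongrightarrow> 0" for i by (simp add: L2_lim_def)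
  have "(\<lambda>n. H1_norm_sq ?S (d n)) \<longlonglongrightarrow> 0 + (\<Sum>i\<in>(UNIV::2 set). 0)"
    unfolding H1_norm_sq_def by (intro tendsto_intros a b)
  then have "(\<lambda>n. C * H1_norm_sq ?S (d n)) \<longlonglongrightarrow> C * 0" by (intro tendsto_intros) simp
  then have up: "(\<lambda>n. C * H1_norm_sq ?S (d n)) \<longlonglongrightarrow> 0" by simp
  have "(\<lambda>n. \<integral>x. (d n x)\<^sup>2 \<partial>?N) \<longlonglongrightarrow> 0"
    by (rule tendsto_sandwich[OF _ _ tendsto_const up]) (simp_all add: C d)
  moreover have "(\<lambda>x. 0) \<in> L2 (?N)" by (simp add: L2_def)
  ultimately have "L2_lim (?N) d (\<lambda>x. 0)" using sE[OF d] by (simp add: L2_lim_def)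
  moreover have "L2_lim (?N) d (\<lambda>x. g x - h x)"
    unfolding d_def by (rule L2_lim_diff[OF \<phi>(4) \<psi>(4)])
  ultimately have "AE x in ?N. 0 = g x - h x" by (rule L2_lim_unique)
  then show ?thesis by eventually_elim simp
qed

lemma L2_lim_Cauchy:
  assumes l: "L2_lim M \<phi> v" and e: "e > 0"
  shows "\<exists>N. \<forall>m\<ge>N. \<forall>n\<ge>N. (\<integral>x. (\<phi> m x - \<phi> n x)\<^sup>2 \<partial>M) < e"
proof -
  have m: "v \<in> L2 M" "\<phi> n \<in> L2 M" for n using l by (auto simp: L2_lim_def)
  have "(\<lambda>n. \<integral>x. (v x - \<phi> n x)\<^sup>2 \<partial>M) \<longlonglongrightarrow> 0" using l by (simp add: L2_lim_def)
  then obtain N where N: "\<forall>n\<ge>N. norm ((\<integral>x. (v x - \<phi> n x)\<^sup>2 \<partial>M) - 0) < e / 4"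
    by (rule exE[OF LIMSEQ_D[where r="e / 4"]]) (use e that in simp_all)
  have "(\<integral>x. (\<phi> i x - \<phi> j x)\<^sup>2 \<partial>M) < e" if "i \<ge> N" "j \<ge> N" for i j
  proof -
    have "(\<integral>x. (\<phi> i x - \<phi> j x)\<^sup>2 \<partial>M) = (\<integral>x. ((v x - \<phi> j x) - (v x - \<phi> i x))\<^sup>2 \<partial>M)" by simp
    also have "\<dots> \<le> 2 * (\<integral>x. (v x - \<phi> j x)\<^sup>2 \<partial>M) + 2 * (\<integral>x. (v x - \<phi> i x)\<^sup>2 \<partial>M)"
      by (rule integral_square_diff_le) (intro L2_diff m)+
    also have "\<dots> < e" using N[rule_format, OF that(1)] N[rule_format, OF that(2)] by simp
    finally show ?thesis .
  qed
  then show ?thesis by blast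
qed

text \<open>
  By the trace inequality the approximating sequence is a Cauchy sequence on the edge.
\<close>

lemma has_edge_trace_exists:
  assumes T: "admits_trace K E" and l: "smooth_limit (interior K) v G"
  shows "\<exists>g. has_edge_trace 1 K E v g"
proof -
  let ?S = "interior K"
  let ?M = "lebesgue_on ?S"
  let ?N = "edge_measure E"
  obtain C where sE: "\<And>\<phi>. smooth \<phi> \<Longrightarrow> \<phi> \<in> L2 (?N)"
    and C: "\<And>\<phi>. smooth \<phi> \<Longrightarrow> (\<integral>x. (\<phi> x)\<^sup>2 \<partial>?N) \<le> C * H1_norm_sq ?S \<phi>"
    using T unfolding admits_trace_def by metis
  obtain \<phi> where \<phi>: "\<And>n. smooth (\<phi> n)" "L2_lim (?M) \<phi> v"
      "\<And>i. L2_lim (?M) (\<lambda>n. pderiv2 i (\<phi> n)) (G i)"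
    using l unfolding smooth_limit_def by metis
  have "\<exists>g\<in>L2 (?N). (\<lambda>n. \<integral>x. (g x - \<phi> n x)\<^sup>2 \<partial>?N) \<longlonglongrightarrow> 0"
  proof (rule L2_complete)
    show "\<phi> n \<in> L2 (?N)" for n by (rule sE[OF \<phi>(1)])
    fix e :: real assume e: "e > 0"
    define \<delta> where "\<delta> = e / (3 * (\<bar>C\<bar> + 1))"
    have \<delta>: "\<delta> > 0" "(\<bar>C\<bar> + 1) * (3 * \<delta>) = e" using e unfolding \<delta>_def by (simp_all add: field_simps)
    obtain N0 where N0: "\<forall>m\<ge>N0. \<forall>n\<ge>N0. (\<integral>x. (\<phi> m x - \<phi> n x)\<^sup>2 \<partial>?M) < \<delta>"
      using L2_lim_Cauchy[OF \<phi>(2) \<delta>(1)] by blast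
    have "\<exists>N. \<forall>m\<ge>N. \<forall>n\<ge>N. (\<integral>x. (pderiv2 i (\<phi> m) x - pderiv2 i (\<phi> n) x)\<^sup>2 \<partial>?M) < \<delta>" for i
      by (rule L2_lim_Cauchy[OF \<phi>(3) \<delta>(1)])
    then obtain N where N: "\<And>i m n. m \<ge> N i \<Longrightarrow> n \<ge> N i \<Longrightarrow> (\<integral>x. (pderiv2 i (\<phi> m) x - pderiv2 i (\<phi> n) x)\<^sup>2 \<partial>?M) < \<delta>"
      by metis
    define M where "M = N0 + N 1 + N 2"
    have "(\<integral>x. (\<phi> m x - \<phi> n x)\<^sup>2 \<partial>?N) < e" if "m \<ge> M" "n \<ge> M" for m n
    proof -
      let ?d = "\<lambda>x. \<phi> m x - \<phi> n x"
      have pd: "pderiv2 i ?d = (\<lambda>x. pderiv2 i (\<phi> m) x - pderiv2 i (\<phi> n) x)" for i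
        by (rule pderiv2_diff[OF \<phi>(1) \<phi>(1)])
      have "H1_norm_sq ?S ?d < 3 * \<delta>"
        using N0[rule_format, of m n] N[of 1 m n] N[of 2 m n] that
        unfolding H1_norm_sq_def pd by (simp add: UNIV_2 M_def)
      have "(\<integral>x. (?d x)\<^sup>2 \<partial>?N) \<le> C * H1_norm_sq ?S ?d"
        by (rule C[OF smooth_diff[OF \<phi>(1) \<phi>(1)]])
      also have "\<dots> \<le> (\<bar>C\<bar> + 1) * H1_norm_sq ?S ?d"
        by (intro mult_right_mono H1_norm_sq_nonneg) simp
      also have "\<dots> < (\<bar>C\<bar> + 1) * (3 * \<delta>)"
        by (intro mult_strict_left_mono) (use \<open>H1_norm_sq ?S ?d < 3 * \<delta>\<close> in simp_all)
      finally show ?thesis using \<delta>(2) by simp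
    qed
    then show "\<exists>N. \<forall>m\<ge>N. \<forall>n\<ge>N. (\<integral>x. (\<phi> m x - \<phi> n x)\<^sup>2 \<partial>?N) < e" by blast
  qed
  then obtain g where "g \<in> L2 (?N)" "(\<lambda>n. \<integral>x. (g x - \<phi> n x)\<^sup>2 \<partial>?N) \<longlonglongrightarrow> 0" by blast
  then have "L2_lim (?N) \<phi> g" using sE[OF \<phi>(1)] by (simp add: L2_lim_def)
  then show ?thesis using \<phi> unfolding has_edge_trace_iff[OF T] by blast
qed

text \<open>
  The difference of two traces is a trace of the difference, and traces are unique. The function
  \<open>u\<close> is only required to agree almost everywhere with the difference, since it will be a chosen
  weak derivative.
\<close>

lemma edge_trace_diff:
  assumes T: "admits_trace K E" and v: "smooth_limit (interior K) v G" and w: "smooth_limit (interior K) w H"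
    and ae: "AE x in lebesgue_on (interior K). u x = v x - w x"
  shows "edge_trace 1 K E v \<in> L2 (edge_measure E)"
    and "AE x in edge_measure E. edge_trace 1 K E u x = edge_trace 1 K E v x - edge_trace 1 K E w x"
proof -
  let ?S = "interior K"
  let ?M = "lebesgue_on ?S"
  have tv: "has_edge_trace 1 K E v (edge_trace 1 K E v)"
    unfolding edge_trace_def by (rule someI_ex[OF has_edge_trace_exists[OF T v]])
  have tw: "has_edge_trace 1 K E w (edge_trace 1 K E w)"
    unfolding edge_trace_def by (rule someI_ex[OF has_edge_trace_exists[OF T w]])
  show "edge_trace 1 K E v \<in> L2 (edge_measure E)" using tv unfolding has_edge_trace_def by blast
  obtain \<phi> F where \<phi>: "\<And>n. smooth (\<phi> n)" "L2_lim (?M) \<phi> v"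
      "\<And>i. L2_lim (?M) (\<lambda>n. pderiv2 i (\<phi> n)) (F i)" "L2_lim (edge_measure E) \<phi> (edge_trace 1 K E v)"
    using tv unfolding has_edge_trace_iff[OF T] by metis
  obtain \<psi> F' where \<psi>: "\<And>n. smooth (\<psi> n)" "L2_lim (?M) \<psi> w"
      "\<And>i. L2_lim (?M) (\<lambda>n. pderiv2 i (\<psi> n)) (F' i)" "L2_lim (edge_measure E) \<psi> (edge_trace 1 K E w)"
    using tw unfolding has_edge_trace_iff[OF T] by metis
  have ae': "AE x in ?M. v x - w x = u x" using ae by eventually_elim simp
  have tu: "has_edge_trace 1 K E u (\<lambda>x. edge_trace 1 K E v x - edge_trace 1 K E w x)"
    unfolding has_edge_trace_iff[OF T]
  proof (intro exI[of _ "\<lambda>n x. \<phi> n x - \<psi> n x"] exI[of _ "\<lambda>i x. F i x - F' i x"] conjI allI)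
    show "smooth (\<lambda>x. \<phi> n x - \<psi> n x)" for n by (rule smooth_diff[OF \<phi>(1) \<psi>(1)])
    show "L2_lim (?M) (\<lambda>n x. \<phi> n x - \<psi> n x) u"
      by (rule L2_lim_AE[OF sets_lebesgue_open[OF open_interior] L2_lim_diff[OF \<phi>(2) \<psi>(2)] ae'])
    show "L2_lim (?M) (\<lambda>n. pderiv2 i (\<lambda>x. \<phi> n x - \<psi> n x)) (\<lambda>x. F i x - F' i x)" for i
      unfolding pderiv2_diff[OF \<phi>(1) \<psi>(1)] by (rule L2_lim_diff[OF \<phi>(3) \<psi>(3)])
    show "L2_lim (edge_measure E) (\<lambda>n x. \<phi> n x - \<psi> n x) (\<lambda>x. edge_trace 1 K E v x - edge_trace 1 K E w x)"
      by (rule L2_lim_diff[OF \<phi>(4) \<psi>(4)])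
  qed
  have "has_edge_trace 1 K E u (edge_trace 1 K E u)"
    unfolding edge_trace_def[of 1 K E u] by (rule someI[of "has_edge_trace 1 K E u", OF tu])
  then show "AE x in edge_measure E. edge_trace 1 K E u x = edge_trace 1 K E v x - edge_trace 1 K E w x"
    by (rule has_edge_trace_unique[OF T _ tu])
qed


section \<open>Edges of a triangulation\<close>

text \<open>
  The determinant of two vectors: it vanishes for parallel vectors, and the sign of
  \<open>cross2 (b - a) (c - a)\<close> tells on which side of the line through \<open>a\<close> and \<open>b\<close> the point \<open>c\<close> lies.
\<close>

definition cross2 :: "plane \<Rightarrow> plane \<Rightarrow> real" where
  "cross2 u v = u $ 1 * v $ 2 - u $ 2 * v $ 1"

lemma cross2_eq_0_imp_parallel:
  assumes "cross2 u v = 0" "u \<noteq> 0" shows "\<exists>t. v = t *\<^sub>R u"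
proof -
  have e: "u $ 1 * v $ 2 = u $ 2 * v $ 1" using assms by (simp add: cross2_def)
  consider "u $ 1 \<noteq> 0" | "u $ 2 \<noteq> 0" using assms(2) by (auto simp: vec_eq_iff forall_2)
  then show ?thesis
  proof cases
    case 1
    then have "v = (v $ 1 / u $ 1) *\<^sub>R u" using e by (simp add: vec_eq_iff forall_2 field_simps)
    then show ?thesis by blast
  next
    case 2
    then have "v = (v $ 2 / u $ 2) *\<^sub>R u" using e by (simp add: vec_eq_iff forall_2 field_simps)
    then show ?thesis by blast
  qed
qed

lemma affine_independent_imp_cross2:
  assumes "\<not> affine_dependent {a, b, c}" "a \<noteq> b" "a \<noteq> c" "b \<noteq> c"
  shows "cross2 (b - a) (c - a) \<noteq> 0"
proof
  assume "cross2 (b - a) (c - a) = 0"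
  then obtain t where "c - a = t *\<^sub>R (b - a)" using cross2_eq_0_imp_parallel assms(2) by force
  then have "c = (1 - t) *\<^sub>R a + t *\<^sub>R b" by (simp add: algebra_simps)
  then have "c \<in> affine hull {a, b}" 
    unfolding affine_hull_2 by (intro CollectI exI[of _ "1 - t"] exI[of _ t]) simp
  moreover have "{a, b, c} - {c} = {a, b}" using assms by auto
  ultimately show False using assms(1) unfolding affine_dependent_def by force
qed

text \<open>
  Cramer's rule.
\<close>

lemma cross2_combination:
  assumes "cross2 u v \<noteq> 0" shows "w = (cross2 w v / cross2 u v) *\<^sub>R u + (cross2 u w / cross2 u v) *\<^sub>R v"
proof -
  have "cross2 u v *\<^sub>R w = cross2 w v *\<^sub>R u + cross2 u w *\<^sub>R v"
    by (simp add: vec_eq_iff forall_2 cross2_def algebra_simps)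
  then have "(1 / cross2 u v) *\<^sub>R (cross2 u v *\<^sub>R w) = (1 / cross2 u v) *\<^sub>R (cross2 w v *\<^sub>R u + cross2 u w *\<^sub>R v)"
    by (rule arg_cong)
  then show ?thesis using assms by (simp add: scaleR_add_right)
qed

lemma facet_of_triangle:
  fixes K E :: "plane set"
  assumes K: "2 simplex K" and E: "E facet_of K"
  obtains a b c where "K = convex hull {a, b, c}" "E = closed_segment a b" "cross2 (b - a) (c - a) \<noteq> 0"
proof -
  obtain C where C: "\<not> affine_dependent C" "int (card C) = 2 + 1" "K = convex hull C"
    using K unfolding simplex_def by blast
  then obtain c where c: "c \<in> C" "E = convex hull (C - {c})"
    using E facet_of_convex_hull_affine_independent[OF C(1)] by blast
  have "card C = 3" using C(2) by simp
  then have "card (C - {c}) = 2" using c(1) by simp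
  then obtain a b where ab: "C - {c} = {a, b}" "a \<noteq> b" by (meson card_2_iff)
  then have ne: "a \<noteq> c" "b \<noteq> c" by blast+
  have "C = insert c (C - {c})" using c(1) by blast
  then have Ceq: "C = {a, b, c}" unfolding ab(1) by (simp add: insert_commute)
  show ?thesis
  proof (rule that)
    show "K = convex hull {a, b, c}" using C(3) Ceq by simp
    show "E = closed_segment a b" using c(2) ab(1) by (simp add: segment_convex_hull)
    show "cross2 (b - a) (c - a) \<noteq> 0"
      using affine_independent_imp_cross2[of a b c] C(1) Ceq ab(2) ne by simp
  qed
qed

lemma facet_of_triangle_apex:
  fixes K E :: "plane set"
  assumes K: "2 simplex K" and E: "E facet_of K" "E = closed_segment a b"
  obtains c where "K = convex hull {a, b, c}" "cross2 (b - a) (c - a) \<noteq> 0"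
proof -
  obtain a' b' c where *: "K = convex hull {a', b', c}" "E = closed_segment a' b'" "cross2 (b' - a') (c - a') \<noteq> 0"
    using facet_of_triangle[OF K E(1)] .
  then have "{a, b} = {a', b'}" using E(2) by simp
  then have "a = a' \<and> b = b' \<or> a = b' \<and> b = a'" by (auto simp: doubleton_eq_iff)
  then show ?thesis
  proof
    assume "a = a' \<and> b = b'" then show ?thesis using * that by blast
  next
    assume ab: "a = b' \<and> b = a'"
    have "cross2 (b - a) (c - a) = - cross2 (b' - a') (c - a')"
      using ab by (simp add: cross2_def algebra_simps)
    moreover have "K = convex hull {a, b, c}" using *(1) ab by (simp add: insert_commute)
    ultimately show ?thesis using * that[of c] by simp
  qed
qed

lemma facet_admits_trace:
  assumes "2 simplex K" "E facet_of K"
  shows "admits_trace K E"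
proof -
  obtain a b c where "K = convex hull {a, b, c}" "E = closed_segment a b" "cross2 (b - a) (c - a) \<noteq> 0"
    using facet_of_triangle[OF assms] .
  then show ?thesis using triangle_admits_trace[of b a c] by (simp add: cross2_def)
qed

text \<open>
  A point of the segment from the midpoint of the common edge to \<open>c\<close>, close enough to the edge,
  belongs to both triangles. It lies in the relative interior of that segment, so the common face
  contains the end point \<open>c\<close> as well.
\<close>

lemma triangles_on_same_side:
  fixes a b c d :: plane
  assumes F: "(convex hull {a, b, c} \<inter> convex hull {a, b, d}) face_of convex hull {a, b, c}"
    and side: "cross2 (b - a) (c - a) * cross2 (b - a) (d - a) > 0"
  shows "convex hull {a, b, c} \<subseteq> convex hull {a, b, d}"
proof -
  let ?K = "convex hull {a, b, c}" and ?L = "convex hull {a, b, d}"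
  define \<alpha> where "\<alpha> = cross2 (c - a) (d - a) / cross2 (b - a) (d - a)"
  define \<gamma> where "\<gamma> = cross2 (b - a) (c - a) / cross2 (b - a) (d - a)"
  have nz: "cross2 (b - a) (d - a) \<noteq> 0" using side by auto
  have \<gamma>: "\<gamma> > 0" using side by (auto simp: \<gamma>_def zero_less_mult_iff zero_less_divide_iff)
  have c: "c - a = \<alpha> *\<^sub>R (b - a) + \<gamma> *\<^sub>R (d - a)"
    unfolding \<alpha>_def \<gamma>_def by (rule cross2_combination[OF nz])
  \<comment> \<open>Small enough for the oblique coordinates of \<open>x\<close> with respect to \<open>d\<close> to stay in the triangle.\<close>
  define \<epsilon> where "\<epsilon> = 1 / (4 * (1 + \<bar>\<alpha>\<bar> + \<gamma>))"
  have pos: "4 * (1 + \<bar>\<alpha>\<bar> + \<gamma>) > 0" using \<gamma> by (smt (verit))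
  have \<epsilon>: "\<epsilon> > 0" "\<epsilon> \<le> 1/4" "\<epsilon> * \<bar>\<alpha>\<bar> \<le> 1/4" "\<epsilon> * \<gamma> \<le> 1/4"
    using pos \<gamma> unfolding \<epsilon>_def by (simp_all add: divide_le_eq)
  have "\<bar>\<epsilon> * \<alpha>\<bar> \<le> 1/4" using \<epsilon> by (simp add: abs_mult)
  then have \<epsilon>\<alpha>: "\<epsilon> * \<alpha> \<le> 1/4" "- (1/4) \<le> \<epsilon> * \<alpha>" by linarith+
  define m where "m = a + (1/2) *\<^sub>R (b - a)"
  define x where "x = (1 - \<epsilon>) *\<^sub>R m + \<epsilon> *\<^sub>R c"
  have x1: "x = a + ((1 - \<epsilon>) / 2) *\<^sub>R (b - a) + \<epsilon> *\<^sub>R (c - a)"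
    by (simp add: x_def m_def algebra_simps)
  have x2: "x = a + ((1 - \<epsilon>) / 2 + \<epsilon> * \<alpha>) *\<^sub>R (b - a) + (\<epsilon> * \<gamma>) *\<^sub>R (d - a)"
    unfolding x1 c by (simp add: algebra_simps)
  have st: "0 \<le> (1 - \<epsilon>) / 2" "0 \<le> \<epsilon>" "(1 - \<epsilon>) / 2 + \<epsilon> \<le> 1" "0 \<le> (1 - \<epsilon>) / 2 + \<epsilon> * \<alpha>"
      "(1 - \<epsilon>) / 2 + \<epsilon> * \<alpha> + \<epsilon> * \<gamma> \<le> 1"
    using \<epsilon> \<epsilon>\<alpha> by argo+
  have "x \<in> ?K" unfolding x1 by (rule in_triangle[OF st(1-3)])
  moreover have "x \<in> ?L" unfolding x2
    by (rule in_triangle[OF st(4) _ st(5)]) (use \<epsilon>(1) \<gamma> in simp)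
  moreover have "m \<in> ?K" using in_triangle[of "1/2" 0 a b c] by (simp add: m_def)
  moreover have "c \<in> ?K" by (simp add: hull_inc)
  moreover have "x \<in> open_segment m c"
  proof -
    have "m \<noteq> c"
    proof
      assume "m = c"
      then have "c - a = (1/2) *\<^sub>R (b - a)" by (auto simp: m_def)
      then have "cross2 (b - a) (c - a) = 0" by (simp add: cross2_def)
      then show False using side by simp
    qed
    then show ?thesis unfolding in_segment x_def using \<epsilon> by (intro conjI exI[of _ \<epsilon>]) auto
  qed
  ultimately have "c \<in> ?L" using face_ofD[OF F, of x m c] by blast
  moreover have "a \<in> ?L" "b \<in> ?L" by (simp_all add: hull_inc)
  ultimately show ?thesis by (intro hull_minimal) auto
qed

text \<open>
  Among three apexes two lie on the same side of the edge, and their triangles contain each other.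
\<close>

lemma at_most_two_triangles:
  fixes T :: mesh
  assumes T: "triangulation T" "\<forall>K\<in>T. 2 simplex K"
    and K: "K1 \<in> T" "K2 \<in> T" "K3 \<in> T" "E facet_of K1" "E facet_of K2" "E facet_of K3"
  shows "K1 = K2 \<or> K1 = K3 \<or> K2 = K3"
proof -
  obtain a b where E: "E = closed_segment a b" using facet_of_triangle T(2) K by metis
  obtain c1 where c1: "K1 = convex hull {a, b, c1}" "cross2 (b - a) (c1 - a) \<noteq> 0"
    using facet_of_triangle_apex[OF _ K(4) E] T(2) K by blast
  obtain c2 where c2: "K2 = convex hull {a, b, c2}" "cross2 (b - a) (c2 - a) \<noteq> 0"
    using facet_of_triangle_apex[OF _ K(5) E] T(2) K by blast
  obtain c3 where c3: "K3 = convex hull {a, b, c3}" "cross2 (b - a) (c3 - a) \<noteq> 0"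
    using facet_of_triangle_apex[OF _ K(6) E] T(2) K by blast
  have eq: "L = M" if "L \<in> T" "M \<in> T" "L = convex hull {a, b, c}" "M = convex hull {a, b, d}"
     "cross2 (b - a) (c - a) * cross2 (b - a) (d - a) > 0" for L M c d
  proof
    have F: "(L \<inter> M) face_of L" "(M \<inter> L) face_of M" using T(1) that(1,2) unfolding triangulation_def by blast+
    show "L \<subseteq> M" using triangles_on_same_side[of a b c d] F(1) that by simp
    show "M \<subseteq> L" using triangles_on_same_side[of a b d c] F(2) that by (simp add: mult.commute)
  qed
  let ?x = "cross2 (b - a) (c1 - a)" and ?y = "cross2 (b - a) (c2 - a)" and ?z = "cross2 (b - a) (c3 - a)"
  have "?x * ?y > 0 \<or> ?x * ?z > 0 \<or> ?y * ?z > 0"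
    using c1(2) c2(2) c3(2) by (simp add: zero_less_mult_iff) linarith
  then show ?thesis
    using eq[OF K(1,2) c1(1) c2(1)] eq[OF K(1,3) c1(1) c3(1)] eq[OF K(2,3) c2(1) c3(1)] by blast
qed

lemma K_plus_facet: "E \<in> mesh_edges T \<Longrightarrow> K_plus T E \<in> T \<and> E facet_of K_plus T E"
  unfolding mesh_edges_def K_plus_def by (rule someI_ex) blast

text \<open>
  The definite description in \<open>K_minus\<close> denotes, since an edge has at most one other triangle.
\<close>

lemma K_minus_facet:
  assumes T: "triangulation T" "\<forall>K\<in>T. 2 simplex K" and E: "E \<in> mesh_edges T" "interior_edge T E"
  shows "K_minus T E \<in> T \<and> E facet_of K_minus T E"
proof -
  have p: "K_plus T E \<in> T" "E facet_of K_plus T E" using K_plus_facet[OF E(1)] by auto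
  obtain K where K: "K \<in> T" "E facet_of K" "K \<noteq> K_plus T E"
    using E(2) unfolding interior_edge_def by metis
  have "K_minus T E \<in> T \<and> E facet_of K_minus T E \<and> K_minus T E \<noteq> K_plus T E"
    unfolding K_minus_def
  proof (rule theI[of _ K])
    fix L assume "L \<in> T \<and> E facet_of L \<and> L \<noteq> K_plus T E"
    then show "L = K"
      using at_most_two_triangles[OF T, of L K "K_plus T E" E] K p by blast
  qed (use K in blast)
  then show ?thesis by blast
qed

section \<open>Functions that vanish to second order on the boundary\<close>

text \<open>
  The part of \<open>S\<close> outside of \<open>\<Omega>\<close> carries no mass, although \<open>f\<close> may be arbitrary there.
\<close>

lemma L2_transfer:
  fixes f :: fn
  assumes S: "S \<in> sets lebesgue" "\<Omega> \<in> sets lebesgue" "negligible (S - \<Omega>)" and f: "f \<in> L2 (lebesgue_on \<Omega>)"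
  shows "f \<in> L2 (lebesgue_on S)" "(\<integral>x. (f x)\<^sup>2 \<partial>lebesgue_on S) \<le> (\<integral>x. (f x)\<^sup>2 \<partial>lebesgue_on \<Omega>)"
proof -
  let ?M = "lebesgue_on S"
  let ?N = "lebesgue_on \<Omega>"
  have "AE x in lebesgue. x \<notin> S - \<Omega>" using S(3) unfolding negligible_iff_null_sets by (rule AE_not_in)
  then have ae: "AE x in ?M. x \<in> \<Omega>"
    unfolding AE_lebesgue_on_iff[OF S(1)] by eventually_elim simp
  define g where "g x = (if x \<in> \<Omega> then f x else 0)" for x
  have gm: "g \<in> borel_measurable lebesgue"
    unfolding g_def using f borel_measurable_if[OF S(2), of f] by (simp add: L2_def)
  have gi: "integrable lebesgue (\<lambda>x. (g x)\<^sup>2)"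
  proof -
    have "integrable lebesgue (\<lambda>x. indicator \<Omega> x * (f x)\<^sup>2)"
      using f by (simp add: L2_def integrable_on_lebesgue_on_iff[OF S(2)])
    also have "(\<lambda>x. indicator \<Omega> x * (f x)\<^sup>2) = (\<lambda>x. (g x)\<^sup>2)" by (auto simp: g_def indicator_def fun_eq_iff)
    finally show ?thesis .
  qed
  have gS: "integrable lebesgue (\<lambda>x. indicator S x * (g x)\<^sup>2)"
    using integrable_mult_indicator[OF S(1) gi] by simp
  have gL: "g \<in> L2 (?M)"
    using measurable_restrict_space1[OF gm] gS by (simp add: L2_def integrable_on_lebesgue_on_iff[OF S(1)])
  have eq: "AE x in ?M. g x = f x" using ae by eventually_elim (simp add: g_def)
  show "f \<in> L2 (?M)" by (rule L2_AE_lebesgue_on[OF S(1) gL eq])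
  have "(\<integral>x. (f x)\<^sup>2 \<partial>?M) = (\<integral>x. (g x)\<^sup>2 \<partial>?M)"
  proof (rule integrable_AE_lebesgue_on(2)[OF S(1), symmetric])
    show "integrable (?M) (\<lambda>x. (g x)\<^sup>2)" using gL by (simp add: L2_def)
    show "AE x in ?M. (g x)\<^sup>2 = (f x)\<^sup>2" using eq by eventually_elim simp
  qed
  also have "\<dots> = (\<integral>x. indicator S x * (g x)\<^sup>2 \<partial>lebesgue)" by (rule integral_lebesgue_on_eq[OF S(1)])
  also have "\<dots> \<le> (\<integral>x. (g x)\<^sup>2 \<partial>lebesgue)"
    by (rule integral_mono[OF gS gi]) (simp add: indicator_def)
  also have "(\<lambda>x. (g x)\<^sup>2) = (\<lambda>x. indicator \<Omega> x * (f x)\<^sup>2)" by (auto simp: g_def indicator_def fun_eq_iff)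
  also have "(\<integral>x. indicator \<Omega> x * (f x)\<^sup>2 \<partial>lebesgue) = (\<integral>x. (f x)\<^sup>2 \<partial>?N)"
    by (rule integral_lebesgue_on_eq[OF S(2), symmetric])
  finally show "(\<integral>x. (f x)\<^sup>2 \<partial>?M) \<le> (\<integral>x. (f x)\<^sup>2 \<partial>?N)" .
qed

lemma L2_lim_transfer:
  fixes v :: fn
  assumes S: "S \<in> sets lebesgue" "\<Omega> \<in> sets lebesgue" "negligible (S - \<Omega>)" and l: "L2_lim (lebesgue_on \<Omega>) \<phi> v"
  shows "L2_lim (lebesgue_on S) \<phi> v"
  unfolding L2_lim_def
proof (intro conjI allI)
  have m: "v \<in> L2 (lebesgue_on \<Omega>)" "\<phi> n \<in> L2 (lebesgue_on \<Omega>)" for n using l by (auto simp: L2_lim_def)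
  show "v \<in> L2 (lebesgue_on S)" by (rule L2_transfer(1)[OF S m(1)])
  show "\<phi> n \<in> L2 (lebesgue_on S)" for n by (rule L2_transfer(1)[OF S m(2)])
  have up: "(\<lambda>n. \<integral>x. (v x - \<phi> n x)\<^sup>2 \<partial>lebesgue_on \<Omega>) \<longlonglongrightarrow> 0" using l by (simp add: L2_lim_def)
  show "(\<lambda>n. \<integral>x. (v x - \<phi> n x)\<^sup>2 \<partial>lebesgue_on S) \<longlonglongrightarrow> 0"
    by (rule tendsto_sandwich[OF _ _ tendsto_const up])
       (simp_all add: L2_transfer(2)[OF S L2_diff[OF m]])
qed

lemma smooth_limit2_transfer:
  assumes S: "S \<in> sets lebesgue" "\<Omega> \<in> sets lebesgue" "negligible (S - \<Omega>)" and l: "smooth_limit2 \<Omega> f g H"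
  shows "smooth_limit2 S f g H"
  using l L2_lim_transfer[OF S] unfolding smooth_limit2_def by metis

lemma sobolev_norm_sq_1_AE:
  assumes S: "open S" and v: "v \<in> L2 (lebesgue_on S)" and ae: "AE x in lebesgue_on S. v x = w x"
  shows "sobolev_norm_sq 1 S v = sobolev_norm_sq 1 S w"
proof -
  have "(\<integral>x. (v x)\<^sup>2 \<partial>lebesgue_on S) = (\<integral>x. (w x)\<^sup>2 \<partial>lebesgue_on S)"
  proof (rule integrable_AE_lebesgue_on(2)[OF sets_lebesgue_open[OF S]])
    show "integrable (lebesgue_on S) (\<lambda>x. (v x)\<^sup>2)" using v by (simp add: L2_def)
    show "AE x in lebesgue_on S. (v x)\<^sup>2 = (w x)\<^sup>2" using ae by eventually_elim simp
  qed
  moreover have "weak_deriv S i v = weak_deriv S i w" for i by (rule weak_deriv_cong_AE[OF S ae])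
  ultimately show ?thesis by (simp add: L2_norm_sq)
qed

text \<open>
  The approximating test functions are smooth on the whole plane, and by uniqueness of weak
  derivatives their convergence in the \<open>H\<^sup>2\<close> norm is the mean square convergence of all derivatives.
\<close>

lemma sobolev0_2_smooth_limit2:
  assumes \<Omega>: "open \<Omega>" "bounded \<Omega>" and f: "f \<in> sobolev0 2 \<Omega>"
  shows "\<exists>g H. smooth_limit2 \<Omega> f g H"
proof -
  let ?M = "lebesgue_on \<Omega>"
  define g where "g j = weak_deriv \<Omega> j f" for j
  define H where "H i j = weak_deriv \<Omega> i (g j)" for i j
  have f2: "f \<in> sobolev (Suc 1) \<Omega>" using f by (simp add: sobolev0_def numeral_2_eq_2)
  then have f0: "f \<in> L2 (?M)" and ex: "\<exists>w. is_weak_deriv \<Omega> j f w" and g1: "g j \<in> sobolev 1 \<Omega>" for j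
    unfolding g_def sobolev.simps(2)[of 1] by blast+
  have g: "is_weak_deriv \<Omega> j f (g j)" for j
    unfolding g_def using ex[of j] by (rule exE) (rule is_weak_deriv_weak_deriv(1)[OF \<Omega>(1)])
  have H: "g j \<in> L2 (?M)" "is_weak_deriv \<Omega> i (g j) (H i j)" "H i j \<in> L2 (?M)" for i j
    using g1[of j] unfolding sobolev_1_iff[OF \<Omega>(1)] H_def by blast+
  obtain \<phi> where \<phi>: "\<And>n. \<phi> n \<in> test_fns \<Omega>" "(\<lambda>n. sobolev_norm 2 \<Omega> (\<lambda>x. f x - \<phi> n x)) \<longlonglongrightarrow> 0"
    using f unfolding sobolev0_def by blast
  have sm: "smooth (\<phi> n)" for n using \<phi>(1)[of n] by (simp add: test_fns_def)
  let ?A = "\<lambda>n. \<integral>x. (f x - \<phi> n x)\<^sup>2 \<partial>?M"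
  let ?B = "\<lambda>j n. \<integral>x. (g j x - pderiv2 j (\<phi> n) x)\<^sup>2 \<partial>?M"
  let ?C = "\<lambda>i j n. \<integral>x. (H i j x - pderiv2 i (pderiv2 j (\<phi> n)) x)\<^sup>2 \<partial>?M"
  have D: "sobolev_norm_sq 1 \<Omega> (weak_deriv \<Omega> j (\<lambda>x. f x - \<phi> n x)) = ?B j n + (\<Sum>i\<in>UNIV. ?C i j n)" for j n
  proof -
    have "AE x in ?M. weak_deriv \<Omega> j (\<lambda>x. f x - \<phi> n x) x = g j x - pderiv2 j (\<phi> n) x"
      by (rule is_weak_deriv_weak_deriv(2)[OF \<Omega>(1) is_weak_deriv_diff[OF \<Omega>(1) g smooth_is_weak_deriv[OF \<Omega>(1) sm]]])
    then have ae: "AE x in ?M. g j x - pderiv2 j (\<phi> n) x = weak_deriv \<Omega> j (\<lambda>x. f x - \<phi> n x) x"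
      by eventually_elim simp
    have L: "(\<lambda>x. g j x - pderiv2 j (\<phi> n) x) \<in> L2 (?M)"
      by (rule L2_diff[OF H(1) smooth_L2[OF \<Omega>(2,1) smooth_pderiv2[OF sm]]])
    show ?thesis
      using sobolev_norm_sq_1_AE[OF \<Omega>(1) L ae] sobolev_norm_sq_1[where G="\<lambda>i. H i j", OF \<Omega> H(2,3) smooth_pderiv2[OF sm]]
      by simp
  qed
  have "sobolev_norm_sq 2 \<Omega> (\<lambda>x. f x - \<phi> n x) = ?A n + (\<Sum>j\<in>UNIV. ?B j n + (\<Sum>i\<in>UNIV. ?C i j n))" for n
  proof -
    have "sobolev_norm_sq (Suc 1) \<Omega> (\<lambda>x. f x - \<phi> n x) = ?A n + (\<Sum>j\<in>UNIV. ?B j n + (\<Sum>i\<in>UNIV. ?C i j n))"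
      unfolding sobolev_norm_sq.simps(2)[of 1] D L2_norm_sq by (rule refl)
    then show ?thesis by (simp only: Suc_1)
  qed
  then have sq: "(sobolev_norm 2 \<Omega> (\<lambda>x. f x - \<phi> n x))\<^sup>2 = ?A n + (\<Sum>j\<in>UNIV. ?B j n + (\<Sum>i\<in>UNIV. ?C i j n))" for n
    by (simp add: sobolev_norm_def sum_nonneg)
  have "(\<lambda>n. ?A n + (\<Sum>j\<in>UNIV. ?B j n + (\<Sum>i\<in>UNIV. ?C i j n))) \<longlonglongrightarrow> 0"
    using tendsto_power[OF \<phi>(2), of 2] unfolding sq by simp
  then have "?A \<longlonglongrightarrow> 0 \<and> (\<forall>j. (\<lambda>n. ?B j n + (\<Sum>i\<in>UNIV. ?C i j n)) \<longlonglongrightarrow> 0)"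
    by (subst (asm) sum_tendsto_0_iff) (simp_all add: sum_nonneg)
  moreover have "(\<lambda>n. ?B j n + (\<Sum>i\<in>UNIV. ?C i j n)) \<longlonglongrightarrow> 0 \<longleftrightarrow> ?B j \<longlonglongrightarrow> 0 \<and> (\<forall>i. ?C i j \<longlonglongrightarrow> 0)" for j
    by (rule sum_tendsto_0_iff) simp_all
  ultimately have lim: "?A \<longlonglongrightarrow> 0" "?B j \<longlonglongrightarrow> 0" "?C i j \<longlonglongrightarrow> 0" for i j by blast+
  have "smooth_limit2 \<Omega> f g H"
    unfolding smooth_limit2_def
    by (rule exI[of _ \<phi>])
       (use lim f0 H sm in \<open>simp add: L2_lim_def smooth_L2[OF \<Omega>(2,1)] smooth_pderiv2\<close>)
  then show ?thesis by blast
qed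

text \<open>
  The boundary is a finite union of segments.
\<close>

lemma negligible_frontier_polygonal_domain:
  assumes "polygonal_domain \<Omega>" shows "negligible (frontier \<Omega>)"
proof -
  have seg: "negligible (closed_segment a b)" for a b :: plane
  proof -
    have "interior (convex hull {a, b}) = {}"
      by (rule empty_interior_convex_hull) (simp_all add: card_insert_if)
    then show ?thesis by (simp add: negligible_convex_interior segment_convex_hull)
  qed
  obtain \<J> where J: "finite \<J>" "\<forall>J\<in>\<J>. polygon_curve J" "frontier \<Omega> = \<Union>\<J>"
    using assms unfolding polygonal_domain_def by blast
  have "negligible J" if "J \<in> \<J>" for J
  proof -
    obtain V where V: "finite V" "J = (\<Union>(a, b)\<in>V. closed_segment a b)"
      using J(2) \<open>J \<in> \<J>\<close> unfolding polygon_curve_def by blast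
    then show ?thesis using seg by (auto intro!: negligible_Union)
  qed
  then show ?thesis using J by (auto intro: negligible_Union)
qed


section \<open>The energy norm\<close>

lemma L2_scale: "f \<in> L2 M \<Longrightarrow> (\<lambda>x. f x * c) \<in> L2 M"
  by (auto simp: L2_def power_mult_distrib intro!: borel_measurable_times)

lemma L2_add: "f \<in> L2 M \<Longrightarrow> g \<in> L2 M \<Longrightarrow> (\<lambda>x. f x + g x) \<in> L2 M"
  using L2_diff[of f M "\<lambda>x. g x * (-1)"] L2_scale[of g M "-1"] by simp

lemma L2_norm_sq_AE_diff:
  assumes L: "f \<in> L2 M" "g \<in> L2 M" "u \<in> L2 M" and ae: "AE x in M. u x = f x - g x"
  shows "(L2_norm M u)\<^sup>2 \<le> 2 * (L2_norm M f)\<^sup>2 + 2 * (L2_norm M g)\<^sup>2"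
proof -
  have "(\<integral>x. (u x)\<^sup>2 \<partial>M) = (\<integral>x. (f x - g x)\<^sup>2 \<partial>M)"
    by (rule integral_cong_AE)
       (use L L2_diff[OF L(1,2)] ae in \<open>auto simp: L2_def elim!: eventually_mono\<close>)
  then show ?thesis using integral_square_diff_le[OF L(1,2)] by (simp add: L2_norm_sq)
qed

lemma H2_seminorm_sq_diff:
  assumes S: "open S" and f: "smooth_limit2 S f gf Hf" and g: "smooth_limit2 S g gg Hg"
  shows "(H2_seminorm S (\<lambda>x. f x - g x))\<^sup>2 \<le> 2 * (H2_seminorm S f)\<^sup>2 + 2 * (H2_seminorm S g)\<^sup>2"
proof -
  let ?M = "lebesgue_on S"
  have Sm: "S \<in> sets lebesgue" using S by auto
  have sq: "(H2_seminorm S w)\<^sup>2 = (\<Sum>i\<in>UNIV. \<Sum>j\<in>UNIV. (L2_norm (?M) (D2 S i j w))\<^sup>2)" for w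
    by (simp add: H2_seminorm_def sum_nonneg)
  have L: "D2 S i j w \<in> L2 (?M)" if w: "smooth_limit2 S w G H" for w G H i j
  proof (rule L2_AE_lebesgue_on[OF Sm])
    show "H i j \<in> L2 (?M)" using w by (auto simp: smooth_limit2_def L2_lim_def)
    show "AE x in ?M. H i j x = D2 S i j w x"
      using smooth_limit2_D2(2)[OF S w, of i j] by eventually_elim simp
  qed
  note d = smooth_limit2_diff[OF f g]
  have ae: "AE x in ?M. D2 S i j (\<lambda>x. f x - g x) x = D2 S i j f x - D2 S i j g x" for i j
    using smooth_limit2_D2(2)[OF S d, of i j] smooth_limit2_D2(2)[OF S f, of i j] smooth_limit2_D2(2)[OF S g, of i j]
    by eventually_elim simp
  have "(\<Sum>i\<in>UNIV. \<Sum>j\<in>UNIV. (L2_norm (?M) (D2 S i j (\<lambda>x. f x - g x)))\<^sup>2)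
     \<le> (\<Sum>i\<in>UNIV. \<Sum>j\<in>UNIV. 2 * (L2_norm (?M) (D2 S i j f))\<^sup>2 + 2 * (L2_norm (?M) (D2 S i j g))\<^sup>2)"
    by (intro sum_mono L2_norm_sq_AE_diff L[OF f] L[OF g] L[OF d] ae)
  also have "\<dots> = 2 * (H2_seminorm S f)\<^sup>2 + 2 * (H2_seminorm S g)\<^sup>2"
    unfolding sq by (simp add: sum.distrib sum_distrib_left)
  finally show ?thesis unfolding sq .
qed

text \<open>
  The functions for which all ingredients of the energy norm behave linearly: piecewise \<open>H\<^sup>2\<close>,
  with approximation by smooth functions up to the boundary of each triangle.
\<close>

definition broken_H2 :: "mesh \<Rightarrow> fn \<Rightarrow> bool" where
  "broken_H2 T f \<longleftrightarrow> (\<forall>K\<in>T. \<exists>g H. smooth_limit2 (interior K) f g H)"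

lemma broken_H2_diff: "broken_H2 T f \<Longrightarrow> broken_H2 T g \<Longrightarrow> broken_H2 T (\<lambda>x. f x - g x)"
  unfolding broken_H2_def using smooth_limit2_diff by meson

lemma grad_trace_diff:
  assumes T: "\<forall>K\<in>T. 2 simplex K" and K: "K \<in> T" "E facet_of K" and f: "broken_H2 T f" and g: "broken_H2 T g"
  shows "edge_trace 1 K E (weak_deriv (interior K) i f) \<in> L2 (edge_measure E)"
    and "AE x in edge_measure E. edge_trace 1 K E (weak_deriv (interior K) i (\<lambda>x. f x - g x)) x
      = edge_trace 1 K E (weak_deriv (interior K) i f) x - edge_trace 1 K E (weak_deriv (interior K) i g) x"
proof -
  let ?S = "interior K"
  have S: "open ?S" by simp
  have A: "admits_trace K E" using facet_admits_trace T K by blast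
  obtain F HF where F: "smooth_limit2 ?S f F HF" using f K unfolding broken_H2_def by blast
  obtain G HG where G: "smooth_limit2 ?S g G HG" using g K unfolding broken_H2_def by blast
  have sl: "smooth_limit ?S (weak_deriv ?S i w) (\<lambda>j. H j i)" if w: "smooth_limit2 ?S w D H" for w D H
  proof (rule smooth_limit_AE[OF S smooth_limit2_deriv[OF w]])
    show "AE x in lebesgue_on ?S. D i x = weak_deriv ?S i w x"
      using smooth_limit2_D2(1)[OF S w, of i] by eventually_elim simp
  qed
  have ae: "AE x in lebesgue_on ?S. weak_deriv ?S i (\<lambda>x. f x - g x) x = weak_deriv ?S i f x - weak_deriv ?S i g x"
    using smooth_limit2_D2(1)[OF S smooth_limit2_diff[OF F G], of i] smooth_limit2_D2(1)[OF S F, of i] smooth_limit2_D2(1)[OF S G, of i]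
    by eventually_elim simp
  show "edge_trace 1 K E (weak_deriv ?S i f) \<in> L2 (edge_measure E)"
    by (rule edge_trace_diff(1)[OF A sl[OF F] sl[OF G] ae])
  show "AE x in edge_measure E. edge_trace 1 K E (weak_deriv ?S i (\<lambda>x. f x - g x)) x
      = edge_trace 1 K E (weak_deriv ?S i f) x - edge_trace 1 K E (weak_deriv ?S i g) x"
    by (rule edge_trace_diff(2)[OF A sl[OF F] sl[OF G] ae])
qed

text \<open>
  Jumps are defined through the two triangles at the edge, or the only one for a boundary edge; on
  each of them the trace of the gradient is additive almost everywhere.
\<close>

lemma grad_jump_diff:
  assumes T: "triangulation T" "\<forall>K\<in>T. 2 simplex K" and E: "E \<in> mesh_edges T" and f: "broken_H2 T f" and g: "broken_H2 T g"
  shows "grad_jump T E i f \<in> L2 (edge_measure E)"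
    and "AE x in edge_measure E. grad_jump T E i (\<lambda>x. f x - g x) x = grad_jump T E i f x - grad_jump T E i g x"
proof -
  let ?D = "AE x in edge_measure E. grad_jump T E i (\<lambda>x. f x - g x) x = grad_jump T E i f x - grad_jump T E i g x"
  let ?M = "grad_jump T E i f \<in> L2 (edge_measure E)"
  have p: "K_plus T E \<in> T" "E facet_of K_plus T E" using K_plus_facet[OF E] by auto
  note P = grad_trace_diff[OF T(2) p f g, of i]
  have "?M \<and>
    (?D)"
  proof (cases "interior_edge T E")
    case True
    have m: "K_minus T E \<in> T" "E facet_of K_minus T E" using K_minus_facet[OF T E True] by auto
    note M = grad_trace_diff[OF T(2) m f g, of i]
    have "?D"
      using P(2) M(2) by eventually_elim (simp add: grad_jump_def edge_jump_def True)
    moreover have "?M"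
      using L2_diff[OF P(1) M(1)] by (simp add: grad_jump_def edge_jump_def True)
    ultimately show ?thesis by blast
  next
    case False
    have "?D"
      using P(2) by eventually_elim (simp add: grad_jump_def edge_jump_def False)
    moreover have "?M"
      using P(1) by (simp add: grad_jump_def edge_jump_def False)
    ultimately show ?thesis by blast
  qed
  then show "?M"
    "?D"
    by blast+
qed

lemma normal_jump_sq_diff:
  assumes T: "triangulation T" "\<forall>K\<in>T. 2 simplex K" and E: "E \<in> mesh_edges T" and f: "broken_H2 T f" and g: "broken_H2 T g"
  shows "(L2_norm (edge_measure E) (normal_jump T E (\<lambda>x. f x - g x)))\<^sup>2
     \<le> 2 * (L2_norm (edge_measure E) (normal_jump T E f))\<^sup>2 + 2 * (L2_norm (edge_measure E) (normal_jump T E g))\<^sup>2"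
proof (rule L2_norm_sq_AE_diff)
  let ?N = "edge_measure E"
  have L: "normal_jump T E w \<in> L2 (?N)" if w: "broken_H2 T w" for w
    unfolding normal_jump_def UNIV_2
    using L2_add[OF L2_scale[OF grad_jump_diff(1)[OF T E w w, of 1]] L2_scale[OF grad_jump_diff(1)[OF T E w w, of 2]]]
    by simp
  show "normal_jump T E f \<in> L2 (?N)" "normal_jump T E g \<in> L2 (?N)"
    "normal_jump T E (\<lambda>x. f x - g x) \<in> L2 (?N)"
    using L f g broken_H2_diff by blast+
  show "AE x in ?N. normal_jump T E (\<lambda>x. f x - g x) x = normal_jump T E f x - normal_jump T E g x"
    using grad_jump_diff(2)[OF T E f g, of 1] grad_jump_diff(2)[OF T E f g, of 2]
    by eventually_elim (simp add: normal_jump_def UNIV_2 left_diff_distrib)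
qed

lemma norm_IP_sq:
  assumes "\<sigma> > 0" "\<forall>K\<in>T. 2 simplex K"
  shows "(norm_IP \<sigma> T w)\<^sup>2 = (\<Sum>K\<in>T. (H2_seminorm (interior K) w)\<^sup>2)
     + (\<Sum>E\<in>mesh_edges T. \<sigma> / diameter E * (L2_norm (edge_measure E) (normal_jump T E w))\<^sup>2)"
    and "E \<in> mesh_edges T \<Longrightarrow> 0 \<le> \<sigma> / diameter E"
proof -
  let ?R = "(\<Sum>K\<in>T. (H2_seminorm (interior K) w)\<^sup>2)
     + (\<Sum>E\<in>mesh_edges T. \<sigma> / diameter E * (L2_norm (edge_measure E) (normal_jump T E w))\<^sup>2)"
  have d: "0 \<le> \<sigma> / diameter E" if E: "E \<in> mesh_edges T" for E
  proof -
    obtain K where K: "K \<in> T" "E facet_of K" using E unfolding mesh_edges_def by blast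
    obtain a b c where "E = closed_segment a b" using facet_of_triangle[of K E] assms(2) K by metis
    then have "0 \<le> diameter E" by (auto intro!: diameter_ge_0 bounded_closed_segment)
    then show ?thesis using assms(1) by simp
  qed
  show "E \<in> mesh_edges T \<Longrightarrow> 0 \<le> \<sigma> / diameter E" by (rule d)
  have "0 \<le> ?R"
    by (intro add_nonneg_nonneg sum_nonneg mult_nonneg_nonneg d) simp_all
  then show "(norm_IP \<sigma> T w)\<^sup>2 = ?R"
    unfolding norm_IP_def by (rule real_sqrt_pow2)
qed

text \<open>
  All terms of the squared norm are squared mean square norms of quantities that are linear almost
  everywhere, weighted by nonnegative factors, so the claim follows term by term from
  \<open>(a - b)\<^sup>2 \<le> 2 a\<^sup>2 + 2 b\<^sup>2\<close>.
\<close>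

lemma norm_IP_sq_diff:
  assumes \<sigma>: "\<sigma> > 0" and T: "triangulation T" "\<forall>K\<in>T. 2 simplex K" and f: "broken_H2 T f" and g: "broken_H2 T g"
  shows "(norm_IP \<sigma> T (\<lambda>x. f x - g x))\<^sup>2 \<le> 2 * (norm_IP \<sigma> T f)\<^sup>2 + 2 * (norm_IP \<sigma> T g)\<^sup>2"
proof -
  have 1: "(\<Sum>K\<in>T. (H2_seminorm (interior K) (\<lambda>x. f x - g x))\<^sup>2)
      \<le> (\<Sum>K\<in>T. 2 * (H2_seminorm (interior K) f)\<^sup>2 + 2 * (H2_seminorm (interior K) g)\<^sup>2)"
  proof (rule sum_mono)
    fix K assume K: "K \<in> T"
    obtain F HF where F: "smooth_limit2 (interior K) f F HF" using f K unfolding broken_H2_def by blast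
    obtain G HG where G: "smooth_limit2 (interior K) g G HG" using g K unfolding broken_H2_def by blast
    show "(H2_seminorm (interior K) (\<lambda>x. f x - g x))\<^sup>2 \<le> 2 * (H2_seminorm (interior K) f)\<^sup>2 + 2 * (H2_seminorm (interior K) g)\<^sup>2"
      by (rule H2_seminorm_sq_diff[OF open_interior F G])
  qed
  let ?J = "\<lambda>E w. (L2_norm (edge_measure E) (normal_jump T E w))\<^sup>2"
  have 2: "(\<Sum>E\<in>mesh_edges T. \<sigma> / diameter E * ?J E (\<lambda>x. f x - g x))
      \<le> (\<Sum>E\<in>mesh_edges T. 2 * (\<sigma> / diameter E * ?J E f) + 2 * (\<sigma> / diameter E * ?J E g))"
  proof (rule sum_mono)
    fix E assume E: "E \<in> mesh_edges T"
    have "\<sigma> / diameter E * ?J E (\<lambda>x. f x - g x) \<le> \<sigma> / diameter E * (2 * ?J E f + 2 * ?J E g)"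
      by (rule mult_left_mono[OF normal_jump_sq_diff[OF T E f g] norm_IP_sq(2)[OF \<sigma> T(2) E]])
    then show "\<sigma> / diameter E * ?J E (\<lambda>x. f x - g x) \<le> 2 * (\<sigma> / diameter E * ?J E f) + 2 * (\<sigma> / diameter E * ?J E g)"
      by (simp only: distrib_left mult.left_commute)
  qed
  show ?thesis
    using add_mono[OF 1 2] unfolding norm_IP_sq(1)[OF \<sigma> T(2)] sum.distrib sum_distrib_left[symmetric] distrib_left
    by linarith
qed

text \<open>
  A triangle inequality with factor 2. The factor is harmless for an estimate up to a constant and
  spares Minkowski's inequality.
\<close>

lemma norm_IP2_diff:
  assumes \<sigma>: "\<sigma> > 0" and T: "triangulation T" "\<forall>K\<in>T. 2 simplex K"
    and F: "broken_H2 T (fst F)" "broken_H2 T (snd F)" and G: "broken_H2 T (fst G)" "broken_H2 T (snd G)"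
  shows "norm_IP2 \<sigma> T (F - G) \<le> 2 * (norm_IP2 \<sigma> T F + norm_IP2 \<sigma> T G)"
proof -
  have sq: "(norm_IP2 \<sigma> T W)\<^sup>2 = (norm_IP \<sigma> T (fst W))\<^sup>2 + (norm_IP \<sigma> T (snd W))\<^sup>2" for W
    by (simp add: norm_IP2_def)
  have nn: "0 \<le> norm_IP2 \<sigma> T W" for W by (simp add: norm_IP2_def)
  have d: "fst (F - G) = (\<lambda>x. fst F x - fst G x)" "snd (F - G) = (\<lambda>x. snd F x - snd G x)"
    by (auto simp: fun_eq_iff)
  have "(norm_IP2 \<sigma> T (F - G))\<^sup>2 \<le> 2 * (norm_IP2 \<sigma> T F)\<^sup>2 + 2 * (norm_IP2 \<sigma> T G)\<^sup>2"
    unfolding sq d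
    using add_mono[OF norm_IP_sq_diff[OF \<sigma> T F(1) G(1)] norm_IP_sq_diff[OF \<sigma> T F(2) G(2)]]
    by (simp add: algebra_simps)
  also have "\<dots> \<le> (2 * (norm_IP2 \<sigma> T F + norm_IP2 \<sigma> T G))\<^sup>2"
    using nn[of F] nn[of G] by (simp add: power2_eq_square algebra_simps)
  finally show ?thesis by (rule power2_le_imp_le) (use nn[of F] nn[of G] in simp)
qed

lemma interior_triangle_bounded:
  assumes "2 simplex K" shows "bounded (interior (K :: plane set))"
proof -
  obtain C where "finite C" "K = convex hull C" using assms unfolding simplex by blast
  then show ?thesis
    using bounded_subset[OF _ interior_subset, of K] by (simp add: finite_imp_bounded bounded_convex_hull)
qed

lemma S20_broken_H2:
  assumes T: "\<forall>K\<in>T. 2 simplex K" and p: "p \<in> S20 \<Omega> T"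
  shows "broken_H2 T p"
  unfolding broken_H2_def
proof
  fix K assume K: "K \<in> T"
  obtain q where q: "quadratic q" "\<And>x. x \<in> interior K \<Longrightarrow> p x = q x"
    using p K unfolding S20_def P2_def by blast
  have b: "bounded (interior K)" using interior_triangle_bounded T K by blast
  have "AE x in lebesgue_on (interior K). q x = p x" by (rule AE_I2) (simp add: q(2))
  then show "\<exists>g H. smooth_limit2 (interior K) p g H"
    using smooth_limit2_AE[OF open_interior smooth_limit2_smooth[OF open_interior b quadratic_smooth[OF q(1)]]] by blast
qed

text \<open>
  The interior of a triangle lies in the closure of \<open>\<Omega>\<close>, and the boundary of \<open>\<Omega>\<close> is a null set.
  As the approximating functions are smooth across that boundary, the approximation restricts to
  the triangle.
\<close>

lemma sobolev0_broken_H2: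
  assumes \<Omega>: "bounded \<Omega>" "polygonal_domain \<Omega>" and T: "triangulates T \<Omega>" and f: "f \<in> sobolev0 2 \<Omega>"
  shows "broken_H2 T f"
  unfolding broken_H2_def
proof
  fix K assume K: "K \<in> T"
  have o: "open \<Omega>" using \<Omega>(2) by (simp add: polygonal_domain_def)
  obtain g H where gH: "smooth_limit2 \<Omega> f g H" using sobolev0_2_smooth_limit2[OF o \<Omega>(1) f] by blast
  have "interior K \<subseteq> closure \<Omega>" using T K interior_subset[of K] unfolding triangulates_def by blast
  then have "interior K - \<Omega> \<subseteq> frontier \<Omega>" using o by (auto simp: frontier_def interior_open)
  then have "negligible (interior K - \<Omega>)"
    by (rule negligible_subset[OF negligible_frontier_polygonal_domain[OF \<Omega>(2)]])
  then show "\<exists>g H. smooth_limit2 (interior K) f g H"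
    using smooth_limit2_transfer[OF sets_lebesgue_open[OF open_interior] sets_lebesgue_open[OF o] _ gH] by blast
qed

theorem theorem6p1:
  fixes \<Omega> :: "plane set" and \<alpha> :: real and f :: fn and \<Psi> :: fn2
    and \<T> :: "mesh set" and Pi_h :: "mesh \<Rightarrow> fn2" and C1 :: "real \<Rightarrow> real"
  assumes domain: "bounded \<Omega>" "polygonal_domain \<Omega>"
    and index: "1/2 < \<alpha>" "\<alpha> \<le> 1" "elliptic_regularity \<Omega> \<alpha>"
    and load: "f \<in> L2 (lebesgue_on \<Omega>)"
    and regular: "regular_solution \<Omega> f \<Psi>"
    and meshes: "\<forall>T\<in>\<T>. triangulates T \<Omega>" "shape_regular \<T>"
    and interpolant: "\<forall>T\<in>\<T>. Pi_h T \<in> S20 \<Omega> T \<times> S20 \<Omega> T"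
      "\<forall>\<sigma>>0. \<exists>C. \<forall>T\<in>\<T>.
         norm_IP2 \<sigma> T (\<Psi> - Pi_h T) \<le> C * mesh_size T powr \<alpha> * fsobolev_norm2 2 \<alpha> \<Omega> \<Psi> \<and>
         norm_IP2_aug \<alpha> \<sigma> T (\<Psi> - Pi_h T) \<le> C * mesh_size T powr \<alpha> * fsobolev_norm2 2 \<alpha> \<Omega> \<Psi>"
    and C1_pos: "\<forall>\<sigma>>0. 0 < C1 \<sigma>"
    and mu: "sufficiently \<Omega> \<T> (\<lambda>\<sigma> T. mu_well_defined \<Omega> f \<sigma> T (Pi_h T) \<and>
         (\<forall>\<Theta>\<in>S20 \<Omega> T \<times> S20 \<Omega> T. \<forall>M. mu_graph \<Omega> f \<sigma> T (Pi_h T) \<Theta> M \<longrightarrow>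
            norm_IP2 \<sigma> T (M - Pi_h T) \<le>
              C1 \<sigma> * (mesh_size T powr \<alpha> + (norm_IP2 \<sigma> T (\<Theta> - Pi_h T))\<^sup>2)))"
  shows "\<exists>C :: real \<Rightarrow> real. sufficiently \<Omega> \<T> (\<lambda>\<sigma> T. \<forall>\<Psi>_IP.
           local_solution \<Omega> f \<sigma> T (Pi_h T) (2 * C1 \<sigma> * mesh_size T powr \<alpha>) \<Psi>_IP \<longrightarrow>
           norm_IP2 \<sigma> T (\<Psi> - \<Psi>_IP) \<le> C \<sigma> * mesh_size T powr \<alpha>)"
proof -
  \<comment> \<open>The threshold for the penalty comes with ellipticity; the threshold 1 for the mesh size chosen below
    is arbitrary, because the estimate is proved for each mesh.\<close>
  obtain \<sigma>0 where \<sigma>0: "\<sigma>0 > 0" "\<forall>\<sigma>\<ge>\<sigma>0. ip_elliptic \<Omega> \<T> \<sigma>"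
    using mu unfolding sufficiently_def by blast
  obtain CI where CI: "\<And>\<sigma> T. \<sigma> > 0 \<Longrightarrow> T \<in> \<T> \<Longrightarrow>
      norm_IP2 \<sigma> T (\<Psi> - Pi_h T) \<le> CI \<sigma> * mesh_size T powr \<alpha> * fsobolev_norm2 2 \<alpha> \<Omega> \<Psi>"
    using interpolant(2) by metis
  define C where "C \<sigma> = 2 * (CI \<sigma> * fsobolev_norm2 2 \<alpha> \<Omega> \<Psi> + 2 * C1 \<sigma>)" for \<sigma>
  have bound: "norm_IP2 \<sigma> T (\<Psi> - U) \<le> C \<sigma> * mesh_size T powr \<alpha>"
    if \<sigma>: "\<sigma> > 0" and T: "T \<in> \<T>"
      and U: "local_solution \<Omega> f \<sigma> T (Pi_h T) (2 * C1 \<sigma> * mesh_size T powr \<alpha>) U" for \<sigma> T U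
  proof -
    have tri: "triangulates T \<Omega>" using meshes(1) T by blast
    then have t: "triangulation T" "\<forall>K\<in>T. 2 simplex K" by (auto simp: triangulates_def)
    have P: "fst (Pi_h T) \<in> S20 \<Omega> T" "snd (Pi_h T) \<in> S20 \<Omega> T" using interpolant(1) T by (auto simp: mem_Times_iff)
    have U0: "fst U \<in> S20 \<Omega> T" "snd U \<in> S20 \<Omega> T" and near: "norm_IP2 \<sigma> T (U - Pi_h T) \<le> 2 * C1 \<sigma> * mesh_size T powr \<alpha>"
      using U by (auto simp: local_solution_def ip_solution_def split: prod.splits)
    have \<Psi>: "fst \<Psi> \<in> sobolev0 2 \<Omega>" "snd \<Psi> \<in> sobolev0 2 \<Omega>"
      using regular by (auto simp: regular_solution_def X2_def mem_Times_iff)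
    note B = sobolev0_broken_H2[OF domain tri \<Psi>(1)] sobolev0_broken_H2[OF domain tri \<Psi>(2)]
      S20_broken_H2[OF t(2) P(1)] S20_broken_H2[OF t(2) P(2)] S20_broken_H2[OF t(2) U0(1)] S20_broken_H2[OF t(2) U0(2)]
    have d: "fst (V - W) = (\<lambda>x. fst V x - fst W x)" "snd (V - W) = (\<lambda>x. snd V x - snd W x)" for V W :: fn2
      by (auto simp: fun_eq_iff)
    \<comment> \<open>The distance to the interpolant is an approximation error for \<open>\<Psi>\<close> and at most the radius of the
      ball of local uniqueness for \<open>U\<close>.\<close>
    have "norm_IP2 \<sigma> T ((\<Psi> - Pi_h T) - (U - Pi_h T)) \<le> 2 * (norm_IP2 \<sigma> T (\<Psi> - Pi_h T) + norm_IP2 \<sigma> T (U - Pi_h T))"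
      by (rule norm_IP2_diff[OF \<sigma> t]; unfold d; intro broken_H2_diff B)
    also have "(\<Psi> - Pi_h T) - (U - Pi_h T) = \<Psi> - U"
      by (rule prod_eqI) (auto simp: fun_eq_iff)
    also have "2 * (norm_IP2 \<sigma> T (\<Psi> - Pi_h T) + norm_IP2 \<sigma> T (U - Pi_h T))
        \<le> 2 * (CI \<sigma> * mesh_size T powr \<alpha> * fsobolev_norm2 2 \<alpha> \<Omega> \<Psi> + 2 * C1 \<sigma> * mesh_size T powr \<alpha>)"
      by (intro mult_left_mono add_mono CI[OF \<sigma> T] near) simp
    also have "\<dots> = C \<sigma> * mesh_size T powr \<alpha>" by (simp add: C_def algebra_simps)
    finally show ?thesis .
  qed
  have "sufficiently \<Omega> \<T> (\<lambda>\<sigma> T. \<forall>U. local_solution \<Omega> f \<sigma> T (Pi_h T) (2 * C1 \<sigma> * mesh_size T powr \<alpha>) U \<longrightarrow>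
           norm_IP2 \<sigma> T (\<Psi> - U) \<le> C \<sigma> * mesh_size T powr \<alpha>)"
    unfolding sufficiently_def
  proof (intro exI[of _ \<sigma>0] conjI allI impI exI[of _ 1] ballI)
    fix \<sigma> T U assume "\<sigma>0 \<le> \<sigma>" "T \<in> \<T>"
      "local_solution \<Omega> f \<sigma> T (Pi_h T) (2 * C1 \<sigma> * mesh_size T powr \<alpha>) U"
    then show "norm_IP2 \<sigma> T (\<Psi> - U) \<le> C \<sigma> * mesh_size T powr \<alpha>" using bound \<sigma>0(1) by simp
  qed (use \<sigma>0 in simp_all)
  then show ?thesis by blast
qed

end
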